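(* Let $K\subset\hat{\mathbb{C}}$ be a compactum, $f:\hat{\mathbb{C}}\to\hat{\mathbb{C}}$ a rational function of degree at least $2$, and $L=f^{-1}(K)$. If $u\in L$ and $x\in K$ satisfy $f(u)=x$, then $f\left(\overline{R_{L}}[u]\right)=\overline{R_K}[x]$.
   Context: For disjoint simple closed curves $J_1,J_2\subset\hat{\mathbb{C}}$, $U(J_1,J_2)$ is the component of $\hat{\mathbb{C}}\setminus(J_1\cup J_2)$ with boundary $J_1\cup J_2$. For a compactum $X\subset\hat{\mathbb{C}}$, the Schönflies relation $R_X\subset X\times X$: $x\ne y$ satisfy $(x,y)\in R_X$ if there exist disjoint simple closed curves $J_1\ni x$, $J_2\ni y$ such that $\overline{U(J_1,J_2)}\cap X$ contains an infinite sequence of distinct components $P_n$ each meeting both $J_1$ and $J_2$ whose Hausdorff limit contains $\{x,y\}$. $\overline{R_X}$ is the closure of $R_X$ in $X\times X$, and $\overline{R_X}[z]=\{w\in X:(z,w)\in\overline{R_X}\}$. *)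

theory Defs
  imports "HOL-Analysis.Analysis" "HOL-Computational_Algebra.Computational_Algebra"
begin

text \<open>The Riemann sphere is modelled as the unit sphere in complex \<times> real (= R^3),
  with the chordal (Euclidean) metric; the north pole (0,1) is the point at infinity.\<close>

type_synonym pt = "complex \<times> real"

definition RS :: "pt set" where "RS = sphere 0 1"

definition north :: pt where "north = (0, 1)"

definition stereo_inv :: "complex \<Rightarrow> pt" where
  "stereo_inv z = (of_real (2 / ((cmod z)\<^sup>2 + 1)) * z, ((cmod z)\<^sup>2 - 1) / ((cmod z)\<^sup>2 + 1))"

definition to_plane :: "pt \<Rightarrow> complex" where
  "to_plane P = fst P / of_real (1 - snd P)"

definition rat_sphere :: "complex poly \<Rightarrow> complex poly \<Rightarrow> pt \<Rightarrow> pt" where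
  "rat_sphere p q P =
     (if P = north then
        (if degree q < degree p then north else stereo_inv (coeff p (degree q) / lead_coeff q))
      else (let z = to_plane P in
            if poly q z = 0 then north else stereo_inv (poly p z / poly q z)))"

definition rational_of_degree :: "(pt \<Rightarrow> pt) \<Rightarrow> nat \<Rightarrow> bool" where
  "rational_of_degree f d \<longleftrightarrow>
     (\<exists>p q. q \<noteq> 0 \<and> coprime p q \<and> max (degree p) (degree q) = d \<and>
            (\<forall>P\<in>RS. f P = rat_sphere p q P))"

definition simple_closed_curve :: "pt set \<Rightarrow> bool" where
  "simple_closed_curve J \<longleftrightarrow>
     (\<exists>g. simple_path g \<and> pathfinish g = pathstart g \<and> path_image g = J \<and> J \<subseteq> RS)"

definition is_U :: "pt set \<Rightarrow> pt set \<Rightarrow> pt set \<Rightarrow> bool" where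
  "is_U J1 J2 U \<longleftrightarrow> U \<in> components (RS - (J1 \<union> J2)) \<and>
     (subtopology euclidean RS) frontier_of U = J1 \<union> J2"

definition hausdorff_lim :: "(nat \<Rightarrow> pt set) \<Rightarrow> pt set \<Rightarrow> bool" where
  "hausdorff_lim P Q \<longleftrightarrow> compact Q \<and> Q \<noteq> {} \<and>
     (\<forall>e>0. \<forall>\<^sub>F n in sequentially.
        (\<forall>a\<in>P n. \<exists>b\<in>Q. dist a b < e) \<and> (\<forall>b\<in>Q. \<exists>a\<in>P n. dist a b < e))"

definition schoenflies_rel :: "pt set \<Rightarrow> (pt \<times> pt) set" where
  "schoenflies_rel X = {(x, y). x \<in> X \<and> y \<in> X \<and> x \<noteq> y \<and>
     (\<exists>J1 J2 U P Q. simple_closed_curve J1 \<and> simple_closed_curve J2 \<and> J1 \<inter> J2 = {} \<and>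
        x \<in> J1 \<and> y \<in> J2 \<and> is_U J1 J2 U \<and>
        inj P \<and> (\<forall>n. P n \<in> components (closure U \<inter> X) \<and> P n \<inter> J1 \<noteq> {} \<and> P n \<inter> J2 \<noteq> {}) \<and>
        hausdorff_lim P Q \<and> {x, y} \<subseteq> Q)}"

definition schoenflies_closure :: "pt set \<Rightarrow> (pt \<times> pt) set" where
  "schoenflies_closure X = closure (schoenflies_rel X) \<inter> (X \<times> X)"

definition schoenflies_section :: "pt set \<Rightarrow> pt \<Rightarrow> pt set" where
  "schoenflies_section X z = {w \<in> X. (z, w) \<in> schoenflies_closure X}"

end

theory Submission
  imports Defs "HOL-Complex_Analysis.Great_Picard" "HOL-Real_Asymp.Real_Asymp"
begin

text \<open>
  Off the diagonal, the closure of the Schoenflies relation has a local description: x and y are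
  related iff, for all small neighbourhoods N of x and M of y, infinitely many components of
  X - (N \<union> M) touch both N and M (\<open>linked\<close> below). For one direction take round
  curves about x and y and a Hausdorff convergent sequence of components; the other direction and
  the lifting argument rest on the nonplanarity of the graph K(3,3): at most two of pairwise
  disjoint continua can touch three given pairwise disjoint connected open sets from outside.

  A rational map f of positive degree is a continuous, open, finite-to-one map of the sphere, so it
  maps each component of a preimage of a continuum onto that continuum. Pulling back neighbourhoods
  shows that f maps linked points to linked points. Conversely, if x and y are linked and f(u) = x,
  infinitely many components lift to components touching a neighbourhood of u and one of a point w
  over y; by nonplanarity only finitely many of them touch a neighbourhood of a third point over x
  or y, so that u and w are linked. If f(u) = f(w) for linked u and w, the diagonal pair (f(u), f(u)) is
  reached as a limit, because u is then linked to points at every small distance.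
\<close>

section \<open>Theta curves in the plane\<close>

text \<open>The delicate implication is the one from \<open>schoenflies_rel\<close> to
  \<open>linked\<close>. A Schoenflies pair only provides components of
  \<open>closure U \<inter> X\<close>, and X may join infinitely many of them outside U, along J1
  and J2 away from x and y. Replacing the annulus by small neighbourhoods of x and y therefore needs
  a further set for K(3,3): a connected open set (a hub) on the far side of J1 whose closure
  contains J1 except near x, and likewise for J2. Pieces that reach J1 elsewhere touch this hub, and
  only finitely many can. That such hubs exist is a matter of plane separation, by the theorem of
  Janiszewski.

  Neighbourhoods are preferred to curves because they pull back: the preimage of an annulus is in
  general no annulus, whereas \<open>crossings\<close> speaks of components and closures only, and
  an open map controls both.\<close>

lemma arc_continuous_image:
  assumes "arc g" "continuous_on (path_image g) h" "inj_on h (path_image g)"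
  shows "arc (h \<circ> g)"
proof -
  have "inj_on (h \<circ> g) {0..1}"
    using assms unfolding arc_def path_image_def by (intro comp_inj_on) auto
  then show ?thesis
    using assms path_continuous_image unfolding arc_def by blast
qed

lemma inside_or_outside: "z \<in> inside C \<or> z \<in> outside C \<or> z \<in> C"
  using inside_Un_outside[of C] by blast

lemma inside_not_in: "z \<in> inside C \<Longrightarrow> z \<notin> C \<and> z \<notin> outside C"
  using inside_Un_outside[of C] inside_Int_outside[of C] by blast

lemma outside_not_in: "z \<in> outside C \<Longrightarrow> z \<notin> C \<and> z \<notin> inside C"
  using inside_Un_outside[of C] inside_Int_outside[of C] by blast

lemma connected_subset_inside:
  fixes C :: "'a::real_normed_vector set"
  assumes "connected W" "W \<inter> C = {}" "open (inside C)" "open (outside C)" "W \<inter> inside C \<noteq> {}"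
  shows "W \<subseteq> inside C"
  using assms inside_or_outside[of _ C] inside_Int_outside[of C] connectedD[of W "inside C" "outside C"] by blast

lemma connected_subset_outside:
  fixes C :: "'a::real_normed_vector set"
  assumes "connected W" "W \<inter> C = {}" "open (inside C)" "open (outside C)" "W \<inter> outside C \<noteq> {}"
  shows "W \<subseteq> outside C"
  using assms inside_or_outside[of _ C] inside_Int_outside[of C] connectedD[of W "inside C" "outside C"] by blast

text \<open>If c3 enters the Jordan curve formed by c1 and c2, it cuts the inside into two regions,
  one bounded by c1 and c3, the other by c2 and c3. A connected set off the theta curve that comes
  near the middle of c3 lies in one of them, and the closure of that region misses the middle of c2
  or of c1.\<close>

lemma theta_inside_not_touched:
  fixes c1 c2 c3 :: "real \<Rightarrow> complex"
  assumes arcs: "arc c1" "arc c2" "arc c3"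
    and ends: "pathstart c1 = a" "pathfinish c1 = b" "pathstart c2 = a" "pathfinish c2 = b"
      "pathstart c3 = a" "pathfinish c3 = b"
    and i12: "path_image c1 \<inter> path_image c2 = {a,b}"
    and i13: "path_image c1 \<inter> path_image c3 = {a,b}"
    and i23: "path_image c2 \<inter> path_image c3 = {a,b}"
    and ins: "path_image c3 \<inter> inside (path_image c1 \<union> path_image c2) \<noteq> {}"
    and W: "connected W" "W \<inter> (path_image c1 \<union> path_image c2 \<union> path_image c3) = {}"
    and t: "t1 \<in> closure W" "t1 \<in> path_image c1 - {a,b}" "t2 \<in> closure W" "t2 \<in> path_image c2 - {a,b}"
      "t3 \<in> closure W" "t3 \<in> path_image c3 - {a,b}"
  shows False
proof -
  have ab: "a \<noteq> b"
    using arc_distinct_ends[OF arcs(1)] ends by simp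
  have curve: "simple_path (p +++ reversepath q)" "pathfinish (p +++ reversepath q) = pathstart (p +++ reversepath q)"
      "path_image (p +++ reversepath q) = path_image p \<union> path_image q"
    if "arc p" "arc q" "pathstart p = a" "pathfinish p = b" "pathstart q = a" "pathfinish q = b"
      "path_image p \<inter> path_image q = {a,b}" for p q :: "real \<Rightarrow> complex"
  proof -
    show "simple_path (p +++ reversepath q)"
      using that by (intro simple_path_join_loop) (auto simp: arc_reversepath)
    show "pathfinish (p +++ reversepath q) = pathstart (p +++ reversepath q)"
      using that by simp
    show "path_image (p +++ reversepath q) = path_image p \<union> path_image q"
      using that by (simp add: path_image_join)
  qed
  note J = Jordan_inside_outside[OF curve(1,2)]
  define P1 P2 P3 where P_def: "P1 = path_image c1" "P2 = path_image c2" "P3 = path_image c3"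
  have J12: "open (inside (P1 \<union> P2))" "open (outside (P1 \<union> P2))"
    using J[OF arcs(1,2) ends(1-4) i12 arcs(1,2) ends(1-4) i12] curve(3)[OF arcs(1,2) ends(1-4) i12] by (simp_all add: P_def)
  have J13: "open (inside (P1 \<union> P3))" "frontier (inside (P1 \<union> P3)) = P1 \<union> P3"
    using J[OF arcs(1,3) ends(1,2,5,6) i13 arcs(1,3) ends(1,2,5,6) i13] curve(3)[OF arcs(1,3) ends(1,2,5,6) i13] by (simp_all add: P_def)
  have J23: "open (inside (P2 \<union> P3))" "frontier (inside (P2 \<union> P3)) = P2 \<union> P3"
    using J[OF arcs(2,3) ends(3-6) i23 arcs(2,3) ends(3-6) i23] curve(3)[OF arcs(2,3) ends(3-6) i23] by (simp_all add: P_def)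
  obtain d: "inside (P1 \<union> P3) \<inter> inside (P2 \<union> P3) = {}"
      and u: "inside (P1 \<union> P3) \<union> inside (P2 \<union> P3) \<union> (P3 - {a,b}) = inside (P1 \<union> P2)"
    using split_inside_simple_closed_curve[of c1 a b c2 c3] arcs ends i12 i13 i23 ins ab
    by (auto simp: P_def arc_imp_simple_path)
  have t3: "t3 \<in> inside (P1 \<union> P2)"
    using t(6) u by (auto simp: P_def)
  have "W \<inter> inside (P1 \<union> P2) \<noteq> {}"
    using t3 t(5) J12(1) by (metis Int_commute disjoint_iff open_Int_closure_eq_empty)
  then have Win: "W \<subseteq> inside (P1 \<union> P2)"
    using W J12 by (intro connected_subset_inside) (auto simp: P_def)
  have "W \<subseteq> inside (P1 \<union> P3) \<union> inside (P2 \<union> P3)"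
    using Win u W(2) by (auto simp: P_def)
  then consider "W \<subseteq> inside (P1 \<union> P3)" | "W \<subseteq> inside (P2 \<union> P3)"
    using W(1) J13(1) J23(1) d connectedD[of W "inside (P1 \<union> P3)" "inside (P2 \<union> P3)"] by blast
  then show False
  proof cases
    case 1
    then have "t2 \<in> closure (inside (P1 \<union> P3))"
      using t(3) closure_mono by blast
    then have "t2 \<in> inside (P1 \<union> P3) \<union> (P1 \<union> P3)"
      using J13(2) by (metis closure_Un_frontier)
    moreover have "t2 \<notin> P1 \<union> P3"
      using t(4) i12 i23 by (auto simp: P_def)
    moreover have "t2 \<notin> inside (P1 \<union> P2)"
      using t(4) inside_not_in unfolding P_def by blast
    ultimately show False using u by blast
  next
    case 2
    then have "t1 \<in> closure (inside (P2 \<union> P3))"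
      using t(1) closure_mono by blast
    then have "t1 \<in> inside (P2 \<union> P3) \<union> (P2 \<union> P3)"
      using J23(2) by (metis closure_Un_frontier)
    moreover have "t1 \<notin> P2 \<union> P3"
      using t(2) i12 i13 by (auto simp: P_def)
    moreover have "t1 \<notin> inside (P1 \<union> P2)"
      using t(2) inside_not_in unfolding P_def by blast
    ultimately show False using u by blast
  qed
qed

text \<open>This inversion turns the outer arc of a theta curve into an inner one. The outside and
  the inside without p both have connected images off the image curve. If the outside were not sent
  inwards, the inside without p would be; but points near p are sent arbitrarily far away, and the
  inside of a Jordan curve is bounded.\<close>

lemma inversion_outside_subset_inside:
  fixes c :: "real \<Rightarrow> complex"
  assumes c: "simple_path c" "pathfinish c = pathstart c" and p: "p \<in> inside (path_image c)"
  shows "(\<lambda>z. inverse (z - p)) ` outside (path_image c) \<subseteq> inside ((\<lambda>z. inverse (z - p)) ` path_image c)"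
proof -
  define C where "C = path_image c"
  define \<phi> where "\<phi> = (\<lambda>z. inverse (z - p))"
  have J: "open (inside C)" "connected (inside C)" "connected (outside C)"
    using Jordan_inside_outside[OF c] by (simp_all add: C_def)
  have pC: "p \<notin> C" "p \<notin> outside C"
    using p inside_not_in unfolding C_def by blast+
  have cont: "continuous_on (-{p}) \<phi>"
    unfolding \<phi>_def by (intro continuous_intros) auto
  have inj: "inj \<phi>" by (auto simp: \<phi>_def inj_def)
  define c' where "c' = \<phi> \<circ> c"
  have im: "path_image c' = \<phi> ` C"
    by (simp add: c'_def path_image_compose C_def)
  have c': "simple_path c'" "pathfinish c' = pathstart c'"
    unfolding c'_def
    using c pC cont by (auto intro!: simple_path_continuous_image continuous_on_subset[OF cont] inj_on_subset[OF inj] simp: C_def pathfinish_compose pathstart_compose)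
  have J': "open (inside (\<phi> ` C))" "inside (\<phi> ` C) \<noteq> {}" "open (outside (\<phi> ` C))" "bounded (inside (\<phi> ` C))"
    using Jordan_inside_outside[OF c'] by (simp_all add: im)
  have alt: "\<phi> ` A \<subseteq> inside (\<phi> ` C)" if "connected A" "p \<notin> A" "A \<inter> C = {}" "\<phi> ` A \<inter> inside (\<phi> ` C) \<noteq> {}" for A
  proof -
    have "connected (\<phi> ` A)"
      using that by (intro connected_continuous_image continuous_on_subset[OF cont]) auto
    moreover have "\<phi> ` A \<inter> \<phi> ` C = {}"
      using that inj by (auto simp: inj_def)
    ultimately show ?thesis
      using J' that(4) by (intro connected_subset_inside) auto
  qed
  have "\<phi> ` outside C \<inter> inside (\<phi> ` C) \<noteq> {}"
  proof
    assume e: "\<phi> ` outside C \<inter> inside (\<phi> ` C) = {}"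
    \<comment> \<open>As \<open>inverse 0 = 0\<close>, the map \<phi> is injective everywhere with
      value 0 at p; a nonzero \<zeta> comes from a point other than p.\<close>
    obtain \<zeta> where \<zeta>: "\<zeta> \<in> inside (\<phi> ` C)" "\<zeta> \<noteq> 0"
    proof -
      have "\<not> inside (\<phi> ` C) \<subseteq> {0}"
        using finite_imp_not_open[OF _ J'(1)] J'(2) finite_subset[of _ "{0}"] by blast
      then show ?thesis using that by blast
    qed
    define z where "z = p + inverse \<zeta>"
    have z: "\<phi> z = \<zeta>" "z \<noteq> p" using \<zeta> by (auto simp: \<phi>_def z_def)
    have "z \<notin> C" using z \<zeta> inside_not_in by blast
    moreover have "z \<notin> outside C" using e z \<zeta> by blast
    ultimately have zin: "z \<in> inside C - {p}" using inside_or_outside z by blast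
    have "\<phi> ` (inside C - {p}) \<subseteq> inside (\<phi> ` C)"
    proof (rule alt)
      show "connected (inside C - {p})"
        using J by (intro connected_open_delete) auto
      show "\<phi> ` (inside C - {p}) \<inter> inside (\<phi> ` C) \<noteq> {}" using zin z \<zeta> by blast
      show "p \<notin> inside C - {p}" by blast
      show "(inside C - {p}) \<inter> C = {}" using inside_not_in by blast
    qed
    then have "bounded (\<phi> ` (inside C - {p}))" using J' bounded_subset by blast
    then obtain M where M: "M > 0" "\<And>w. w \<in> inside C - {p} \<Longrightarrow> norm (\<phi> w) \<le> M"
      unfolding bounded_pos by blast
    obtain e where e: "e > 0" "ball p e \<subseteq> inside C"
      using J p by (metis C_def open_contains_ball)
    \<comment> \<open>With this radius the value of \<phi> at p + r has norm 1/r, which is at least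
      twice the bound M.\<close>
    define r where "r = min (e/2) (inverse (2*M))"
    have r: "r > 0" "r < e" "r \<le> inverse (2*M)"
      using e M unfolding r_def by auto
    have "p + of_real r \<in> inside C - {p}"
      using e r by (auto simp: dist_norm subset_iff)
    from M(2)[OF this] have "inverse r \<le> M"
      using r by (simp add: \<phi>_def norm_inverse)
    moreover have "inverse r \<ge> 2 * M"
      using r M by (simp add: field_simps)
    ultimately show False using M by linarith
  qed
  then show ?thesis
    using alt[of "outside C"] J pC outside_not_in[of _ C] unfolding C_def[symmetric] \<phi>_def[symmetric] by blast
qed

text \<open>If c3 avoids the inside of the curve formed by c1 and c2, then t3, and with it W, lies
  outside. Inversion at an inner point p moves both inwards, which is the case already
  treated.\<close>

lemma theta_not_touched:
  fixes c1 c2 c3 :: "real \<Rightarrow> complex"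
  assumes arcs: "arc c1" "arc c2" "arc c3"
    and ends: "pathstart c1 = a" "pathfinish c1 = b" "pathstart c2 = a" "pathfinish c2 = b"
      "pathstart c3 = a" "pathfinish c3 = b"
    and i12: "path_image c1 \<inter> path_image c2 = {a,b}"
    and i13: "path_image c1 \<inter> path_image c3 = {a,b}"
    and i23: "path_image c2 \<inter> path_image c3 = {a,b}"
    and W: "connected W" "W \<inter> (path_image c1 \<union> path_image c2 \<union> path_image c3) = {}"
    and t: "t1 \<in> closure W" "t1 \<in> path_image c1 - {a,b}" "t2 \<in> closure W" "t2 \<in> path_image c2 - {a,b}"
      "t3 \<in> closure W" "t3 \<in> path_image c3 - {a,b}"
  shows False
proof (cases "path_image c3 \<inter> inside (path_image c1 \<union> path_image c2) = {}")
  case False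
  then show False using theta_inside_not_touched[OF arcs ends i12 i13 i23 _ W t] by blast
next
  case True
  define c where "c = c1 +++ reversepath c2"
  have c: "simple_path c" "pathfinish c = pathstart c"
    unfolding c_def
    using arcs ends i12 by (auto intro!: simple_path_join_loop simp: arc_reversepath)
  have cim: "path_image c = path_image c1 \<union> path_image c2"
    using arcs ends by (simp add: c_def path_image_join)
  define C where "C = path_image c"
  have J: "open (inside C)" "open (outside C)" "inside C \<noteq> {}"
    using Jordan_inside_outside[OF c] by (simp_all add: C_def)
  have t3: "t3 \<in> outside C"
    using True t(6) i13 i23 inside_or_outside[of t3 C] by (auto simp: C_def cim)
  have "W \<inter> outside C \<noteq> {}"
    using t3 t(5) J(2) by (metis Int_commute disjoint_iff open_Int_closure_eq_empty)
  then have Wout: "W \<subseteq> outside C"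
    using W J by (intro connected_subset_outside) (auto simp: C_def cim)
  obtain p where p: "p \<in> inside C" using J by blast
  \<comment> \<open>With p off \<open>closure W\<close>, the inversion is continuous there and
    carries the touching points along.\<close>
  have clW: "p \<notin> closure W"
  proof
    assume "p \<in> closure W"
    then have "inside C \<inter> W \<noteq> {}"
      using p J(1) by (metis disjoint_iff open_Int_closure_eq_empty)
    then show False using Wout inside_not_in by blast
  qed
  have pC: "p \<notin> path_image c1" "p \<notin> path_image c2" "p \<notin> path_image c3"
    using p inside_not_in[of p C] True by (auto simp: C_def cim)
  define \<phi> where "\<phi> = (\<lambda>z. inverse (z - p))"
  have cont: "continuous_on (-{p}) \<phi>"
    unfolding \<phi>_def by (intro continuous_intros) auto
  have inj: "inj \<phi>" by (auto simp: \<phi>_def inj_def)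
  have arc': "arc (\<phi> \<circ> g)" if "arc g" "p \<notin> path_image g" for g
    using that by (intro arc_continuous_image continuous_on_subset[OF cont] inj_on_subset[OF inj]) auto
  have int': "path_image (\<phi> \<circ> g) \<inter> path_image (\<phi> \<circ> h) = {\<phi> a, \<phi> b}" if "path_image g \<inter> path_image h = {a,b}" for g h
    unfolding path_image_compose image_Int[OF inj, symmetric] that by simp
  have mem: "\<phi> x \<in> path_image (\<phi> \<circ> g) - {\<phi> a, \<phi> b}" if "x \<in> path_image g - {a,b}" for x g
    using that inj by (auto simp: path_image_compose inj_eq)
  have cl: "\<phi> x \<in> closure (\<phi> ` W)" if "x \<in> closure W" for x
  proof -
    have "continuous_on (closure W) \<phi>"
      using clW by (intro continuous_on_subset[OF cont]) blast
    then have "\<phi> ` closure W \<subseteq> closure (\<phi> ` W)"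
      by (rule image_closure_subset) (simp_all add: closure_subset)
    then show ?thesis using that by blast
  qed
  show False
  proof (rule theta_inside_not_touched[of "\<phi> \<circ> c1" "\<phi> \<circ> c2" "\<phi> \<circ> c3" "\<phi> a" "\<phi> b" "\<phi> ` W" "\<phi> t1" "\<phi> t2" "\<phi> t3"])
    have "\<phi> ` outside C \<subseteq> inside (\<phi> ` C)"
      using inversion_outside_subset_inside[OF c, of p] p by (simp add: C_def \<phi>_def)
    moreover have "\<phi> ` C = path_image (\<phi> \<circ> c1) \<union> path_image (\<phi> \<circ> c2)"
      by (simp add: C_def cim path_image_compose image_Un)
    moreover have "\<phi> t3 \<in> path_image (\<phi> \<circ> c3)" using mem[OF t(6)] by blast
    ultimately show "path_image (\<phi> \<circ> c3) \<inter> inside (path_image (\<phi> \<circ> c1) \<union> path_image (\<phi> \<circ> c2)) \<noteq> {}"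
      using t3 by auto
    show "connected (\<phi> ` W)"
      using W clW closure_subset by (intro connected_continuous_image continuous_on_subset[OF cont]) auto
    show "\<phi> ` W \<inter> (path_image (\<phi> \<circ> c1) \<union> path_image (\<phi> \<circ> c2) \<union> path_image (\<phi> \<circ> c3)) = {}"
      using W(2) inj by (auto simp: path_image_compose inj_eq)
  qed (simp_all add: arcs pC ends i12 i13 i23 t arc' int' mem cl pathstart_compose pathfinish_compose del: Diff_iff)
qed

section \<open>First hits of paths, and stars with three prescribed ends\<close>

lemma path_first_hit:
  assumes "path g" "closed S" "pathfinish g \<in> S"
  obtains s where "s \<in> {0..1}" "g s \<in> S" "\<And>u. 0 \<le> u \<Longrightarrow> u < s \<Longrightarrow> g u \<notin> S"
proof -
  define T where "T = {u \<in> {0..1}. g u \<in> S}"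
  have "closed T"
    using continuous_closed_preimage[of "{0..1}" g S] assms
    by (simp add: T_def path_def vimage_def Int_def)
  moreover have "1 \<in> T" using assms by (auto simp: T_def pathfinish_def)
  moreover have bdd: "bdd_below T" by (auto simp: T_def intro: bdd_belowI[of _ 0])
  ultimately have "Inf T \<in> T" by (intro closed_contains_Inf) auto
  show ?thesis
  proof (rule that)
    show "Inf T \<in> {0..1}" "g (Inf T) \<in> S" using \<open>Inf T \<in> T\<close> by (auto simp: T_def)
    fix u assume "0 \<le> u" "u < Inf T"
    then show "g u \<notin> S"
      using \<open>Inf T \<in> T\<close> cInf_lower[OF _ bdd, of u] by (force simp: T_def)
  qed
qed

lemma arc_first_hit:
  fixes X S :: "'a::{complete_space,real_normed_vector} set"
  assumes X: "path_connected X" "x \<in> X" "y \<in> X" and S: "closed S" "x \<notin> S" "y \<in> S"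
  obtains g a where "arc g" "pathstart g = x" "pathfinish g = a" "a \<in> S" "path_image g \<subseteq> X"
    "path_image g \<inter> S = {a}"
proof -
  obtain p where p: "path p" "path_image p \<subseteq> X" "pathstart p = x" "pathfinish p = y"
    using X by (meson path_connected_def)
  obtain q where q: "arc q" "path_image q \<subseteq> path_image p" "pathstart q = x" "pathfinish q = y"
    using path_contains_arc[OF p(1,3,4)] S by blast
  obtain s where s: "s \<in> {0..1}" "q s \<in> S" "\<And>u. 0 \<le> u \<Longrightarrow> u < s \<Longrightarrow> q u \<notin> S"
    using path_first_hit[of q S] q S arc_imp_path by metis
  have s0: "s \<noteq> 0" using q(3) s(2) S(2) by (metis pathstart_def)
  have im: "path_image (subpath 0 s q) = q ` {0..s}"
    using s by (simp add: path_image_subpath)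
  show ?thesis
  proof
    show "arc (subpath 0 s q)"
      using q s s0 by (intro arc_subpath_arc) auto
    show "pathstart (subpath 0 s q) = x" "pathfinish (subpath 0 s q) = q s"
      using q by (simp_all add: pathstart_def[of q])
    show "q s \<in> S" by fact
    show "path_image (subpath 0 s q) \<subseteq> X"
    proof -
      have "path_image (subpath 0 s q) \<subseteq> path_image q" unfolding im path_image_def[of q] using s(1) by (intro image_mono) auto
      then show ?thesis using q(2) p(2) by (meson subset_trans)
    qed
    show "path_image (subpath 0 s q) \<inter> S = {q s}"
    proof -
      have "q u = q s" if "u \<in> {0..s}" "q u \<in> S" for u using s(3)[of u] that by (cases "u = s") auto
      then show ?thesis unfolding im using s(1,2) by auto
    qed
  qed
qed

lemma exhaust_3_zero: "(j::3) = 0 \<or> j = 1 \<or> j = 2"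
  using exhaust_3[of j] by auto

lemma subset_Un_pair: "A \<subseteq> X \<union> {p, q} \<Longrightarrow> q \<notin> A \<Longrightarrow> A \<subseteq> X \<union> {p}"
  and subset_Un_pair': "A \<subseteq> X \<union> {p, q} \<Longrightarrow> p \<notin> A \<Longrightarrow> A \<subseteq> X \<union> {q}"
  by blast+

text \<open>An arc between two of the ends, together with an arc from the third end to its first hit
  on it, is a star centred at the hit. Since X stays path-connected with any selection of the ends
  adjoined, the first arc can avoid \<open>t 2\<close> and the second can avoid \<open>t 0\<close>
  and \<open>t 1\<close>, which keeps the centre in X.\<close>

lemma star_3:
  fixes X :: "'a::{complete_space,real_normed_vector} set" and t :: "3 \<Rightarrow> 'a"
  assumes X: "\<And>T. path_connected (X \<union> t ` T)" and t: "inj t" "\<And>j. t j \<notin> X"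
  obtains a r where "a \<in> X" "\<And>j. arc (r j)" "\<And>j. pathstart (r j) = a" "\<And>j. pathfinish (r j) = t j"
    "\<And>j. path_image (r j) \<subseteq> X \<union> {t j}" "\<And>j k. j \<noteq> k \<Longrightarrow> path_image (r j) \<inter> path_image (r k) = {a}"
proof -
  have t012: "t 0 \<noteq> t 1" "t 0 \<noteq> t 2" "t 1 \<noteq> t 2"
    using t(1) by (simp_all add: inj_eq)
  obtain \<gamma> where \<gamma>: "arc \<gamma>" "pathstart \<gamma> = t 0" "pathfinish \<gamma> = t 1" "path_image \<gamma> \<subseteq> X \<union> {t 0, t 1}"
  proof (rule arc_first_hit[OF X[of "{0,1}"], of "t 0" "t 1" "{t 1}"])
    fix g a assume "arc g" "pathstart g = t 0" "pathfinish g = a" "a \<in> {t 1}" "path_image g \<subseteq> X \<union> t ` {0, 1}"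
    then show thesis using that[of g] by simp
  qed (use t012 in auto)
  have inj: "inj_on \<gamma> {0..1}" using \<gamma> by (simp add: arc_def)
  have ends: "\<gamma> 0 = t 0" "\<gamma> 1 = t 1" using \<gamma> by (auto simp: pathstart_def pathfinish_def)
  \<comment> \<open>Some point of \<gamma> in X is needed as the target of the path from
    \<open>t 2\<close>; the ends of \<gamma> lie outside X.\<close>
  have mid: "\<gamma> (1/2) \<in> path_image \<gamma>" by (auto simp: path_image_def)
  have "\<gamma> (1/2) \<noteq> \<gamma> 0" "\<gamma> (1/2) \<noteq> \<gamma> 1"
    using inj_onD[OF inj, of "1/2" 0] inj_onD[OF inj, of "1/2" 1] by auto
  then have midX: "\<gamma> (1/2) \<in> X" using mid \<gamma>(4) ends by auto
  have t2: "t 2 \<notin> path_image \<gamma>" using \<gamma>(4) t012 t(2)[of 2] by auto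
  obtain \<zeta> a where \<zeta>: "arc \<zeta>" "pathstart \<zeta> = t 2" "pathfinish \<zeta> = a" "a \<in> path_image \<gamma>"
     "path_image \<zeta> \<subseteq> X \<union> {t 2}" "path_image \<zeta> \<inter> path_image \<gamma> = {a}"
  proof (rule arc_first_hit[OF X[of "{2}"], of "t 2" "\<gamma> (1/2)" "path_image \<gamma>"])
    fix g a assume "arc g" "pathstart g = t 2" "pathfinish g = a" "a \<in> path_image \<gamma>" "path_image g \<subseteq> X \<union> t ` {2}"
      "path_image g \<inter> path_image \<gamma> = {a}"
    then show thesis using that[of g a] by simp
  qed (use mid midX t2 \<gamma>(1) in \<open>auto simp: arc_imp_path closed_path_image\<close>)
  have "a \<in> path_image \<zeta>" using \<zeta> by blast
  moreover have "a \<noteq> t 2" using \<zeta>(4) t2 by blast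
  ultimately have aX: "a \<in> X" using \<zeta>(5) by auto
  obtain s where s: "s \<in> {0..1}" "\<gamma> s = a" using \<zeta>(4) by (auto simp: path_image_def)
  have s01: "s \<noteq> 0" "s \<noteq> 1" using s aX ends t(2)[of 0] t(2)[of 1] by auto
  have im0: "path_image (subpath s 0 \<gamma>) = \<gamma> ` {0..s}" and im1: "path_image (subpath s 1 \<gamma>) = \<gamma> ` {s..1}"
    using s s01 by (simp_all add: path_image_subpath_gen closed_segment_eq_real_ivl)
  have im01: "\<gamma> ` {0..s} \<union> \<gamma> ` {s..1} \<subseteq> path_image \<gamma>"
    using s by (auto simp: path_image_def)
  define r where "r = (\<lambda>j::3. if j = 0 then subpath s 0 \<gamma> else if j = 1 then subpath s 1 \<gamma> else reversepath \<zeta>)"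
  have r: "r 0 = subpath s 0 \<gamma>" "r 1 = subpath s 1 \<gamma>" "r 2 = reversepath \<zeta>"
    by (simp_all add: r_def)
  have I01: "\<gamma> ` {0..s} \<inter> \<gamma> ` {s..1} = {a}"
  proof
    show "{a} \<subseteq> \<gamma> ` {0..s} \<inter> \<gamma> ` {s..1}" using s by auto
    show "\<gamma> ` {0..s} \<inter> \<gamma> ` {s..1} \<subseteq> {a}"
    proof clarsimp
      fix u v assume "\<gamma> u = \<gamma> v" "0 \<le> u" "u \<le> s" "s \<le> v" "v \<le> 1"
      moreover from this have "u = v" using inj_onD[OF inj, of u v] s by auto
      ultimately have "v = s" by simp
      then show "\<gamma> v = a" using s by simp
    qed
  qed
  have X0: "\<gamma> ` {0..s} \<subseteq> X \<union> {t 0}"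
  proof -
    have "t 1 \<notin> \<gamma> ` {0..s}"
    proof
      assume "t 1 \<in> \<gamma> ` {0..s}"
      then obtain u where "u \<in> {0..s}" "\<gamma> u = \<gamma> 1" using ends by auto
      then show False using inj_onD[OF inj, of u 1] s s01 by auto
    qed
    moreover have "\<gamma> ` {0..s} \<subseteq> X \<union> {t 0, t 1}" using im01 by (intro order_trans[OF _ \<gamma>(4)]) simp
    ultimately show ?thesis by (rule subset_Un_pair[rotated])
  qed
  have X1: "\<gamma> ` {s..1} \<subseteq> X \<union> {t 1}"
  proof -
    have "t 0 \<notin> \<gamma> ` {s..1}"
    proof
      assume "t 0 \<in> \<gamma> ` {s..1}"
      then obtain u where "u \<in> {s..1}" "\<gamma> u = \<gamma> 0" using ends by auto
      then show False using inj_onD[OF inj, of u 0] s s01 by auto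
    qed
    moreover have "\<gamma> ` {s..1} \<subseteq> X \<union> {t 0, t 1}" using im01 by (intro order_trans[OF _ \<gamma>(4)]) simp
    ultimately show ?thesis by (rule subset_Un_pair'[rotated])
  qed
  define A0 A1 Z where A_def: "A0 = \<gamma> ` {0..s}" "A1 = \<gamma> ` {s..1}" "Z = path_image \<zeta>"
  have A: "A0 \<inter> A1 = {a}" "A0 \<inter> Z = {a}" "A1 \<inter> Z = {a}"
  proof -
    have "A0 \<inter> A1 = {a}" using I01 by (simp add: A_def)
    moreover have "A0 \<union> A1 \<subseteq> path_image \<gamma>" using im01 by (simp add: A_def)
    moreover have "Z \<inter> path_image \<gamma> = {a}" using \<zeta>(6) by (simp add: A_def)
    ultimately show "A0 \<inter> A1 = {a}" "A0 \<inter> Z = {a}" "A1 \<inter> Z = {a}" by blast+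
  qed
  show ?thesis
  proof (rule that)
    show "a \<in> X" by (rule aX)
    show "arc (r j)" for j
      using exhaust_3_zero[of j] r s s01 \<gamma>(1) \<zeta>(1) by (auto simp: arc_reversepath intro!: arc_subpath_arc)
    show "pathstart (r j) = a" "pathfinish (r j) = t j" for j
      using exhaust_3_zero[of j] r s ends \<zeta>(2,3) by auto
    show "path_image (r j) \<subseteq> X \<union> {t j}" for j
      using exhaust_3_zero[of j]
      by (elim disjE) (simp_all only: r im0 im1 X0 X1 \<zeta>(5) path_image_reversepath)
    show "path_image (r j) \<inter> path_image (r k) = {a}" if "j \<noteq> k" for j k
    proof -
      have P: "path_image (r 0) \<inter> path_image (r 1) = {a}" "path_image (r 0) \<inter> path_image (r 2) = {a}"
        "path_image (r 1) \<inter> path_image (r 2) = {a}"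
        unfolding r im0 im1 path_image_reversepath using A by (simp_all add: A_def)
      show ?thesis using exhaust_3_zero[of j] exhaust_3_zero[of k] that P by (auto simp: Int_commute)
    qed
  qed
qed

lemma finite_small_positive:
  fixes d :: "'i::finite \<Rightarrow> real"
  assumes "\<And>i. d i > 0"
  obtains e where "e > 0" "\<And>i. e < d i"
proof -
  have "Min (range d) > 0" using assms by simp
  moreover have "Min (range d) \<le> d i" for i by simp
  ultimately show ?thesis
    using that[of "Min (range d) / 2"] by (smt (verit, best) field_sum_of_halves)
qed

lemma path_first_hit_image:
  assumes "path g" "closed S" "pathfinish g \<in> S" "pathstart g \<notin> S"
  obtains s where "0 < s" "s \<le> 1" "g s \<in> S" "g ` {0..<s} \<inter> S = {}"
proof -
  obtain s where s: "s \<in> {0..1}" "g s \<in> S" "\<And>u. 0 \<le> u \<Longrightarrow> u < s \<Longrightarrow> g u \<notin> S"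
    using path_first_hit[OF assms(1-3)] by blast
  have "s \<noteq> 0" using s(2) assms(4) by (auto simp: pathstart_def)
  moreover have "g ` {0..<s} \<inter> S = {}" using s(3) by auto
  ultimately show ?thesis using s(1,2) that[of s] by auto
qed

lemma half_open_path_closure:
  assumes "path g" "0 < s" "s \<le> 1"
  shows "g s \<in> closure (g ` {0..<s})"
proof -
  have "continuous_on {0..s} g"
    using assms by (auto simp: path_def elim: continuous_on_subset)
  then have "g ` closure {0..<s} \<subseteq> closure (g ` {0..<s})"
    using assms by (intro image_closure_subset) (auto simp: closure_subset)
  then show ?thesis using assms by auto
qed

lemma half_open_path_connected:
  assumes "path g" "s \<le> 1"
  shows "path_connected (g ` {0..<s})" "path_connected (g ` {0..s})"
  using assms unfolding path_def
  by (auto intro!: path_connected_continuous_image convex_imp_path_connected elim: continuous_on_subset)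

lemma path_connected_Un_family:
  assumes "path_connected A" "\<And>j. j \<in> J \<Longrightarrow> path_connected (S j)" "\<And>j. j \<in> J \<Longrightarrow> A \<inter> S j \<noteq> {}"
  shows "path_connected (A \<union> (\<Union>j\<in>J. S j))"
proof (cases "A = {}")
  case True
  then have "J = {}" using assms(3) by blast
  then show ?thesis using True by simp
next
  case False
  then obtain x where x: "x \<in> A" by blast
  have *: "path_component (A \<union> (\<Union>j\<in>J. S j)) x y" if y: "y \<in> A \<union> (\<Union>j\<in>J. S j)" for y
  proof (cases "y \<in> A")
    case True
    then have "path_component A x y"
      using assms(1) x by (simp add: path_connected_component)
    then show ?thesis by (rule path_component_of_subset[rotated]) simp
  next
    case False
    then obtain j where j: "j \<in> J" "y \<in> S j" using y by blast
    have "path_connected (A \<union> S j)" using assms j by (intro path_connected_Un) auto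
    then have "path_component (A \<union> S j) x y"
      using x j by (simp add: path_connected_component)
    then show ?thesis by (rule path_component_of_subset[rotated]) (use j in auto)
  qed
  show ?thesis
    unfolding path_connected_component using path_component_trans[OF path_component_sym[OF *] *] by simp
qed

section \<open>Nonplanarity of $K_{3,3}$ for continua\<close>

lemma disjoint_subsets: "R \<subseteq> X \<Longrightarrow> Q \<subseteq> Y \<Longrightarrow> X \<inter> Y = {} \<Longrightarrow> R \<inter> Q = {}"
  by blast

text \<open>The stars in A 0 and A 1, joined through N 0, N 1 and N 2, form a theta curve with ends
  at the two centres. Paths from a point of A 2 into the three N j reach its three arcs, which
  \<open>theta_not_touched\<close> forbids. The edges end at ports \<open>t i j\<close> just outside
  N j; the larger, pairwise disjoint M j contain the ports and confine each passage.\<close>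

lemma K33_graph:
  fixes t :: "3 \<Rightarrow> 3 \<Rightarrow> complex" and A N M :: "3 \<Rightarrow> complex set"
  assumes A: "\<And>i T. path_connected (A i \<union> t i ` T)"
    and N: "\<And>j T. path_connected (N j \<union> (\<lambda>i. t i j) ` T)" "\<And>j. N j \<noteq> {}" "\<And>j. N j \<subseteq> M j" "\<And>i j. t i j \<in> M j"
    and AA: "\<And>i k. i \<noteq> k \<Longrightarrow> A i \<inter> A k = {}" and AM: "\<And>i j. A i \<inter> M j = {}"
    and MM: "\<And>j l. j \<noteq> l \<Longrightarrow> M j \<inter> M l = {}"
    and t: "\<And>i k j. t i j = t k j \<Longrightarrow> i = k" and tN: "\<And>i j. t i j \<notin> N j"
  shows False
proof -
  have A01: "A 0 \<inter> A 1 = {}" and A20: "A 2 \<inter> A 0 = {}" and A21: "A 2 \<inter> A 1 = {}"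
    by (simp_all add: AA)
  have tinj: "inj (t i)" for i
    using MM N(4) by (auto simp: inj_def) (metis disjoint_iff)
  have tA: "t i j \<notin> A k" for i j k using AM[of k j] N(4)[of i j] by blast
  have star: "\<exists>a r. a \<in> A i \<and> (\<forall>j. arc (r j) \<and> pathstart (r j) = a \<and> pathfinish (r j) = t i j \<and>
      path_image (r j) \<subseteq> A i \<union> {t i j} \<and> (\<forall>k. j \<noteq> k \<longrightarrow> path_image (r j) \<inter> path_image (r k) = {a}))" for i
  proof (rule star_3[of "A i" "t i"])
    fix a r
    assume "a \<in> A i" "\<And>j. arc (r j)" "\<And>j. pathstart (r j) = a" "\<And>j. pathfinish (r j) = t i j"
      "\<And>j. path_image (r j) \<subseteq> A i \<union> {t i j}" "\<And>j k. j \<noteq> k \<Longrightarrow> path_image (r j) \<inter> path_image (r k) = {a}"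
    then show ?thesis by (intro exI[of _ a] exI[of _ r]) simp
  qed (use A tinj tA in auto)
  obtain a r where a: "a \<in> A 0" and ar: "\<forall>j. arc (r j) \<and> pathstart (r j) = a \<and> pathfinish (r j) = t 0 j \<and>
      path_image (r j) \<subseteq> A 0 \<union> {t 0 j} \<and> (\<forall>k. j \<noteq> k \<longrightarrow> path_image (r j) \<inter> path_image (r k) = {a})"
    using star[of 0] by (elim exE conjE)
  have r: "arc (r j)" "pathstart (r j) = a" "pathfinish (r j) = t 0 j"
      and rA: "path_image (r j) \<subseteq> A 0 \<union> {t 0 j}"
      and rr: "j \<noteq> k \<Longrightarrow> path_image (r j) \<inter> path_image (r k) = {a}" for j k
    using ar by simp_all
  obtain b q where b: "b \<in> A 1" and bq: "\<forall>j. arc (q j) \<and> pathstart (q j) = b \<and> pathfinish (q j) = t 1 j \<and>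
      path_image (q j) \<subseteq> A 1 \<union> {t 1 j} \<and> (\<forall>k. j \<noteq> k \<longrightarrow> path_image (q j) \<inter> path_image (q k) = {b})"
    using star[of 1] by (elim exE conjE)
  have q: "arc (q j)" "pathstart (q j) = b" "pathfinish (q j) = t 1 j"
      and qA: "path_image (q j) \<subseteq> A 1 \<union> {t 1 j}"
      and qq: "j \<noteq> k \<Longrightarrow> path_image (q j) \<inter> path_image (q k) = {b}" for j k
    using bq by simp_all
  obtain z where z: "z \<in> A 2" using star[of 2] by blast
  have "\<exists>m. arc m \<and> pathstart m = t 0 j \<and> pathfinish m = t 1 j \<and> path_image m \<subseteq> N j \<union> {t 0 j, t 1 j}" for j
  proof (rule arc_first_hit[OF N(1)[of j "{0,1}"], of "t 0 j" "t 1 j" "{t 1 j}"])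
    show "t 0 j \<notin> {t 1 j}" using t[of 0 j 1] by auto
    fix g x assume "arc g" "pathstart g = t 0 j" "pathfinish g = x" "x \<in> {t 1 j}" "path_image g \<subseteq> N j \<union> (\<lambda>i. t i j) ` {0, 1}"
    then show ?thesis by (intro exI[of _ g]) simp
  qed auto
  then obtain m where m: "\<And>j. arc (m j)" "\<And>j. pathstart (m j) = t 0 j" "\<And>j. pathfinish (m j) = t 1 j"
      and mN: "\<And>j. path_image (m j) \<subseteq> N j \<union> {t 0 j, t 1 j}"
    by metis
  have mM: "path_image (m j) \<subseteq> M j" for j
    using mN[of j] N(3)[of j] N(4)[of 0 j] N(4)[of 1 j] by blast
  define c where "c = (\<lambda>j. r j +++ (m j +++ reversepath (q j)))"
  have cim: "path_image (c j) = path_image (r j) \<union> path_image (m j) \<union> path_image (q j)" for j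
    using r m q by (simp add: c_def path_image_join Un_assoc)
  have t01: "t 0 j \<noteq> t 1 j" for j using t[of 0 j 1] by auto
  have carc: "arc (c j)" for j
    unfolding c_def
  proof (intro arc_join)
    have "path_image (m j) \<inter> path_image (q j) \<subseteq> {t 1 j}"
      using Int_mono[OF mM[of j] qA[of j]] AM[of 1 j] by auto
    then show "path_image (m j) \<inter> path_image (reversepath (q j)) \<subseteq> {pathstart (reversepath (q j))}"
      using q by simp
    have "path_image (r j) \<inter> path_image (q j) = {}"
      by (rule disjoint_subsets[OF rA qA]) (use A01 tA t01[of j] in auto)
    moreover have "path_image (r j) \<inter> path_image (m j) \<subseteq> {t 0 j}"
      using Int_mono[OF rA[of j] mM[of j]] AM[of 0 j] by auto
    ultimately show "path_image (r j) \<inter> path_image (m j +++ reversepath (q j)) \<subseteq> {pathstart (m j +++ reversepath (q j))}"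
      using m q by (auto simp: path_image_join)
  qed (use r m q in \<open>auto simp: arc_reversepath\<close>)
  have cends: "pathstart (c j) = a" "pathfinish (c j) = b" for j
    using r q by (simp_all add: c_def)
  have csub: "path_image (c j) \<subseteq> A 0 \<union> A 1 \<union> M j" for j
    unfolding cim using Un_mono[OF Un_mono[OF rA[of j] mM[of j]] qA[of j]] N(4)[of 0 j] N(4)[of 1 j] by auto
  have cc: "path_image (c j) \<inter> path_image (c k) = {a, b}" if "j \<noteq> k" for j k
  proof
    have "a \<in> path_image (c j)" "b \<in> path_image (c j)" for j
      using cends[of j] by (metis pathstart_in_path_image pathfinish_in_path_image)+
    then show "{a, b} \<subseteq> path_image (c j) \<inter> path_image (c k)" by blast
    have "path_image (r j) \<inter> path_image (q k) = {}" if "j \<noteq> k" for j k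
    proof -
      have "t 0 j \<noteq> t 1 k" using MM[OF that] N(4)[of 0 j] N(4)[of 1 k] by auto
      then show ?thesis by (intro disjoint_subsets[OF rA qA]) (use A01 tA in auto)
    qed
    moreover have "path_image (r j) \<inter> path_image (m k) = {}" "path_image (q j) \<inter> path_image (m k) = {}" if "j \<noteq> k" for j k
    proof -
      have "t i j \<notin> M k" for i using MM[OF that] N(4)[of i j] by auto
      then show "path_image (r j) \<inter> path_image (m k) = {}" "path_image (q j) \<inter> path_image (m k) = {}"
        using AM by (intro disjoint_subsets[OF rA mM] disjoint_subsets[OF qA mM]; simp)+
    qed
    moreover have "path_image (m j) \<inter> path_image (m k) = {}" by (rule disjoint_subsets[OF mM mM MM[OF that]])
    ultimately show "path_image (c j) \<inter> path_image (c k) \<subseteq> {a, b}"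
      unfolding cim using rr[OF that] qq[OF that] that[symmetric] \<open>j \<noteq> k\<close> by (smt (verit) Int_Un_distrib Int_Un_distrib2 Int_commute Un_empty_left Un_empty_right subset_insertI subset_refl Un_subset_iff empty_subsetI insert_subset insertI1 insertCI)
  qed
  \<comment> \<open>Between its two ports the arc \<open>m j\<close> runs in N j, so its midpoint is
    a point of \<open>c j\<close> that a path from A 2 through N j can aim at.\<close>
  have inner: "\<exists>p. p \<in> path_image (m j) \<inter> N j" for j
  proof -
    have i: "inj_on (m j) {0..1}" using m(1)[of j] by (simp add: arc_def)
    have "m j (1/2) \<noteq> m j 0" "m j (1/2) \<noteq> m j 1"
      using inj_onD[OF i, of "1/2" 0] inj_onD[OF i, of "1/2" 1] by auto
    moreover have "m j (1/2) \<in> path_image (m j)" by (auto simp: path_image_def)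
    ultimately show ?thesis
      using mN[of j] m(2,3)[of j] by (intro exI[of _ "m j (1/2)"]) (auto simp: pathstart_def pathfinish_def)
  qed
  have hit: "\<exists>h s. path h \<and> 0 < s \<and> s \<le> 1 \<and> h 0 = z \<and> path_image h \<subseteq> A 2 \<union> M j \<and> h s \<in> path_image (c j) \<and>
      h ` {0..<s} \<inter> path_image (c j) = {}" for j
  proof -
    obtain p where p: "p \<in> path_image (m j)" "p \<in> N j" using inner[of j] by blast
    have "path_connected ((A 2 \<union> t 2 ` {j}) \<union> (N j \<union> (\<lambda>i. t i j) ` {2}))"
      by (rule path_connected_Un[OF A N(1)]) auto
    then obtain h where h: "path h" "path_image h \<subseteq> (A 2 \<union> t 2 ` {j}) \<union> (N j \<union> (\<lambda>i. t i j) ` {2})"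
        "pathstart h = z" "pathfinish h = p"
      unfolding path_connected_def using z p(2) by blast
    have "z \<notin> path_image (c j)"
      using csub[of j] z A20 A21 AM[of 2 j] by auto
    moreover have "p \<in> path_image (c j)" using p cim by blast
    ultimately obtain s where "0 < s" "s \<le> 1" "h s \<in> path_image (c j)" "h ` {0..<s} \<inter> path_image (c j) = {}"
      using path_first_hit_image[of h "path_image (c j)"] h carc[of j] by (auto simp: closed_path_image arc_imp_path)
    moreover have "path_image h \<subseteq> A 2 \<union> M j" using h(2) N(3)[of j] N(4)[of 2 j] by auto
    ultimately show ?thesis using h by (intro exI[of _ h] exI[of _ s]) (simp add: pathstart_def)
  qed
  then obtain h where "\<forall>j. \<exists>s. path (h j) \<and> 0 < s \<and> s \<le> 1 \<and> h j 0 = z \<and> path_image (h j) \<subseteq> A 2 \<union> M j \<and> h j s \<in> path_image (c j) \<and>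
      h j ` {0..<s} \<inter> path_image (c j) = {}" by metis
  then obtain s where h: "\<And>j. path (h j)" "\<And>j. 0 < s j" "\<And>j. s j \<le> 1" "\<And>j. h j 0 = z" "\<And>j. path_image (h j) \<subseteq> A 2 \<union> M j"
      "\<And>j. h j (s j) \<in> path_image (c j)" "\<And>j. h j ` {0..<s j} \<inter> path_image (c j) = {}" by metis
  \<comment> \<open>Each path is cut just before its first hit: W avoids the theta curve, yet its
    closure contains a point of each arc.\<close>
  define W where "W = (\<Union>j. h j ` {0..<s j})"
  have hsub: "h j u \<in> A 2 \<union> M j" if "0 \<le> u" "u \<le> s j" for j u
  proof -
    have "h j u \<in> path_image (h j)" unfolding path_image_def using that h(3)[of j] by simp
    then show ?thesis using h(5)[of j] by (rule subsetD[rotated])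
  qed
  have zh: "z \<in> h j ` {0..<s j}" for j
    using h(2)[of j] h(4)[of j] by (intro image_eqI[of _ _ 0]) auto
  have Wc: "connected W"
    unfolding W_def
  proof (rule connected_Union)
    show "\<Inter> (range (\<lambda>j. h j ` {0..<s j})) \<noteq> {}" using zh by blast
    fix S assume "S \<in> range (\<lambda>j. h j ` {0..<s j})"
    then show "connected S"
      using half_open_path_connected(1)[OF h(1,3)] path_connected_imp_connected by blast
  qed
  have Wd: "W \<inter> path_image (c k) = {}" for k
  proof -
    have "h j ` {0..<s j} \<inter> path_image (c k) = {}" for j
    proof (cases "j = k")
      case False
      have "h j ` {0..<s j} \<subseteq> A 2 \<union> M j"
      proof
        fix x assume "x \<in> h j ` {0..<s j}"
        then obtain u where "x = h j u" "0 \<le> u" "u < s j" by auto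
        then show "x \<in> A 2 \<union> M j" using hsub[of u j] by simp
      qed
      then show ?thesis
        by (rule disjoint_subsets[OF _ csub]) (use A20 A21 AM[of 2 k] AM[of 0 j] AM[of 1 j] MM[OF False] in auto)
    qed (use h(7) in auto)
    then show ?thesis by (auto simp: W_def)
  qed
  have cl: "h j (s j) \<in> closure W" for j
    using half_open_path_closure[OF h(1-3)] closure_mono[of "h j ` {0..<s j}" W] by (auto simp: W_def)
  have mem: "h j (s j) \<in> path_image (c j) - {a, b}" for j
  proof -
    have "h j (s j) \<in> A 2 \<union> M j" using hsub[of "s j" j] h(2)[of j] by simp
    then have "h j (s j) \<noteq> a" "h j (s j) \<noteq> b"
      using a b A20 A21 AM[of 0 j] AM[of 1 j] by auto
    then show ?thesis using h(6) by simp
  qed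
  show False
    by (rule theta_not_touched[OF carc[of 0] carc[of 1] carc[of 2] cends cends cends cc cc cc Wc _ cl mem cl mem cl mem])
      (use Wd in auto)
qed

lemma choice2: "(\<And>i j. \<exists>d. P i j d) \<Longrightarrow> \<exists>f. \<forall>i j. P i j (f i j)"
  by metis

lemma choice3: "(\<And>i j k. \<exists>d. P i j k d) \<Longrightarrow> \<exists>f. \<forall>i j k. P i j k (f i j k)"
  by metis

text \<open>To obtain a graph, each G i is thinned to a compact path-connected A0 i, each B j is
  thickened to its \<delta>-neighbourhoods N j (open) and M j (closed), and each touching point
  \<open>b i j\<close> is approached along a straight segment from a nearby point
  \<open>q i j\<close> of G i. The order of the choices matters: \<epsilon> keeps apart the segments
  belonging to different i and the different B j; then come q and A0; \<delta> is last, because M j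
  has to miss A0 i.\<close>

lemma K33_plane:
  fixes G B :: "3 \<Rightarrow> complex set"
  assumes G: "\<And>i. open (G i)" "\<And>i. connected (G i)" "\<And>i k. i \<noteq> k \<Longrightarrow> closure (G i) \<inter> closure (G k) = {}"
    and B: "\<And>j. compact (B j)" "\<And>j. connected (B j)" "\<And>j l. j \<noteq> l \<Longrightarrow> B j \<inter> B l = {}"
    and GB: "\<And>i j. G i \<inter> B j = {}" "\<And>i j. closure (G i) \<inter> B j \<noteq> {}"
  shows False
proof -
  obtain b where b: "\<And>i j. b i j \<in> closure (G i)" "\<And>i j. b i j \<in> B j"
  proof -
    have "\<exists>x. x \<in> closure (G i) \<and> x \<in> B j" for i j using GB(2)[of i j] by blast
    then show ?thesis using that by metis
  qed
  have Bcl: "closed (B j)" for j using B(1) compact_imp_closed by blast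
  obtain d1 where d1: "\<And>i k j. d1 (i,k,j) > (0::real)"
      "\<And>i k j z. k \<noteq> i \<Longrightarrow> z \<in> closure (G k) \<Longrightarrow> d1 (i,k,j) \<le> dist (b i j) z"
  proof -
    have ex: "\<exists>d>0. k \<noteq> i \<longrightarrow> (\<forall>z\<in>closure (G k). d \<le> dist (b i j) z)" for i k j
    proof (cases "k = i")
      case False
      then have "{b i j} \<inter> closure (G k) = {}" using b(1)[of i j] G(3)[OF False] by blast
      then show ?thesis using separate_compact_closed[of "{b i j}" "closure (G k)"] by auto
    qed (auto intro: exI[of _ 1])
    have "\<exists>d. \<forall>i k j. d i k j > 0 \<and> (k \<noteq> i \<longrightarrow> (\<forall>z\<in>closure (G k). d i k j \<le> dist (b i j) z))"
      by (rule choice3) (rule ex)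
    then obtain d where d: "\<forall>i k j. d i k j > 0 \<and> (k \<noteq> i \<longrightarrow> (\<forall>z\<in>closure (G k). d i k j \<le> dist (b i j) z))"
      by (rule exE)
    show ?thesis by (rule that[of "\<lambda>(i,k,j). d i k j"]) (use d in simp_all)
  qed
  obtain d2 where d2: "\<And>j l. d2 (j,l) > (0::real)" "\<And>j l y z. j \<noteq> l \<Longrightarrow> y \<in> B j \<Longrightarrow> z \<in> B l \<Longrightarrow> d2 (j,l) \<le> dist y z"
  proof -
    have ex: "\<exists>d>0. j \<noteq> l \<longrightarrow> (\<forall>y\<in>B j. \<forall>z\<in>B l. d \<le> dist y z)" for j l
    proof (cases "j = l")
      case False
      show ?thesis
        using separate_compact_closed[OF B(1) Bcl B(3)[OF False]] by auto
    qed (auto intro: exI[of _ 1])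
    have "\<exists>d. \<forall>j l. d j l > 0 \<and> (j \<noteq> l \<longrightarrow> (\<forall>y\<in>B j. \<forall>z\<in>B l. d j l \<le> dist y z))"
      by (rule choice2) (rule ex)
    then obtain d where d: "\<forall>j l. d j l > 0 \<and> (j \<noteq> l \<longrightarrow> (\<forall>y\<in>B j. \<forall>z\<in>B l. d j l \<le> dist y z))"
      by (rule exE)
    show ?thesis by (rule that[of "\<lambda>(j,l). d j l"]) (use d in simp_all)
  qed
  obtain e1 where e1: "e1 > 0" "\<And>x. e1 < d1 x" by (rule finite_small_positive[of d1]) (use d1(1) in auto)
  obtain e2 where e2: "e2 > 0" "\<And>x. e2 < d2 x" by (rule finite_small_positive[of d2]) (use d2(1) in auto)
  \<comment> \<open>The estimates below bring the points in question within 2 \<epsilon> of each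
    other, whereas \<open>far1\<close> and \<open>far2\<close> keep them more than 4 \<epsilon>
    apart.\<close>
  define \<epsilon> where "\<epsilon> = min e1 e2 / 4"
  have \<epsilon>: "\<epsilon> > 0" using e1 e2 by (simp add: \<epsilon>_def)
  have far1: "4 * \<epsilon> < dist (b i j) z" if "k \<noteq> i" "z \<in> closure (G k)" for i j k z
    using d1(2)[OF that, of j] e1(2)[of "(i,k,j)"] by (simp add: \<epsilon>_def)
  have far2: "4 * \<epsilon> < dist y z" if "j \<noteq> l" "y \<in> B j" "z \<in> B l" for j l y z
    using d2(2)[OF that] e2(2)[of "(j,l)"] by (simp add: \<epsilon>_def)
  obtain q where q: "\<And>i j. q i j \<in> G i" "\<And>i j. dist (q i j) (b i j) < \<epsilon>"
  proof -
    have "\<exists>x. x \<in> G i \<and> dist x (b i j) < \<epsilon>" for i j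
      using b(1)[of i j] \<epsilon> closure_approachable by blast
    then show ?thesis using that by metis
  qed
  obtain A0 where A0: "\<And>i. compact (A0 i)" "\<And>i. path_connected (A0 i)" "\<And>i. A0 i \<subseteq> G i" "\<And>i j. q i j \<in> A0 i"
  proof -
    have "\<exists>S. compact S \<and> path_connected S \<and> S \<subseteq> G i \<and> (\<forall>j. q i j \<in> S)" for i
    proof -
      have "path_connected (G i)" using G connected_open_path_connected by blast
      then obtain g h where g: "path g" "path_image g \<subseteq> G i" "pathstart g = q i 0" "pathfinish g = q i 1"
        and h: "path h" "path_image h \<subseteq> G i" "pathstart h = q i 0" "pathfinish h = q i 2"
        using q(1) by (metis path_connected_def)
      have "q i 0 \<in> path_image g \<inter> path_image h" "q i 1 \<in> path_image g" "q i 2 \<in> path_image h"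
        using g h by (metis IntI pathstart_in_path_image pathfinish_in_path_image)+
      moreover have "path_connected (path_image g \<union> path_image h)"
        using g h calculation by (intro path_connected_Un path_connected_path_image) auto
      ultimately show ?thesis
        using g h exhaust_3_zero by (intro exI[of _ "path_image g \<union> path_image h"]) (auto intro!: compact_Un compact_path_image, metis)
    qed
    then show ?thesis using that by metis
  qed
  obtain d3 where d3: "\<And>i j. d3 (i,j) > (0::real)" "\<And>i j y z. y \<in> A0 i \<Longrightarrow> z \<in> B j \<Longrightarrow> d3 (i,j) \<le> dist y z"
  proof -
    have ex: "\<exists>d>0. \<forall>y\<in>A0 i. \<forall>z\<in>B j. d \<le> dist y z" for i j
    proof -
      have "A0 i \<inter> B j = {}" using A0(3) GB(1)[of i j] by blast
      then show ?thesis
        using separate_compact_closed[OF A0(1) Bcl] by simp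
    qed
    have "\<exists>d. \<forall>i j. d i j > 0 \<and> (\<forall>y\<in>A0 i. \<forall>z\<in>B j. d i j \<le> dist y z)"
      by (rule choice2) (rule ex)
    then obtain d where d: "\<forall>i j. d i j > 0 \<and> (\<forall>y\<in>A0 i. \<forall>z\<in>B j. d i j \<le> dist y z)"
      by (rule exE)
    show ?thesis by (rule that[of "\<lambda>(i,j). d i j"]) (use d in simp_all)
  qed
  obtain e3 where e3: "e3 > 0" "\<And>x. e3 < d3 x" by (rule finite_small_positive[of d3]) (use d3(1) in auto)
  \<comment> \<open>\<open>e3\<close> is below the distance from each compact A0 i to each B j, so
    that the closed neighbourhood M j misses A0 i; the bound \<epsilon> makes the M j
    disjoint.\<close>
  define \<delta> where "\<delta> = min e3 \<epsilon>"
  have \<delta>: "\<delta> > 0" "\<delta> \<le> \<epsilon>" using e3 \<epsilon> by (simp_all add: \<delta>_def)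
  have far3: "\<delta> < dist y z" if "y \<in> A0 i" "z \<in> B j" for i j y z
    using d3(2)[OF that] e3(2)[of "(i,j)"] by (simp add: \<delta>_def)
  define M where "M = (\<lambda>j. {z. infdist z (B j) \<le> \<delta>})"
  define N where "N = (\<lambda>j. {z. infdist z (B j) < \<delta>})"
  have Bne: "B j \<noteq> {}" for j using b(2) by blast
  have near: "\<exists>y\<in>B j. infdist z (B j) = dist z y" for j z
    using infdist_attains_inf[OF Bcl Bne] by metis
  have Mcl: "closed (M j)" for j
    unfolding M_def by (intro closed_Collect_le continuous_intros)
  have MD: "\<exists>y\<in>B j. dist z y \<le> \<delta>" if "z \<in> M j" for z j
    using near[of j z] that by (auto simp: M_def)
  have MM: "M j \<inter> M l = {}" if "j \<noteq> l" for j l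
  proof (rule equals0I)
    fix z assume "z \<in> M j \<inter> M l"
    then obtain y y' where "y \<in> B j" "dist z y \<le> \<delta>" "y' \<in> B l" "dist z y' \<le> \<delta>" using MD by blast
    then have "dist y y' \<le> 2 * \<delta>" by (metis dist_commute dist_triangle_le add_mono mult_2)
    then show False using far2[OF that \<open>y \<in> B j\<close> \<open>y' \<in> B l\<close>] \<delta> by linarith
  qed
  have A0M: "A0 i \<inter> M j = {}" for i j
    using far3 MD by (meson disjoint_iff not_less)
  have bM: "b i j \<in> M j" for i j using b(2)[of i j] \<delta> by (simp add: M_def)
  have NM: "N j \<subseteq> M j" for j by (auto simp: N_def M_def)
  have Nball: "N j = (\<Union>y\<in>B j. ball y \<delta>)" for j
  proof
    show "N j \<subseteq> (\<Union>y\<in>B j. ball y \<delta>)"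
    proof
      fix z assume "z \<in> N j"
      moreover obtain y where "y \<in> B j" "infdist z (B j) = dist z y" using near[of j z] by blast
      ultimately show "z \<in> (\<Union>y\<in>B j. ball y \<delta>)" by (auto simp: N_def dist_commute)
    qed
    show "(\<Union>y\<in>B j. ball y \<delta>) \<subseteq> N j"
    proof clarsimp
      fix y z assume "y \<in> B j" "dist y z < \<delta>"
      then show "z \<in> N j" using infdist_le[of y "B j" z] by (simp add: N_def dist_commute)
    qed
  qed
  have BN: "B j \<subseteq> N j" for j using \<delta> by (auto simp: N_def)
  have Nconn: "path_connected (N j)" for j
  proof -
    have "connected (N j)"
    proof (rule connectedI)
      fix U V assume UV: "open U" "open V" "N j \<subseteq> U \<union> V" "U \<inter> V \<inter> N j = {}" "U \<inter> N j \<noteq> {}" "V \<inter> N j \<noteq> {}"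
      have *: "ball y \<delta> \<inter> V = {} \<or> ball y \<delta> \<inter> U = {}" if "y \<in> B j" for y
      proof (rule ccontr)
        assume "\<not> ?thesis"
        moreover have "ball y \<delta> \<subseteq> N j" using that Nball by blast
        ultimately show False using connectedD[OF connected_ball[of y \<delta>] UV(1,2)] UV by blast
      qed
      have "B j \<inter> U = {} \<or> B j \<inter> V = {}"
        using connectedD[OF B(2)[of j] UV(1,2)] UV BN[of j] by blast
      moreover have "B j \<inter> U \<noteq> {}"
      proof -
        obtain z where "z \<in> U" "z \<in> N j" using UV(5) by blast
        then obtain y where y: "y \<in> B j" "z \<in> ball y \<delta>" using Nball by blast
        moreover have "y \<in> ball y \<delta>" using \<delta> by simp
        ultimately show ?thesis using *[OF y(1)] \<open>z \<in> U\<close> UV(3) BN[of j] by blast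
      qed
      moreover have "B j \<inter> V \<noteq> {}"
      proof -
        obtain z where "z \<in> V" "z \<in> N j" using UV(6) by blast
        then obtain y where y: "y \<in> B j" "z \<in> ball y \<delta>" using Nball by blast
        moreover have "y \<in> ball y \<delta>" using \<delta> by simp
        ultimately show ?thesis using *[OF y(1)] \<open>z \<in> V\<close> UV(3) BN[of j] by blast
      qed
      ultimately show False by blast
    qed
    moreover have "open (N j)" unfolding Nball by auto
    ultimately show ?thesis using connected_open_path_connected by blast
  qed
  (* Cutting the segment from q i j to b i j where it first enters the neighbourhood M j of B j
     gives an edge that does not cross B j; this is where B j being disjoint from G i is used. *)
  define l where "l = (\<lambda>i j. linepath (q i j) (b i j))"
  obtain s where s: "\<And>i j. 0 < s i j" "\<And>i j. s i j \<le> 1" "\<And>i j. l i j (s i j) \<in> M j" "\<And>i j. l i j ` {0..<s i j} \<inter> M j = {}"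
  proof -
    have "\<exists>s. 0 < s \<and> s \<le> 1 \<and> l i j s \<in> M j \<and> l i j ` {0..<s} \<inter> M j = {}" for i j
    proof -
      have "q i j \<notin> M j" using A0(4) A0M by blast
      then show ?thesis
        using path_first_hit_image[of "l i j" "M j"] bM Mcl unfolding l_def by (metis path_linepath pathfinish_linepath pathstart_linepath)
    qed
    then show ?thesis using that by metis
  qed
  define t where "t = (\<lambda>i j. l i j (s i j))"
  define A where "A = (\<lambda>i. A0 i \<union> (\<Union>j. l i j ` {0..<s i j}))"
  have lball: "dist (l i j u) (b i j) < \<epsilon>" if "0 \<le> u" "u \<le> 1" for i j u
  proof -
    have "l i j u \<in> closed_segment (q i j) (b i j)"
      using that by (simp add: l_def linepath_in_path)
    then show ?thesis
      using q(2)[of i j] by (meson dist_commute dist_in_closed_segment dual_order.strict_trans2 le_less_trans)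
  qed
  have l0: "l i j 0 = q i j" for i j by (simp add: l_def linepath_def)
  have lM: "l i j u \<notin> M k" if "0 \<le> u" "u \<le> 1" "j \<noteq> k" for i j k u
  proof
    assume "l i j u \<in> M k"
    then obtain y where "y \<in> B k" "dist (l i j u) y \<le> \<delta>" using MD by blast
    then have "dist (b i j) y < 2 * \<epsilon>"
      using lball[OF that(1,2), of i j] \<delta> dist_triangle[of "b i j" y "l i j u"] by (simp add: dist_commute)
    then show False using far2[OF that(3) b(2) \<open>y \<in> B k\<close>] \<epsilon> by (smt (verit))
  qed
  have AM: "A i \<inter> M j = {}" for i j
  proof -
    have "l i k u \<notin> M j" if "u \<in> {0..<s i k}" for u k
    proof (cases "k = j")
      case True
      then show ?thesis using s(4)[of i j] that by blast
    next
      case False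
      then show ?thesis using lM that s(2)[of i k] by auto
    qed
    then show ?thesis using A0M[of i j] by (auto simp: A_def)
  qed
  have Aapx: "z \<in> closure (G i) \<or> (\<exists>j. dist z (b i j) < \<epsilon>)" if z: "z \<in> A i" for z i
  proof -
    consider "z \<in> A0 i" | j u where "z = l i j u" "0 \<le> u" "u < s i j"
      using z by (auto simp: A_def)
    then show ?thesis
    proof cases
      case 1
      then show ?thesis using A0(3)[of i] closure_subset[of "G i"] by blast
    next
      case 2
      then show ?thesis using lball[of u i j] s(2)[of i j] by auto
    qed
  qed
  have AA: "A i \<inter> A k = {}" if "i \<noteq> k" for i k
  proof (rule equals0I)
    fix z assume "z \<in> A i \<inter> A k"
    then have "z \<in> closure (G i) \<or> (\<exists>j. dist z (b i j) < \<epsilon>)" "z \<in> closure (G k) \<or> (\<exists>j. dist z (b k j) < \<epsilon>)"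
      using Aapx by blast+
    moreover have False if "z \<in> closure (G i)" "z \<in> closure (G k)" using that G(3)[OF \<open>i \<noteq> k\<close>] by blast
    moreover have False if "z \<in> closure (G i)" "dist z (b k j) < \<epsilon>" for j
      using far1[OF \<open>i \<noteq> k\<close> that(1), of j] that(2) \<epsilon> by (simp add: dist_commute)
    moreover have False if "z \<in> closure (G k)" "dist z (b i j) < \<epsilon>" for j
      using far1[OF \<open>i \<noteq> k\<close>[symmetric] that(1), of j] that(2) \<epsilon> by (simp add: dist_commute)
    moreover have False if "dist z (b i j) < \<epsilon>" "dist z (b k m) < \<epsilon>" for j m
      using far1[OF \<open>i \<noteq> k\<close>[symmetric] b(1)[of k m], of j] that \<epsilon> dist_triangle[of "b i j" "b k m" z] by (simp add: dist_commute)
    ultimately show False by blast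
  qed
  have tM: "t i j \<in> M j" for i j using s(3) by (simp add: t_def)
  have tinj: "i = k" if "t i j = t k j" for i j k
  proof (rule ccontr)
    assume "i \<noteq> k"
    moreover have "dist (t i j) (b i j) < \<epsilon>" "dist (t k j) (b k j) < \<epsilon>"
      unfolding t_def using lball s by (meson less_imp_le)+
    ultimately show False
      using far1[OF \<open>i \<noteq> k\<close>[symmetric] b(1)[of k j], of j] that \<epsilon> dist_triangle[of "b i j" "b k j" "t i j"] by (simp add: dist_commute)
  qed
  have tA: "path_connected (A i \<union> t i ` T)" for i T
  proof -
    have "A i \<union> t i ` T = A0 i \<union> (\<Union>j. if j \<in> T then l i j ` {0..s i j} else l i j ` {0..<s i j})"
    proof -
      have "l i j ` {0..s i j} = insert (t i j) (l i j ` {0..<s i j})" for j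
      proof -
        have "{0..s i j} = insert (s i j) {0..<s i j}" using s(1)[of i j] by auto
        then show ?thesis by (simp add: t_def)
      qed
      note l_eq = this
      have "(\<Union>j. if j \<in> T then insert (t i j) (X j) else X j) = (\<Union>j. X j) \<union> t i ` T" for X
        by (auto split: if_splits)
      then show ?thesis unfolding l_eq A_def by auto
    qed
    moreover have "path_connected (A0 i \<union> (\<Union>j. if j \<in> T then l i j ` {0..s i j} else l i j ` {0..<s i j}))"
    proof (rule path_connected_Un_family)
      show "path_connected (A0 i)" by (rule A0)
      show "path_connected (if j \<in> T then l i j ` {0..s i j} else l i j ` {0..<s i j})" for j
        using half_open_path_connected[of "l i j" "s i j"] s(2) by (simp add: l_def)
      have "q i j \<in> l i j ` {0..s i j}" "q i j \<in> l i j ` {0..<s i j}" for j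
        using s(1)[of i j] l0[of i j] by (force intro: image_eqI[of _ _ 0])+
      then show "A0 i \<inter> (if j \<in> T then l i j ` {0..s i j} else l i j ` {0..<s i j}) \<noteq> {}" for j
        using A0(4)[of i j] by auto
    qed
    ultimately show ?thesis by simp
  qed
  have tN: "t i j \<notin> N j" for i j
  proof
    assume tn: "t i j \<in> N j"
    have "open (N j)" unfolding Nball by auto
    moreover have "t i j \<in> closure (l i j ` {0..<s i j})"
      unfolding t_def by (intro half_open_path_closure) (use s in \<open>auto simp: l_def\<close>)
    ultimately have "N j \<inter> l i j ` {0..<s i j} \<noteq> {}"
      using tn by (metis disjoint_iff open_Int_closure_eq_empty)
    then show False using s(4)[of i j] NM[of j] by blast
  qed
  have tNc: "path_connected (N j \<union> (\<lambda>i. t i j) ` T)" for j T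
  proof -
    \<comment> \<open>A port is within \<delta> of some y in B j, and along the segment to y the
      distance to y drops strictly below \<delta> at once; everything but the port is thus in N
      j.\<close>
    have "\<exists>y\<in>B j. closed_segment (t i j) y \<subseteq> insert (t i j) (N j)" for i
    proof -
      obtain y where y: "y \<in> B j" "dist (t i j) y \<le> \<delta>" using MD[OF tM] by blast
      have "dist z y < \<delta>" if z: "z \<in> closed_segment (t i j) y" "z \<noteq> t i j" for z
      proof -
        obtain u where u: "0 \<le> u" "u \<le> 1" "z = (1 - u) *\<^sub>R t i j + u *\<^sub>R y" using z by (auto simp: closed_segment_def)
        then have "u \<noteq> 0" using z by auto
        have "z - y = (1 - u) *\<^sub>R (t i j - y)" using u by (simp add: algebra_simps)
        then have "dist z y = (1 - u) * dist (t i j) y" using u by (simp add: dist_norm)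
        also have "\<dots> \<le> (1 - u) * \<delta>" using y u by (intro mult_left_mono) auto
        also have "\<dots> < \<delta>" using u \<open>u \<noteq> 0\<close> \<delta> by (simp add: algebra_simps)
        finally show ?thesis .
      qed
      then show ?thesis using y Nball by (intro bexI[of _ y]) (auto simp: dist_commute)
    qed
    then obtain y where y: "\<And>i. y i \<in> B j" "\<And>i. closed_segment (t i j) (y i) \<subseteq> insert (t i j) (N j)" by metis
    have "N j \<inter> closed_segment (t i j) (y i) \<noteq> {}" for i
      using y(1)[of i] BN[of j] ends_in_segment(2)[of "y i" "t i j"] by blast
    then have "path_connected (N j \<union> (\<Union>i\<in>T. closed_segment (t i j) (y i)))"
      using Nconn by (intro path_connected_Un_family) (auto intro: convex_imp_path_connected)
    moreover have "N j \<union> (\<Union>i\<in>T. closed_segment (t i j) (y i)) = N j \<union> (\<lambda>i. t i j) ` T"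
      using y(2) by auto
    ultimately show ?thesis by simp
  qed
  show False
  proof (rule K33_graph[of A t N M])
    show "N j \<noteq> {}" for j using BN[of j] Bne by auto
  qed (use tA tNc NM tM AA AM MM tinj tN in auto)
qed

section \<open>Continua crossing between two open sets of the sphere\<close>

abbreviation RS_open :: "pt set \<Rightarrow> bool" where
  "RS_open \<equiv> openin (top_of_set RS)"

lemma punctured_sphere_homeomorphism:
  assumes "a \<in> RS"
  obtains h k where "homeomorphism (RS - {a}) (UNIV :: complex set) h k"
proof -
  let ?H = "{x::pt. (0::complex, 1::real) \<bullet> x = 0}"
  have "(sphere 0 1 - {a}) homeomorphic ?H"
    using assms by (intro homeomorphic_punctured_sphere_hyperplane) (auto simp: RS_def zero_prod_def)
  moreover have "?H homeomorphic (UNIV :: complex set)"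
    by (intro homeomorphic_affine_sets) (simp_all add: affine_hyperplane aff_dim_hyperplane zero_prod_def)
  ultimately have "(RS - {a}) homeomorphic (UNIV :: complex set)"
    unfolding RS_def using homeomorphic_trans by blast
  then show ?thesis using that unfolding homeomorphic_def by blast
qed

lemma continuous_on_image_closure:
  fixes f :: "'a::metric_space \<Rightarrow> 'b::metric_space"
  assumes "continuous_on S f" "X \<subseteq> S" "x \<in> S" "x \<in> closure X"
  shows "f x \<in> closure (f ` X)"
  unfolding closure_approachable
proof (intro allI impI)
  fix e :: real assume "e > 0"
  then obtain d where "d > 0" "\<And>y. y \<in> S \<Longrightarrow> dist y x < d \<Longrightarrow> dist (f y) (f x) < e"
    using assms(1,3) unfolding continuous_on_iff by blast
  moreover obtain y where "y \<in> X" "dist y x < d"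
    using \<open>d > 0\<close> assms(4) closure_approachable by blast
  ultimately show "\<exists>z\<in>f ` X. dist z (f x) < e" using assms(2) by blast
qed

text \<open>A further point off G serves as the centre of projection, so that G becomes a connected
  open subset of the plane, which no single point disconnects.\<close>

lemma connected_openin_sphere_delete:
  assumes "RS_open G" "connected G" "G \<noteq> RS"
  shows "connected (G - {p})"
proof -
  have G: "G \<subseteq> RS" using assms(1) openin_imp_subset by blast
  then obtain a where a: "a \<in> RS" "a \<notin> G" using assms(3) by blast
  obtain h k where hk: "homeomorphism (RS - {a}) (UNIV :: complex set) h k"
    using punctured_sphere_homeomorphism a(1) by blast
  have Ga: "G \<subseteq> RS - {a}" using G a by blast
  have "openin (top_of_set (RS - {a})) G"
    using assms(1) Ga by (meson Diff_subset openin_subset_trans)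
  then have "open (h ` G)"
    using homeomorphism_imp_open_map[OF hk] by simp
  moreover have "connected (h ` G)"
    using assms(2) Ga hk by (intro connected_continuous_image) (auto simp: homeomorphism_def elim: continuous_on_subset)
  ultimately have "connected (h ` G - {h p})" by (intro connected_open_delete) auto
  then have "connected (k ` (h ` G - {h p}))"
    using hk by (intro connected_continuous_image) (auto simp: homeomorphism_def elim: continuous_on_subset)
  moreover have "k ` (h ` G - {h p}) = G - {p}" if "p \<in> G"
  proof -
    have kh: "k (h x) = x" if "x \<in> G" for x using that Ga hk by (auto simp: homeomorphism_def)
    have "h x \<noteq> h p" if "x \<in> G" "x \<noteq> p" for x using kh that \<open>p \<in> G\<close> by metis
    then show ?thesis using kh by force
  qed
  ultimately show ?thesis using assms(2) by (cases "p \<in> G") auto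
qed

text \<open>The sphere is projected from a point p of G 0. Such a point avoids the other G i and all
  B j, which therefore stay compact in the plane. Only G 0 changes: it loses one point, which
  affects neither its connectedness nor its contact with the B j.\<close>

lemma K33_sphere:
  fixes G B :: "3 \<Rightarrow> pt set"
  assumes G: "\<And>i. RS_open (G i)" "\<And>i. connected (G i)" "\<And>i k. i \<noteq> k \<Longrightarrow> closure (G i) \<inter> closure (G k) = {}"
    and B: "\<And>j. compact (B j)" "\<And>j. connected (B j)" "\<And>j. B j \<subseteq> RS" "\<And>j l. j \<noteq> l \<Longrightarrow> B j \<inter> B l = {}"
    and GB: "\<And>i j. G i \<inter> B j = {}" "\<And>i j. closure (G i) \<inter> B j \<noteq> {}"
  shows False
proof -
  have GRS: "G i \<subseteq> RS" for i using G(1) openin_imp_subset by blast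
  have "G 0 \<noteq> {}" using GB(2)[of 0 0] by auto
  then obtain p where p: "p \<in> G 0" by blast
  have "G 0 \<noteq> RS" using GB[of 0 0] B(3)[of 0] by blast
  then have c0: "connected (G 0 - {p})" using connected_openin_sphere_delete G by blast
  have pG: "p \<notin> G i" if "i \<noteq> 0" for i using p G(3)[OF that] closure_subset by blast
  have pB: "p \<notin> B j" for j using p GB(1) by blast
  obtain h k where hk: "homeomorphism (RS - {p}) (UNIV :: complex set) h k"
    using punctured_sphere_homeomorphism p GRS by blast
  have kh: "k (h x) = x" if "x \<in> RS - {p}" for x using hk that by (simp add: homeomorphism_def)
  have ch: "continuous_on (RS - {p}) h" and ck: "continuous_on UNIV k" using hk by (simp_all add: homeomorphism_def)
  define G' where "G' = (\<lambda>i. G i - {p})"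
  have G'RS: "G' i \<subseteq> RS - {p}" for i using GRS[of i] by (auto simp: G'_def)
  have G'c: "connected (G' i)" for i
    using c0 G(2)[of i] pG[of i] by (cases "i = 0") (auto simp: G'_def)
  have BRS: "B j \<subseteq> RS - {p}" for j using B(3) pB by blast
  have inj: "inj_on h (RS - {p})" using kh by (metis inj_onI)
  show False
  proof (rule K33_plane[of "\<lambda>i. h ` G' i" "\<lambda>j. h ` B j"])
    fix i
    have "openin (top_of_set (RS - {p})) (G' i)"
    proof -
      have "RS_open (G' i)" unfolding G'_def Diff_eq by (intro openin_Int_open G(1)) auto
      then show ?thesis using G'RS by (meson Diff_subset openin_subset_trans)
    qed
    then show "open (h ` G' i)" using homeomorphism_imp_open_map[OF hk] by simp
    show "connected (h ` G' i)"
      by (intro connected_continuous_image continuous_on_subset[OF ch] G'c G'RS)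
    show "closure (h ` G' i) \<inter> closure (h ` G' l) = {}" if "i \<noteq> l" for l
    proof -
      have "k z \<in> closure (G i)" if "z \<in> closure (h ` G' i)" for z i
      proof -
        have "k z \<in> closure (k ` h ` G' i)" using that by (intro continuous_on_image_closure[OF ck]) auto
        moreover have "k ` h ` G' i = G' i" using kh G'RS[of i] by force
        ultimately show ?thesis using closure_mono[of "G' i" "G i"] by (auto simp: G'_def)
      qed
      then show ?thesis using G(3)[OF that] by blast
    qed
    fix j
    show "h ` G' i \<inter> h ` B j = {}"
      using inj_on_image_Int[OF inj G'RS BRS, of i j] GB(1)[of i j] by (auto simp: G'_def)
    obtain x where x: "x \<in> closure (G i)" "x \<in> B j" using GB(2) by blast
    have "x \<in> closure (G' i)"
    proof -
      have "closure (G i) \<subseteq> closure (insert p (G' i))" by (rule closure_mono) (auto simp: G'_def)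
      then show ?thesis using x pB[of j] by (auto simp: closure_insert)
    qed
    then have "h x \<in> closure (h ` G' i)"
      using x BRS[of j] by (intro continuous_on_image_closure[OF ch G'RS]) auto
    then show "closure (h ` G' i) \<inter> h ` B j \<noteq> {}" using x by blast
  next
    fix j
    show "compact (h ` B j)" by (intro compact_continuous_image continuous_on_subset[OF ch] B BRS)
    show "connected (h ` B j)" by (intro connected_continuous_image continuous_on_subset[OF ch] B BRS)
    show "h ` B j \<inter> h ` B l = {}" if "j \<noteq> l" for l
      using inj_on_image_Int[OF inj BRS BRS, of j l] B(4)[OF that] by auto
  qed
qed

text \<open>Already three members of the family would form a K(3,3) with the three open sets.
  Finiteness is the convenient form: it allows the exceptional members to be dropped from an
  infinite family.\<close>

lemma finite_continua_touching_three:
  assumes G: "RS_open G1" "connected G1" "RS_open G2" "connected G2"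
      "RS_open G3" "connected G3"
    and GG: "closure G1 \<inter> closure G2 = {}" "closure G1 \<inter> closure G3 = {}" "closure G2 \<inter> closure G3 = {}"
    and C: "pairwise disjnt \<C>" "\<And>C. C \<in> \<C> \<Longrightarrow> compact C" "\<And>C. C \<in> \<C> \<Longrightarrow> connected C" "\<And>C. C \<in> \<C> \<Longrightarrow> C \<subseteq> RS"
    and d: "\<And>C. C \<in> \<C> \<Longrightarrow> C \<inter> (G1 \<union> G2 \<union> G3) = {}"
    and m: "\<And>C. C \<in> \<C> \<Longrightarrow> C \<inter> closure G1 \<noteq> {}" "\<And>C. C \<in> \<C> \<Longrightarrow> C \<inter> closure G2 \<noteq> {}" "\<And>C. C \<in> \<C> \<Longrightarrow> C \<inter> closure G3 \<noteq> {}"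
  shows "finite \<C>"
proof (rule ccontr)
  assume inf: "infinite \<C>"
  obtain C0 where C0: "C0 \<in> \<C>" using inf by fastforce
  obtain C1 where C1: "C1 \<in> \<C> - {C0}" using inf by (metis ex_in_conv finite.emptyI infinite_remove)
  obtain C2 where C2: "C2 \<in> \<C> - {C0} - {C1}" using inf by (metis ex_in_conv finite.emptyI infinite_remove)
  define B where "B = (\<lambda>j::3. if j = 0 then C0 else if j = 1 then C1 else C2)"
  define G where "G = (\<lambda>j::3. if j = 0 then G1 else if j = 1 then G2 else G3)"
  have BC: "B j \<in> \<C>" for j using C0 C1 C2 by (simp add: B_def)
  have BB: "B 0 \<noteq> B 1" "B 0 \<noteq> B 2" "B 1 \<noteq> B 2" using C1 C2 by (auto simp: B_def)
  have Bne: "B j \<noteq> B l" if "j \<noteq> l" for j l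
    using exhaust_3_zero[of j] exhaust_3_zero[of l] that BB by metis
  show False
  proof (rule K33_sphere[of G B])
    show "B j \<inter> B l = {}" if "j \<noteq> l" for j l
      using C(1) BC Bne[OF that] by (metis disjnt_def pairwiseD)
    show "closure (G i) \<inter> closure (G k) = {}" if "i \<noteq> k" for i k
      using that exhaust_3_zero[of i] exhaust_3_zero[of k] GG by (auto simp: G_def Int_commute)
    show "G i \<inter> B j = {}" for i j using d[OF BC[of j]] by (auto simp: G_def)
    show "closure (G i) \<inter> B j \<noteq> {}" for i j
      using m[OF BC[of j]] by (simp add: G_def Int_commute)
    show "compact (B j)" "connected (B j)" "B j \<subseteq> RS" for j by (rule C BC)+
  qed (use G in \<open>simp_all add: G_def\<close>)
qed

section \<open>Components of compacta when open sets are removed or given back\<close>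

text \<open>In a compactum each component has arbitrarily small clopen neighbourhoods (Sura-Bura).
  Those around components that meet A can be taken off B, and by compactness finitely many of them
  cover the part of A in Z.\<close>

lemma compact_separate_components:
  fixes Z :: "'a::euclidean_space set"
  assumes Z: "compact Z" and AB: "closed A" "closed B"
    and no: "\<And>C. C \<in> components Z \<Longrightarrow> C \<inter> A = {} \<or> C \<inter> B = {}"
  obtains Z1 Z2 where "closed Z1" "closed Z2" "Z1 \<union> Z2 = Z" "Z1 \<inter> Z2 = {}" "A \<inter> Z \<subseteq> Z1" "B \<inter> Z \<subseteq> Z2"
proof -
  have "\<exists>K. openin (top_of_set Z) K \<and> compact K \<and> x \<in> K \<and> K \<inter> B = {}" if x: "x \<in> A \<inter> Z" for x
  proof -
    let ?C = "connected_component_set Z x"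
    have C: "?C \<in> components Z" using x by (auto simp: components_def)
    have xC: "x \<in> ?C" using x by simp
    then have "?C \<subseteq> - B" using no[OF C] x by blast
    moreover have "compact ?C" using compact_components[OF Z C] .
    ultimately obtain K where "openin (top_of_set Z) K" "compact K" "?C \<subseteq> K" "K \<subseteq> - B"
      using Sura_Bura_clopen_subset[OF closed_imp_locally_compact[OF compact_imp_closed[OF Z]] C, of "- B"] AB by auto
    then show ?thesis using xC by blast
  qed
  then obtain K where K: "\<And>x. x \<in> A \<inter> Z \<Longrightarrow> openin (top_of_set Z) (K x)" "\<And>x. x \<in> A \<inter> Z \<Longrightarrow> compact (K x)"
      "\<And>x. x \<in> A \<inter> Z \<Longrightarrow> x \<in> K x" "\<And>x. x \<in> A \<inter> Z \<Longrightarrow> K x \<inter> B = {}"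
    by metis
  then have "\<forall>x\<in>A \<inter> Z. \<exists>T. open T \<and> K x = Z \<inter> T" by (simp add: openin_open)
  then obtain T where T: "\<And>x. x \<in> A \<inter> Z \<Longrightarrow> open (T x)" "\<And>x. x \<in> A \<inter> Z \<Longrightarrow> K x = Z \<inter> T x"
    by metis
  have "compact (A \<inter> Z)" using Z AB by (simp add: closed_Int_compact)
  then obtain F where F: "F \<subseteq> A \<inter> Z" "finite F" "A \<inter> Z \<subseteq> (\<Union>x\<in>F. T x)"
  proof (rule compactE_image[of "A \<inter> Z" "A \<inter> Z" T])
    show "open (T x)" if "x \<in> A \<inter> Z" for x using T(1)[OF that] .
    show "A \<inter> Z \<subseteq> (\<Union>x\<in>A \<inter> Z. T x)" using K(3) T(2) by auto
  qed
  define Z1 where "Z1 = (\<Union>x\<in>F. K x)"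
  show ?thesis
  proof (rule that[of Z1 "Z - Z1"])
    have "compact Z1" unfolding Z1_def using F(1,2) K(2) by (intro compact_UN) (simp_all add: subset_iff)
    then show "closed Z1" by (rule compact_imp_closed)
    have "openin (top_of_set Z) Z1" unfolding Z1_def using F(1) K(1) by (intro openin_Union) (auto simp: subset_iff)
    then have "closedin (top_of_set Z) (Z - Z1)" by (simp add: closedin_def double_diff openin_imp_subset)
    then show "closed (Z - Z1)" using Z by (meson closedin_compact compact_imp_closed)
    have "K x \<subseteq> Z" "K x \<inter> B = {}" if "x \<in> F" for x
      using K(4)[of x] T(2)[of x] that F(1) by auto
    then show "Z1 \<union> (Z - Z1) = Z" "B \<inter> Z \<subseteq> Z - Z1" unfolding Z1_def by blast+
    show "A \<inter> Z \<subseteq> Z1"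
    proof
      fix x assume x: "x \<in> A \<inter> Z"
      then obtain y where "y \<in> F" "x \<in> T y" using F(3) by blast
      then show "x \<in> Z1" unfolding Z1_def using T(2)[of y] F(1) x by blast
    qed
  qed auto
qed

text \<open>This is a form of boundary bumping. If no component of the remainder touched both sides,
  the remainder would split into two closed parts; adding the part of C in \<open>closure N\<close>
  to one and the part in \<open>closure M\<close> to the other would disconnect C.\<close>

lemma continuum_crossing:
  fixes C :: "'a::euclidean_space set"
  assumes C: "compact C" "connected C" and cl: "closed (C - (N \<union> M))"
    and d: "closure N \<inter> closure M = {}" and m: "C \<inter> closure N \<noteq> {}" "C \<inter> closure M \<noteq> {}"
  obtains D where "D \<in> components (C - (N \<union> M))" "D \<inter> closure N \<noteq> {}" "D \<inter> closure M \<noteq> {}"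
proof (rule ccontr)
  assume neg: "\<not> thesis"
  then have no: "\<And>D. D \<in> components (C - (N \<union> M)) \<Longrightarrow> D \<inter> closure N = {} \<or> D \<inter> closure M = {}"
    using that by blast
  have "compact (C - (N \<union> M))" using C cl by (metis Diff_subset compact_Int_closed inf.absorb2)
  then obtain Z1 Z2 where Z: "closed Z1" "closed Z2" "Z1 \<union> Z2 = C - (N \<union> M)" "Z1 \<inter> Z2 = {}"
      "closure N \<inter> (C - (N \<union> M)) \<subseteq> Z1" "closure M \<inter> (C - (N \<union> M)) \<subseteq> Z2"
    by (rule compact_separate_components[of _ "closure N" "closure M"]) (use no in auto)
  define A B where "A = Z1 \<union> (C \<inter> closure N)" and "B = Z2 \<union> (C \<inter> closure M)"
  have "closed A" "closed B" using Z(1,2) compact_imp_closed[OF C(1)] by (simp_all add: A_def B_def closed_Un closed_Int)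
  moreover have "C \<subseteq> A \<union> B" using Z(3) closure_subset[of N] closure_subset[of M] by (auto simp: A_def B_def)
  moreover have "Z1 \<inter> closure M = {}" "Z2 \<inter> closure N = {}" using Z by blast+
  then have "A \<inter> B \<inter> C = {}" using Z(4) d by (auto simp: A_def B_def)
  moreover have "A \<inter> C \<noteq> {}" "B \<inter> C \<noteq> {}" using m by (auto simp: A_def B_def)
  ultimately show False using C(2) unfolding connected_closed by blast
qed

lemma components_Diff_trans:
  assumes "C \<in> components (X - P)" "D \<in> components (C - Q)" "P \<subseteq> Q"
  shows "D \<in> components (X - Q)"
  unfolding in_components_maximal
proof (intro conjI allI impI)
  have D: "D \<noteq> {}" "D \<subseteq> C - Q" "connected D" using assms(2) by (simp_all add: in_components_nonempty in_components_subset in_components_connected)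
  show "D \<noteq> {}" "connected D" by fact+
  show DX: "D \<subseteq> X - Q" using D assms(1) in_components_subset by fastforce
  fix E assume E: "E \<noteq> {} \<and> D \<subseteq> E \<and> E \<subseteq> X - Q \<and> connected E"
  then have "E \<subseteq> C"
    using D assms by (intro components_maximal[OF assms(1)]) auto
  then have "E \<subseteq> D"
    using E D by (intro components_maximal[OF assms(2)]) auto
  then show "E = D" using E by auto
qed

text \<open>Giving back removed points does not enlarge a component D that stays away from them. A
  clopen neighbourhood V of D can be chosen off W, and since all points given back lie in the closed
  set W, V remains separated from everything else.\<close>

lemma components_Diff_forget:
  fixes X :: "'a::euclidean_space set"
  assumes c: "compact (X - Q)" and D: "D \<in> components (X - Q)" and P: "P \<subseteq> Q" "Q \<subseteq> P \<union> W" and W: "closed W" "D \<inter> W = {}"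
  shows "D \<in> components (X - P)"
proof -
  have "D \<subseteq> - W" using W by blast
  then obtain V where V: "openin (top_of_set (X - Q)) V" "compact V" "D \<subseteq> V" "V \<subseteq> - W"
    using Sura_Bura_clopen_subset[OF closed_imp_locally_compact[OF compact_imp_closed[OF c]] D compact_components[OF c D], of "- W"] W by auto
  have VX: "V \<subseteq> X - Q" using V openin_imp_subset by blast
  have cl: "closed (X - Q - V)"
  proof -
    obtain T where "open T" "V = (X - Q) \<inter> T" using V(1) by (auto simp: openin_open)
    moreover from this have "X - Q - V = (X - Q) - T" by blast
    ultimately show ?thesis using c compact_diff compact_imp_closed by metis
  qed
  have D': "D \<noteq> {}" "connected D" using D by (simp_all add: in_components_nonempty in_components_connected)
  show ?thesis
    unfolding in_components_maximal
  proof (intro conjI allI impI)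
    show "D \<noteq> {}" "connected D" by fact+
    show "D \<subseteq> X - P" using V VX P by blast
    fix E assume E: "E \<noteq> {} \<and> D \<subseteq> E \<and> E \<subseteq> X - P \<and> connected E"
    have cov: "E \<subseteq> V \<union> ((X - Q - V) \<union> W)" using E P by blast
    moreover have "V \<inter> ((X - Q - V) \<union> W) \<inter> E = {}" using V by blast
    moreover have "V \<inter> E \<noteq> {}" using E V D' by blast
    moreover have "closed V" "closed ((X - Q - V) \<union> W)" using cl V W by (auto simp: compact_imp_closed)
    ultimately have "((X - Q - V) \<union> W) \<inter> E = {}"
      using E unfolding connected_closed by blast
    with cov VX have "E \<subseteq> X - Q" by blast
    then have "E \<subseteq> D" using E D' by (intro components_maximal[OF D]) auto
    then show "E = D" using E by auto
  qed
qed

lemma infinite_refinement: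
  assumes inf: "infinite \<C>" and pd: "pairwise disjnt \<C>"
    and ex: "\<And>C. C \<in> \<C> \<Longrightarrow> \<exists>D\<in>\<D>. D \<subseteq> C \<and> D \<noteq> {}"
  shows "infinite \<D>"
proof -
  obtain \<phi> where \<phi>: "\<And>C. C \<in> \<C> \<Longrightarrow> \<phi> C \<in> \<D> \<and> \<phi> C \<subseteq> C \<and> \<phi> C \<noteq> {}"
    using ex by metis
  have "inj_on \<phi> \<C>"
  proof (rule inj_onI)
    fix C C' assume "C \<in> \<C>" "C' \<in> \<C>" "\<phi> C = \<phi> C'"
    then have "\<not> disjnt C C'" using \<phi>[of C] \<phi>[of C'] unfolding disjnt_def by fastforce
    then show "C = C'" using pd \<open>C \<in> \<C>\<close> \<open>C' \<in> \<C>\<close> by (meson pairwiseD)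
  qed
  moreover have "\<phi> ` \<C> \<subseteq> \<D>" using \<phi> by blast
  ultimately show ?thesis using inf infinite_super finite_imageD by blast
qed

definition crossings :: "pt set \<Rightarrow> pt set \<Rightarrow> pt set \<Rightarrow> pt set set" where
  "crossings X N M = {C \<in> components (X - (N \<union> M)). C \<inter> closure N \<noteq> {} \<and> C \<inter> closure M \<noteq> {}}"

lemma compact_Diff_openin:
  assumes "compact X" "X \<subseteq> S" "openin (top_of_set S) N"
  shows "compact (X - N)"
proof -
  obtain T where "open T" "N = S \<inter> T" using assms(3) by (auto simp: openin_open)
  moreover from this have "X - N = X - T" using assms(2) by blast
  ultimately show ?thesis using assms(1) compact_diff by auto
qed

lemma pairwise_disjnt_crossings: "pairwise disjnt (crossings X N M)"
  using pairwise_disjoint_components[of "X - (N \<union> M)"] unfolding pairwise_def crossings_def disjnt_def by blast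

text \<open>By \<open>continuum_crossing\<close>, each crossing between the small sets contains one
  between the large sets. Consequently only small neighbourhoods matter for
  \<open>linked\<close>.\<close>

lemma infinite_crossings_mono:
  assumes X: "compact X" "X \<subseteq> RS"
    and o: "RS_open N" "RS_open M" "RS_open N'" "RS_open M'"
    and s: "N \<subseteq> N'" "M \<subseteq> M'" and d: "closure N' \<inter> closure M' = {}"
    and inf: "infinite (crossings X N M)"
  shows "infinite (crossings X N' M')"
proof (rule infinite_refinement[OF inf pairwise_disjnt_crossings])
  fix C assume "C \<in> crossings X N M"
  then have C: "C \<in> components (X - (N \<union> M))" "C \<inter> closure N \<noteq> {}" "C \<inter> closure M \<noteq> {}" by (auto simp: crossings_def)
  have "compact (X - (N \<union> M))" using X o by (intro compact_Diff_openin) auto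
  then have cC: "compact C" using compact_components C by blast
  have CX: "C \<subseteq> RS" using C(1) X in_components_subset by blast
  obtain D where D: "D \<in> components (C - (N' \<union> M'))" "D \<inter> closure N' \<noteq> {}" "D \<inter> closure M' \<noteq> {}"
  proof (rule continuum_crossing[OF cC _ _ d])
    show "connected C" using C in_components_connected by blast
    have "compact (C - (N' \<union> M'))" using o CX cC by (intro compact_Diff_openin) auto
    then show "closed (C - (N' \<union> M'))" by (rule compact_imp_closed)
    show "C \<inter> closure N' \<noteq> {}" "C \<inter> closure M' \<noteq> {}" using C closure_mono[OF s(1)] closure_mono[OF s(2)] by blast+
  qed
  have "D \<in> components (X - (N' \<union> M'))" using components_Diff_trans[OF C(1) D(1)] s by blast
  then have "D \<in> crossings X N' M'" using D by (simp add: crossings_def)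
  moreover have "D \<subseteq> C" "D \<noteq> {}" using D in_components_subset in_components_nonempty by blast+
  ultimately show "\<exists>D\<in>crossings X N' M'. D \<subseteq> C \<and> D \<noteq> {}" by blast
qed

section \<open>A local description of the Schoenflies relation\<close>

lemma locally_connected_RS: "locally connected RS"
  unfolding RS_def
  by (intro locally_path_connected_imp_locally_connected ENR_imp_locally_path_connected ENR_sphere)

lemma compact_RS: "compact RS" by (simp add: RS_def)

lemma connected_openin_nbhd:
  assumes "RS_open N" "p \<in> N"
  obtains N' where "RS_open N'" "connected N'" "p \<in> N'" "closure N' \<subseteq> N"
proof -
  obtain T where T: "open T" "N = RS \<inter> T" using assms(1) by (auto simp: openin_open)
  then obtain e where e: "e > 0" "cball p e \<subseteq> T" using assms(2) open_contains_cball by blast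
  have "RS_open (RS \<inter> ball p e)" by (intro openin_open_Int) simp
  moreover have "p \<in> RS \<inter> ball p e" using assms(2) T e by simp
  ultimately obtain N' where N': "RS_open N'" "connected N'" "p \<in> N'" "N' \<subseteq> RS \<inter> ball p e"
    using locally_connected_RS unfolding locally_connected by metis
  have "closed (RS \<inter> cball p e)" using compact_RS by (simp add: closed_Int compact_imp_closed)
  moreover have "N' \<subseteq> RS \<inter> cball p e" using N'(4) by auto
  ultimately have "closure N' \<subseteq> RS \<inter> cball p e" using closure_minimal by blast
  then show ?thesis using that[OF N'(1-3)] e T by blast
qed

text \<open>For x = y the condition is vacuous, as the closures of N and M then always meet;
  distinctness has to be assumed where it matters.\<close>

definition linked :: "pt set \<Rightarrow> pt \<Rightarrow> pt \<Rightarrow> bool" where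
  "linked X x y \<longleftrightarrow> (\<forall>N M. RS_open N \<and> RS_open M \<and> x \<in> N \<and> y \<in> M \<and>
     closure N \<inter> closure M = {} \<longrightarrow> infinite (crossings X N M))"

text \<open>Failure persists when the neighbourhoods shrink, so that finitely many failures can be
  realised by common smaller neighbourhoods.\<close>

lemma not_linked_nbhds:
  assumes X: "compact X" "X \<subseteq> RS" and nl: "\<not> linked X x y"
  obtains N M where "RS_open N" "RS_open M" "x \<in> N" "y \<in> M" "closure N \<inter> closure M = {}"
    "\<forall>N' M'. RS_open N' \<and> RS_open M' \<and> N' \<subseteq> N \<and> M' \<subseteq> M \<longrightarrow> finite (crossings X N' M')"
proof -
  obtain N M where NM: "RS_open N" "RS_open M" "x \<in> N" "y \<in> M" "closure N \<inter> closure M = {}"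
      "finite (crossings X N M)"
    using nl unfolding linked_def by blast
  show ?thesis
  proof (rule that[OF NM(1-5)], intro allI impI, elim conjE)
    fix N' M' assume "RS_open N'" "RS_open M'" "N' \<subseteq> N" "M' \<subseteq> M"
    then show "finite (crossings X N' M')"
      using infinite_crossings_mono[OF X, of N' M' N M] NM by blast
  qed
qed

lemma finite_components_touching_three:
  assumes X: "compact X" "X \<subseteq> RS" "RS_open Q"
    and G: "RS_open G1" "connected G1" "RS_open G2" "connected G2"
      "RS_open G3" "connected G3" "G1 \<subseteq> Q" "G2 \<subseteq> Q" "G3 \<subseteq> Q"
    and GG: "closure G1 \<inter> closure G2 = {}" "closure G1 \<inter> closure G3 = {}" "closure G2 \<inter> closure G3 = {}"
  shows "finite {C \<in> components (X - Q). C \<inter> closure G1 \<noteq> {} \<and> C \<inter> closure G2 \<noteq> {} \<and> C \<inter> closure G3 \<noteq> {}}" (is "finite ?\<C>")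
proof (rule finite_continua_touching_three[OF G(1-6) GG])
  have c: "compact (X - Q)" using X by (rule compact_Diff_openin)
  show "pairwise disjnt ?\<C>"
    using pairwise_disjoint_components[of "X - Q"] unfolding pairwise_def disjnt_def by blast
  fix C assume C: "C \<in> ?\<C>"
  then have "C \<in> components (X - Q)" by blast
  then show "compact C" "connected C"
    using compact_components[OF c] in_components_connected by blast+
  have "C \<subseteq> X - Q" using C in_components_subset by blast
  then show "C \<subseteq> RS" "C \<inter> (G1 \<union> G2 \<union> G3) = {}" using X G by blast+
  show "C \<inter> closure G1 \<noteq> {}" "C \<inter> closure G2 \<noteq> {}" "C \<inter> closure G3 \<noteq> {}" using C by blast+
qed

lemma infinite_pigeonhole:
  assumes "infinite A" "finite F" "\<And>a. a \<in> A \<Longrightarrow> \<exists>w\<in>F. P a w"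
  obtains w where "w \<in> F" "infinite {a \<in> A. P a w}"
proof -
  have "A \<subseteq> (\<Union>w\<in>F. {a \<in> A. P a w})" using assms(3) by blast
  then have "\<not> (\<forall>w\<in>F. finite {a \<in> A. P a w})"
    using assms(1,2) by (meson finite_UN_I finite_subset)
  then show ?thesis using that by blast
qed

lemma connected_meets_sphere:
  assumes "connected C" "C \<inter> ball u r \<noteq> {}" "C \<inter> - cball u r \<noteq> {}"
  shows "C \<inter> sphere u r \<noteq> {}"
proof
  assume "C \<inter> sphere u r = {}"
  then have "C \<subseteq> ball u r \<union> - cball u r" by force
  moreover have "ball u r \<inter> - cball u r = {}" by auto
  ultimately show False
    using connectedD[OF assms(1), of "ball u r" "- cball u r"] assms(2,3) by (simp add: Int_commute inf_assoc) blast
qed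

text \<open>Components running from near u to near w cross the sphere of radius r about u. If no
  point of it were linked to u, compactness would cover it by finitely many sets
  \<open>D w'\<close>, each having only finitely many crossings with a small N. Infinitely many
  components, however, meet the same \<open>D w'\<close>; by K(3,3) for N, M and
  \<open>D w'\<close>, only finitely many of the resulting pieces touch M as well, and the others
  are crossings between N and \<open>D w'\<close>.\<close>

lemma linked_nearby:
  assumes X: "compact X" "X \<subseteq> RS" and u: "u \<in> RS" and w: "w \<in> RS" and r: "0 < r" "r < dist u w"
    and l: "linked X u w"
  obtains w' where "w' \<in> RS" "dist u w' = r" "linked X u w'"
proof -
  have "\<exists>w'\<in>RS \<inter> sphere u r. linked X u w'"
  proof (rule ccontr)
    assume neg: "\<not> ?thesis"
    define B where "B = RS \<inter> sphere u r"
    have "compact B" unfolding B_def by (intro compact_Int compact_RS compact_sphere)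
    have oc: "RS_open (RS \<inter> - cball u r)" by (intro openin_open_Int) auto
    have "w \<in> RS \<inter> - cball u r" using w r by auto
    then obtain M where M: "RS_open M" "connected M" "w \<in> M" "closure M \<subseteq> RS \<inter> - cball u r"
      using connected_openin_nbhd[OF oc] by blast
    have ex: "\<exists>N' D. RS_open N' \<and> RS_open D \<and> connected D \<and> u \<in> N' \<and> w' \<in> D \<and>
        closure N' \<inter> closure D = {} \<and> closure M \<inter> closure D = {} \<and>
        (\<forall>N. RS_open N \<and> N \<subseteq> N' \<longrightarrow> finite (crossings X N D))" if w': "w' \<in> B" for w'
    proof -
      have "\<not> linked X u w'" using neg w' B_def by blast
      then obtain N' M' where NM: "RS_open N'" "RS_open M'" "u \<in> N'" "w' \<in> M'" "closure N' \<inter> closure M' = {}"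
        and fin: "\<forall>N D. RS_open N \<and> RS_open D \<and> N \<subseteq> N' \<and> D \<subseteq> M' \<longrightarrow> finite (crossings X N D)"
        by (rule not_linked_nbhds[OF X])
      \<comment> \<open>D is kept off \<open>closure M\<close>, since N, M and D are to be the three
        sets of a K(3,3) and need disjoint closures.\<close>
      have "RS_open (M' \<inter> - closure M)" by (intro openin_Int_open NM) auto
      moreover have "w' \<in> M' \<inter> - closure M" using NM w' M(4) unfolding B_def by auto
      ultimately obtain D where D: "RS_open D" "connected D" "w' \<in> D" "closure D \<subseteq> M' \<inter> - closure M"
        using connected_openin_nbhd by blast
      have "D \<subseteq> M'" using D(4) closure_subset by blast
      moreover have "closure N' \<inter> closure D = {}" using NM(5) closure_mono[OF \<open>D \<subseteq> M'\<close>] by blast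
      moreover have "closure M \<inter> closure D = {}" using D(4) by blast
      ultimately show ?thesis
        using NM(1,3) D(1-3) fin by (intro exI[of _ N'] exI[of _ D]) simp
    qed
    then obtain N' where "\<forall>w'\<in>B. \<exists>D. RS_open (N' w') \<and> RS_open D \<and> connected D \<and> u \<in> (N' w') \<and> w' \<in> D \<and>
        closure (N' w') \<inter> closure D = {} \<and> closure M \<inter> closure D = {} \<and>
        (\<forall>N. RS_open N \<and> N \<subseteq> N' w' \<longrightarrow> finite (crossings X N D))" by metis
    then obtain D where "\<forall>w'\<in>B. RS_open (N' w') \<and> RS_open (D w') \<and> connected (D w') \<and> u \<in> (N' w') \<and> w' \<in> D w' \<and>
        closure (N' w') \<inter> closure (D w') = {} \<and> closure M \<inter> closure (D w') = {} \<and>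
        (\<forall>N. RS_open N \<and> N \<subseteq> N' w' \<longrightarrow> finite (crossings X N (D w')))" by metis
    then have D: "RS_open (N' w')" "RS_open (D w')" "connected (D w')" "u \<in> N' w'" "w' \<in> D w'"
        "closure (N' w') \<inter> closure (D w') = {}" "closure M \<inter> closure (D w') = {}"
        "\<And>N. RS_open N \<Longrightarrow> N \<subseteq> N' w' \<Longrightarrow> finite (crossings X N (D w'))" if "w' \<in> B" for w'
      using that by simp_all
    have "\<forall>w'\<in>B. \<exists>T. open T \<and> D w' = RS \<inter> T" using D(2) by (simp add: openin_open)
    then obtain T where T: "\<And>w'. w' \<in> B \<Longrightarrow> open (T w')" "\<And>w'. w' \<in> B \<Longrightarrow> D w' = RS \<inter> T w'" by metis
    obtain F where F: "F \<subseteq> B" "finite F" "B \<subseteq> (\<Union>w'\<in>F. T w')"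
    proof (rule compactE_image[OF \<open>compact B\<close>, of B T])
      show "B \<subseteq> \<Union> (T ` B)" using D(5) T(2) by auto
    qed (use T in auto)
    have BD: "B \<subseteq> (\<Union>w'\<in>F. D w')"
    proof
      fix b assume b: "b \<in> B"
      then obtain w' where "w' \<in> F" "b \<in> T w'" using F(3) by blast
      then show "b \<in> (\<Union>w'\<in>F. D w')" using T(2)[of w'] F(1) b unfolding B_def by blast
    qed
    have "RS_open (RS \<inter> ball u r \<inter> (\<Inter>w'\<in>F. N' w'))"
    proof (cases "F = {}")
      case True
      then show ?thesis by (simp add: openin_open_Int)
    next
      case False
      have "RS_open (\<Inter>w'\<in>F. N' w')"
        using F(1) False D(1) by (intro openin_INT2[OF F(2)]) (use F(1) in blast)+
      then show ?thesis by (intro openin_Int openin_open_Int) auto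
    qed
    moreover have "u \<in> RS \<inter> ball u r \<inter> (\<Inter>w'\<in>F. N' w')" using u r F(1) D(4) by auto
    ultimately obtain N where N: "RS_open N" "connected N" "u \<in> N" "closure N \<subseteq> RS \<inter> ball u r \<inter> (\<Inter>w'\<in>F. N' w')"
      using connected_openin_nbhd by blast
    have NN: "N \<subseteq> N' w'" if "w' \<in> F" for w' using N(4) closure_subset[of N] that by blast
    have NMd: "closure N \<inter> closure M = {}" using N(4) M(4) by force
    have "infinite (crossings X N M)"
      using l N M NMd unfolding linked_def by blast
    moreover have "\<exists>w'\<in>F. C \<inter> D w' \<noteq> {}" if C: "C \<in> crossings X N M" for C
    proof -
      have Cc: "connected C" "C \<subseteq> RS" "C \<inter> closure N \<noteq> {}" "C \<inter> closure M \<noteq> {}"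
        using C X in_components_connected in_components_subset unfolding crossings_def by blast+
      have "C \<inter> sphere u r \<noteq> {}"
        using Cc N(4) M(4) by (intro connected_meets_sphere) blast+
      then have "C \<inter> B \<noteq> {}" using Cc(2) unfolding B_def by blast
      then show ?thesis using BD by blast
    qed
    ultimately obtain w' where w': "w' \<in> F" "infinite {C \<in> crossings X N M. C \<inter> D w' \<noteq> {}}" (is "infinite ?\<C>")
      using infinite_pigeonhole[of "crossings X N M" F "\<lambda>C w'. C \<inter> D w' \<noteq> {}"] F(2) by blast
    have wB: "w' \<in> B" using w' F by blast
    note Dw = D[OF wB]
    have NDd: "closure N \<inter> closure (D w') = {}" using Dw(6) closure_mono[OF NN[OF w'(1)]] by blast
    \<comment> \<open>M is removed along with N and \<open>D w'\<close> so that the pieces lie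
      outside all three sets; a piece that misses \<open>closure M\<close> remains a component when
      M is given back.\<close>
    let ?Q = "N \<union> M \<union> D w'"
    define \<E> where "\<E> = {E \<in> components (X - ?Q). E \<inter> closure N \<noteq> {} \<and> E \<inter> closure (D w') \<noteq> {}}"
    have oQ: "RS_open ?Q" using N M Dw by blast
    have "infinite \<E>"
    proof (rule infinite_refinement[OF w'(2)])
      show "pairwise disjnt ?\<C>"
        by (rule pairwise_subset[OF pairwise_disjnt_crossings[of X N M]]) blast
      fix C assume "C \<in> ?\<C>"
      then have C: "C \<in> components (X - (N \<union> M))" "C \<inter> closure N \<noteq> {}" "C \<inter> D w' \<noteq> {}"
        by (auto simp: crossings_def)
      have "compact (X - (N \<union> M))" using X N M by (intro compact_Diff_openin) auto
      then have cC: "compact C" using compact_components C by blast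
      have CX: "C \<subseteq> X - (N \<union> M)" using C(1) in_components_subset by blast
      obtain E where E: "E \<in> components (C - (N \<union> D w'))" "E \<inter> closure N \<noteq> {}" "E \<inter> closure (D w') \<noteq> {}"
      proof (rule continuum_crossing[OF cC _ _ NDd])
        show "connected C" using C in_components_connected by blast
        have "compact (C - (N \<union> D w'))" using N Dw CX cC X by (intro compact_Diff_openin[of C RS]) auto
        then show "closed (C - (N \<union> D w'))" by (rule compact_imp_closed)
        show "C \<inter> closure N \<noteq> {}" by fact
        show "C \<inter> closure (D w') \<noteq> {}" using C(3) closure_subset by blast
      qed
      have "C - (N \<union> D w') = C - ?Q" using CX by blast
      then have "E \<in> components (X - ?Q)" using components_Diff_trans[OF C(1), of E ?Q] E(1) by auto
      then have "E \<in> \<E>" using E by (simp add: \<E>_def)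
      moreover have "E \<subseteq> C" "E \<noteq> {}" using E(1) in_components_subset in_components_nonempty by blast+
      ultimately show "\<exists>E\<in>\<E>. E \<subseteq> C \<and> E \<noteq> {}" by blast
    qed
    moreover have "finite {E \<in> components (X - ?Q). E \<inter> closure N \<noteq> {} \<and> E \<inter> closure M \<noteq> {} \<and> E \<inter> closure (D w') \<noteq> {}}"
      by (rule finite_components_touching_three[OF X oQ N(1,2) M(1,2) Dw(2,3)]) (use NMd NDd Dw(7) in auto)
    ultimately have "infinite (\<E> - {E \<in> components (X - ?Q). E \<inter> closure N \<noteq> {} \<and> E \<inter> closure M \<noteq> {} \<and> E \<inter> closure (D w') \<noteq> {}})"
      by (rule Diff_infinite_finite[rotated])
    moreover have "\<E> - {E \<in> components (X - ?Q). E \<inter> closure N \<noteq> {} \<and> E \<inter> closure M \<noteq> {} \<and> E \<inter> closure (D w') \<noteq> {}} \<subseteq> crossings X N (D w')"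
    proof
      fix E assume "E \<in> \<E> - {E \<in> components (X - ?Q). E \<inter> closure N \<noteq> {} \<and> E \<inter> closure M \<noteq> {} \<and> E \<inter> closure (D w') \<noteq> {}}"
      then have E: "E \<in> components (X - ?Q)" "E \<inter> closure N \<noteq> {}" "E \<inter> closure (D w') \<noteq> {}" "E \<inter> closure M = {}"
        by (auto simp: \<E>_def)
      have "E \<in> components (X - (N \<union> D w'))"
      proof (rule components_Diff_forget[OF compact_Diff_openin[OF X oQ] E(1), of _ "closure M"])
        show "N \<union> M \<union> D w' \<subseteq> N \<union> D w' \<union> closure M" using closure_subset[of M] by blast
      qed (use E in auto)
      then show "E \<in> crossings X N (D w')" using E by (simp add: crossings_def)
    qed
    ultimately have "infinite (crossings X N (D w'))" using infinite_super by blast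
    then show False using Dw(8)[OF N(1) NN[OF w'(1)]] by blast
  qed
  then show ?thesis using that by auto
qed

section \<open>Hausdorff limits, and Schoenflies pairs close to a linked pair\<close>

text \<open>This is Blaschke's selection theorem. The functions \<open>infdist x (P n)\<close> of x
  are 1-Lipschitz and uniformly bounded on S, so Arzela-Ascoli yields a uniform limit g along a
  subsequence; the limit set is the zero set of g.\<close>

lemma hausdorff_lim_subsequence:
  fixes P :: "nat \<Rightarrow> pt set"
  assumes S: "compact S" and P: "\<And>n. compact (P n)" "\<And>n. P n \<noteq> {}" "\<And>n. P n \<subseteq> S"
  obtains \<sigma> Q where "strict_mono \<sigma>" "hausdorff_lim (P \<circ> \<sigma>) Q" "Q \<subseteq> S"
proof -
  obtain B where B: "\<And>x y. x \<in> S \<Longrightarrow> y \<in> S \<Longrightarrow> dist x y \<le> B"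
    using compact_imp_bounded[OF S] unfolding bounded_two_points by blast
  obtain g \<sigma> where g: "continuous_on S g" "strict_mono (\<sigma> :: nat \<Rightarrow> nat)"
    and lim: "\<And>e. 0 < e \<Longrightarrow> \<exists>N. \<forall>n x. n \<ge> N \<and> x \<in> S \<longrightarrow> norm (infdist x (P (\<sigma> n)) - g x) < e"
  proof (rule Arzela_Ascoli[OF S, of "\<lambda>n x. infdist x (P n)" B])
    show "norm (infdist x (P n)) \<le> B" if x: "x \<in> S" for n x
    proof -
      obtain a where "a \<in> P n" using P(2) by blast
      then have "infdist x (P n) \<le> dist x a" by (rule infdist_le)
      also have "\<dots> \<le> B" using B x \<open>a \<in> P n\<close> P(3) by blast
      finally show ?thesis using infdist_nonneg[of x "P n"] by simp
    qed
    show "\<exists>d>0. \<forall>n y. y \<in> S \<and> norm (x - y) < d \<longrightarrow> norm (infdist x (P n) - infdist y (P n)) < e" if "e > 0" for x e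
    proof (intro exI[of _ e] conjI allI impI)
      fix n y assume "y \<in> S \<and> norm (x - y) < e"
      then show "norm (infdist x (P n) - infdist y (P n)) < e"
        using infdist_triangle_abs[of x "P n" y] by (simp add: dist_norm)
    qed (fact that)
  qed (rule that; assumption)
  define Q where "Q = {p \<in> S. g p = 0}"
  have "closed {p \<in> S. g p = 0}"
    using continuous_closed_preimage[OF g(1), of "{0}"] S by (simp add: compact_imp_closed vimage_def Int_def)
  then have cQ: "compact Q" using S unfolding Q_def by (metis (no_types, lifting) compact_Int_closed inf.absorb2 mem_Collect_eq subsetI)
  have g0: "0 \<le> g x" if x: "x \<in> S" for x
  proof (rule ccontr)
    assume "\<not> 0 \<le> g x"
    then obtain n where "norm (infdist x (P (\<sigma> n)) - g x) < - g x" using lim[of "- g x"] x by fastforce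
    then show False using infdist_nonneg[of x "P (\<sigma> n)"] by simp
  qed
  have close1: "\<forall>\<^sub>F n in sequentially. \<forall>a\<in>P (\<sigma> n). \<exists>b\<in>Q. dist a b < e" if e: "e > 0" for e
  proof -
    \<comment> \<open>On the compact set of points at distance at least e from Q, the limit g has a
      positive lower bound m, whereas \<open>infdist\<close> vanishes on
      \<open>P (\<sigma> n)\<close>; for large n the two sets cannot meet.\<close>
    define A where "A = {a \<in> S. \<forall>b\<in>Q. e \<le> dist a b}"
    have Aeq: "A = S \<inter> (\<Inter>b\<in>Q. {a. e \<le> dist a b})" by (auto simp: A_def)
    have "closed (\<Inter>b\<in>Q. {a. e \<le> dist a b})" by (intro closed_INT ballI closed_Collect_le continuous_intros)
    then have cA: "compact A" unfolding Aeq using S by (simp add: compact_Int_closed)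
    have "\<exists>m>0. \<forall>a\<in>A. m \<le> g a"
    proof (cases "A = {}")
      case False
      have "continuous_on A g" using g(1) by (rule continuous_on_subset) (auto simp: A_def)
      then obtain a where a: "a \<in> A" "\<And>a'. a' \<in> A \<Longrightarrow> g a \<le> g a'"
        using continuous_attains_inf[OF cA False] by blast
      have "g a \<noteq> 0"
      proof
        assume "g a = 0"
        then have "a \<in> Q" using a(1) by (auto simp: A_def Q_def)
        then show False using a(1) e by (auto simp: A_def)
      qed
      then have "g a > 0" using g0[of a] a(1) by (simp add: A_def)
      then show ?thesis using a(2) by blast
    qed (auto intro: exI[of _ 1])
    then obtain m where m: "m > 0" "\<And>a. a \<in> A \<Longrightarrow> m \<le> g a" by blast
    obtain N where N: "\<And>n x. n \<ge> N \<Longrightarrow> x \<in> S \<Longrightarrow> norm (infdist x (P (\<sigma> n)) - g x) < m" using lim[OF m(1)] by blast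
    have "\<exists>b\<in>Q. dist a b < e" if "n \<ge> N" "a \<in> P (\<sigma> n)" for n a
    proof -
      have "a \<in> S" using that P(3) by blast
      then have "g a < m" using N[OF that(1), of a] that(2) by simp
      then have "a \<notin> A" using m(2) by fastforce
      then show ?thesis using \<open>a \<in> S\<close> unfolding A_def by (simp add: not_le)
    qed
    then show ?thesis unfolding eventually_sequentially by blast
  qed
  have close2: "\<forall>\<^sub>F n in sequentially. \<forall>b\<in>Q. \<exists>a\<in>P (\<sigma> n). dist a b < e" if e: "e > 0" for e
  proof -
    obtain N where N: "\<And>n x. n \<ge> N \<Longrightarrow> x \<in> S \<Longrightarrow> norm (infdist x (P (\<sigma> n)) - g x) < e" using lim[OF e] by blast
    have "\<exists>a\<in>P (\<sigma> n). dist a b < e" if "n \<ge> N" "b \<in> Q" for n b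
    proof -
      have "infdist b (P (\<sigma> n)) < e" using N[OF that(1), of b] that(2) by (simp add: Q_def)
      moreover obtain a where "a \<in> P (\<sigma> n)" "infdist b (P (\<sigma> n)) = dist b a"
        using infdist_attains_inf[OF compact_imp_closed[OF P(1)] P(2)] by blast
      ultimately show ?thesis by (intro bexI[of _ a]) (simp_all add: dist_commute)
    qed
    then show ?thesis unfolding eventually_sequentially by blast
  qed
  have "Q \<noteq> {}"
  proof -
    obtain n where "\<forall>a\<in>P (\<sigma> n). \<exists>b\<in>Q. dist a b < 1"
      using close1[of 1] unfolding eventually_sequentially by auto
    then show ?thesis using P(2)[of "\<sigma> n"] by blast
  qed
  then have "hausdorff_lim (P \<circ> \<sigma>) Q"
    using cQ close1 close2 unfolding hausdorff_lim_def by (simp add: eventually_conj)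
  then show ?thesis using that g(2) by (auto simp: Q_def)
qed

lemma hausdorff_lim_meets_closed:
  assumes l: "hausdorff_lim P Q" and J: "closed J" "\<And>n. P n \<inter> J \<noteq> {}"
  shows "Q \<inter> J \<noteq> {}"
proof
  assume e: "Q \<inter> J = {}"
  have "compact Q" using l by (simp add: hausdorff_lim_def)
  then obtain d where d: "d > 0" "\<And>x y. x \<in> Q \<Longrightarrow> y \<in> J \<Longrightarrow> d \<le> dist x y"
    using separate_compact_closed[OF _ J(1) e] by blast
  then obtain n where "\<forall>a\<in>P n. \<exists>b\<in>Q. dist a b < d"
    using l unfolding hausdorff_lim_def eventually_sequentially by (metis order_refl)
  moreover obtain a where "a \<in> P n" "a \<in> J" using J(2) by blast
  ultimately obtain b where "b \<in> Q" "dist a b < d" by blast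
  then show False using d(2)[OF \<open>b \<in> Q\<close> \<open>a \<in> J\<close>] by (simp add: dist_commute)
qed

lemma closure_open_annulus:
  fixes c :: complex
  assumes "0 < r" "r < R"
  shows "closure {z. r < dist c z \<and> dist c z < R} = {z. r \<le> dist c z \<and> dist c z \<le> R}" (is "closure ?A = ?B")
proof
  have "closed ?B" by (intro closed_Collect_conj closed_Collect_le continuous_intros)
  then show "closure ?A \<subseteq> ?B" by (intro closure_minimal) auto
  show "?B \<subseteq> closure ?A"
  proof
    fix z assume z: "z \<in> ?B"
    define \<rho> where "\<rho> = dist c z"
    define v where "v = (z - c) /\<^sub>R \<rho>"
    have \<rho>: "\<rho> \<in> {r..R}" "\<rho> > 0" using z assms by (auto simp: \<rho>_def)
    have nv: "norm v = 1" using \<rho>(2) by (simp add: v_def \<rho>_def dist_norm norm_minus_commute)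
    have zv: "z = c + \<rho> *\<^sub>R v" using \<rho>(2) by (simp add: v_def)
    define q where "q = (\<lambda>t. c + t *\<^sub>R v)"
    have dq: "dist c (q t) = t" if "t \<ge> 0" for t using nv that by (simp add: q_def dist_norm)
    have "continuous_on (closure {r<..<R}) q" unfolding q_def by (intro continuous_intros)
    then have "q ` closure {r<..<R} \<subseteq> closure ?A"
    proof (rule image_closure_subset)
      have "q ` {r<..<R} \<subseteq> ?A" using dq assms by auto
      then show "q ` {r<..<R} \<subseteq> closure ?A" using closure_subset by blast
    qed simp
    moreover have "\<rho> \<in> closure {r<..<R}" using \<rho>(1) assms by (simp add: closure_greaterThanLessThan)
    ultimately show "z \<in> closure ?A" using zv unfolding q_def by blast
  qed
qed

lemma component_if_clopen:
  assumes "connected U" "U \<noteq> {}" "U \<subseteq> S" "openin (top_of_set S) U" "closedin (top_of_set S) U"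
  shows "U \<in> components S"
  unfolding in_components_maximal
proof (intro conjI allI impI)
  show "U \<noteq> {}" "U \<subseteq> S" "connected U" by fact+
  fix E assume E: "E \<noteq> {} \<and> U \<subseteq> E \<and> E \<subseteq> S \<and> connected E"
  have "openin (top_of_set E) U" using assms(4) E by (meson openin_subset_trans)
  moreover have "closedin (top_of_set E) U" using assms(5) E by (meson closedin_subset_trans)
  ultimately show "E = U" using E assms(2) unfolding connected_clopen by blast
qed

text \<open>After projection from x, a round annulus about \<open>h y\<close> with small inner and
  large outer radius has one boundary circle close to y and the other close to x on the sphere. With
  N beyond the outer and M within the inner circle, \<open>X - (N \<union> M)\<close> is the part of
  X in the closed annulus, so crossings are components of that part meeting both circles. Their
  Hausdorff limit meets the circles in points that need not be x and y, which is why the closure of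
  the relation appears.\<close>

lemma linked_imp_closure:
  assumes X: "compact X" "X \<subseteq> RS" and xy: "x \<in> RS" "y \<in> RS" "x \<noteq> y" and l: "linked X x y"
  shows "(x, y) \<in> closure (schoenflies_rel X)"
  unfolding closure_approachable
proof (intro allI impI)
  fix e :: real assume "e > 0"
  define e' where "e' = e / 2"
  have e': "e' > 0" using \<open>e > 0\<close> by (simp add: e'_def)
  obtain h k where hk: "homeomorphism (RS - {x}) (UNIV :: complex set) h k"
    using punctured_sphere_homeomorphism xy(1) by blast
  have kh: "k (h p) = p" if "p \<in> RS - {x}" for p using hk that by (simp add: homeomorphism_def)
  have hkz: "h (k z) = z" for z using hk by (simp add: homeomorphism_def)
  have kRS: "k z \<in> RS - {x}" for z using hk by (auto simp: homeomorphism_def)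
  have ch: "continuous_on (RS - {x}) h" and ck: "continuous_on UNIV k" using hk by (simp_all add: homeomorphism_def)
  have injk: "inj k" using hkz by (metis injI)
  have oRx: "RS_open (RS - {x})" by (simp add: openin_delete)
  have ok: "RS_open (k ` T)" if "open T" for T
  proof -
    have "openin (top_of_set (RS - {x})) (k ` T)"
      using homeomorphism_imp_open_map[OF homeomorphism_symD[OF hk], of T] that by simp
    then show ?thesis using oRx openin_trans by blast
  qed
  have compk: "compact (k ` T)" if "compact T" for T
    using that by (intro compact_continuous_image continuous_on_subset[OF ck]) auto
  define c where "c = h y"
  have kc: "k c = y" using kh xy by (simp add: c_def)
  obtain r0 where r0: "r0 > 0" "\<And>z. dist z c < r0 \<Longrightarrow> dist (k z) (k c) < e'"
    using ck e' unfolding continuous_on_iff by (metis UNIV_I)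
  define r where "r = r0 / 2"
  have r: "r > 0" "\<And>z. dist c z \<le> r \<Longrightarrow> dist (k z) y < e'"
    using r0 kc by (auto simp: r_def dist_commute)
  have "compact (RS - ball x e')" using compact_RS compact_diff by blast
  then have "compact (h ` (RS - ball x e'))"
    using e' by (intro compact_continuous_image continuous_on_subset[OF ch]) auto
  then obtain R0 where R0: "h ` (RS - ball x e') \<subseteq> ball c R0"
    using compact_imp_bounded bounded_subset_ballD by blast
  \<comment> \<open>\<open>R0\<close> bounds the images of all points at distance at least e' from
    x, so whatever is projected beyond it is close to x; \<open>r + 1\<close> keeps the annulus
    nondegenerate.\<close>
  define R where "R = max R0 (r + 1)"
  have R: "r < R" "\<And>p. p \<in> RS - {x} \<Longrightarrow> R \<le> dist c (h p) \<Longrightarrow> dist x p < e'"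
  proof -
    show "r < R" by (simp add: R_def)
    fix p assume p: "p \<in> RS - {x}" "R \<le> dist c (h p)"
    then have "h p \<notin> ball c R0" by (simp add: R_def)
    then show "dist x p < e'" using R0 p by force
  qed
  define J1 J2 U where "J1 = k ` sphere c R" and "J2 = k ` sphere c r" and "U = k ` {z. r < dist c z \<and> dist c z < R}"
  define N M where "N = RS - k ` cball c R" and "M = k ` ball c r"
  have oN: "RS_open N"
  proof -
    have "N = RS \<inter> - (k ` cball c R)" by (auto simp: N_def)
    then show ?thesis using compk[of "cball c R"] by (simp add: openin_open_Int compact_imp_closed open_Compl)
  qed
  have oM: "RS_open M" unfolding M_def by (rule ok) simp
  have xN: "x \<in> N" using xy kRS by (force simp: N_def)
  have yM: "y \<in> M" using kc r(1) by (force simp: M_def)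
  have clM: "closure M \<subseteq> k ` cball c r"
    unfolding M_def by (intro closure_minimal image_mono ball_subset_cball compact_imp_closed compk) simp
  have clN: "closure N \<subseteq> RS - k ` ball c R"
  proof (rule closure_minimal)
    show "N \<subseteq> RS - k ` ball c R" using ball_subset_cball[of c R] by (auto simp: N_def)
    show "closed (RS - k ` ball c R)"
      using compact_Diff_openin[OF compact_RS order_refl ok, of "ball c R"] by (simp add: compact_imp_closed)
  qed
  have NMd: "closure N \<inter> closure M = {}"
  proof -
    have "cball c r \<subseteq> ball c R" using R(1) by auto
    then show ?thesis using clM clN by blast
  qed
  have clU: "closure U = k ` {z. r \<le> dist c z \<and> dist c z \<le> R}" (is "_ = k ` ?A")
  proof
    have "?A = cball c R - ball c r" by auto
    then have cA: "compact ?A" using compact_diff[OF compact_cball open_ball, of c R c r] by simp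
    show "closure U \<subseteq> k ` ?A"
      unfolding U_def by (intro closure_minimal image_mono compact_imp_closed compk cA) auto
    show "k ` ?A \<subseteq> closure U"
      unfolding U_def closure_open_annulus[OF r(1) R(1), symmetric]
      by (intro image_closure_subset continuous_on_subset[OF ck]) (auto simp: closure_subset)
  qed
  have XU: "X - (N \<union> M) = closure U \<inter> X"
  proof -
    have "{z. r \<le> dist c z \<and> dist c z \<le> R} = cball c R - ball c r" by auto
    then have "closure U = k ` cball c R - k ` ball c r" using clU image_set_diff[OF injk] by simp
    then show ?thesis unfolding N_def M_def using X(2) by auto
  qed
  have J: "simple_closed_curve (k ` sphere c s)" if "s > 0" for s
    unfolding simple_closed_curve_def
  proof (intro exI[of _ "k \<circ> circlepath c s"] conjI)
    show "simple_path (k \<circ> circlepath c s)"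
      using that ck injk by (intro simple_path_continuous_image) (auto simp: simple_path_circlepath elim: continuous_on_subset inj_on_subset)
    show "k ` sphere c s \<subseteq> RS" using kRS by blast
  qed (use that in \<open>simp_all add: pathstart_compose pathfinish_compose path_image_compose\<close>)
  have scc: "simple_closed_curve J1" "simple_closed_curve J2" using J r(1) R(1) by (auto simp: J1_def J2_def)
  have J12: "J1 \<inter> J2 = {}"
  proof -
    have "sphere c R \<inter> sphere c r = {}" using R(1) by auto
    then show ?thesis unfolding J1_def J2_def image_Int[OF injk, symmetric] by simp
  qed
  have oU: "RS_open U"
    unfolding U_def by (intro ok open_Collect_conj open_Collect_less continuous_intros)
  have Usplit: "closure U = U \<union> (J1 \<union> J2)" "U \<inter> (J1 \<union> J2) = {}"
  proof -
    let ?A = "{z. r < dist c z \<and> dist c z < R}"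
    have "{z. r \<le> dist c z \<and> dist c z \<le> R} = ?A \<union> (sphere c R \<union> sphere c r)" using R(1) by auto
    then show "closure U = U \<union> (J1 \<union> J2)" unfolding clU by (simp add: U_def J1_def J2_def image_Un)
    have "?A \<inter> (sphere c R \<union> sphere c r) = {}" by auto
    then show "U \<inter> (J1 \<union> J2) = {}"
      unfolding U_def J1_def J2_def image_Un[symmetric] image_Int[OF injk, symmetric] by simp
  qed
  have URS: "U \<subseteq> RS" "closure U \<subseteq> RS" unfolding clU unfolding U_def using kRS by blast+
  have U: "is_U J1 J2 U"
    unfolding is_U_def
  proof
    show "U \<in> components (RS - (J1 \<union> J2))"
    proof (rule component_if_clopen)
      have "connected {z. r < dist c z \<and> dist c z < R}"
      proof -
        have "connected {z. r < norm (z - c) \<and> norm (z - c) < R}" by (rule connected_annulus) simp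
        then show ?thesis by (simp add: dist_norm norm_minus_commute)
      qed
      then show "connected U" unfolding U_def by (intro connected_continuous_image continuous_on_subset[OF ck]) auto
      obtain z where "z \<in> {z. r \<le> dist c z \<and> dist c z \<le> R}"
      proof
        show "c + of_real r \<in> {z. r \<le> dist c z \<and> dist c z \<le> R}" using r R by (simp add: dist_norm)
      qed
      then have "closure U \<noteq> {}" unfolding clU by blast
      then show "U \<noteq> {}" by auto
      show sub: "U \<subseteq> RS - (J1 \<union> J2)" using URS Usplit by blast
      show "openin (top_of_set (RS - (J1 \<union> J2))) U" using oU sub by (rule openin_subset_trans) auto
      have "U = (RS - (J1 \<union> J2)) \<inter> closure U" using Usplit URS by blast
      then show "closedin (top_of_set (RS - (J1 \<union> J2))) U" by (metis closed_closure closedin_closed_Int)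
    qed
    have "top_of_set RS closure_of U = closure U" using URS by (simp add: closure_of_subtopology Int_absorb1)
    then show "top_of_set RS frontier_of U = J1 \<union> J2"
      unfolding frontier_of_def using oU Usplit by (auto simp: interior_of_openin)
  qed
  have "infinite (crossings X N M)" using l oN oM xN yM NMd unfolding linked_def by blast
  then obtain P :: "nat \<Rightarrow> pt set" where P: "inj P" "range P \<subseteq> crossings X N M" using infinite_countable_subset by blast
  have PC: "P n \<in> components (closure U \<inter> X)" "P n \<inter> J1 \<noteq> {}" "P n \<inter> J2 \<noteq> {}" for n
  proof -
    have "P n \<in> crossings X N M" using P(2) by blast
    then have p: "P n \<in> components (closure U \<inter> X)" "P n \<inter> closure N \<noteq> {}" "P n \<inter> closure M \<noteq> {}"
      unfolding crossings_def XU by auto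
    show "P n \<in> components (closure U \<inter> X)" by fact
    have sub: "P n \<subseteq> k ` {z. r \<le> dist c z \<and> dist c z \<le> R}" using p(1) in_components_subset clU by blast
    obtain a where a: "a \<in> P n" "a \<in> closure N" using p(2) by blast
    then obtain z where z: "a = k z" "r \<le> dist c z" "dist c z \<le> R" using sub by blast
    have "\<not> dist c z < R" using a(2) clN z(1) by auto
    then show "P n \<inter> J1 \<noteq> {}" using a(1) z by (auto simp: J1_def)
    obtain b where b: "b \<in> P n" "b \<in> closure M" using p(3) by blast
    then obtain z where z: "b = k z" "r \<le> dist c z" "dist c z \<le> R" using sub by blast
    obtain z' where "b = k z'" "dist c z' \<le> r" using b(2) clM by auto
    then have "dist c z \<le> r" using injD[OF injk, of z z'] z(1) by simp
    then show "P n \<inter> J2 \<noteq> {}" using b(1) z by (auto simp: J2_def)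
  qed
  have cXU: "compact (closure U \<inter> X)" using X(1) by (simp add: closed_Int_compact)
  obtain \<sigma> Q where \<sigma>: "strict_mono \<sigma>" "hausdorff_lim (P \<circ> \<sigma>) Q" "Q \<subseteq> X"
  proof (rule hausdorff_lim_subsequence[OF X(1), of P])
    show "compact (P n)" "P n \<noteq> {}" "P n \<subseteq> X" for n
      using PC(1)[of n] compact_components[OF cXU] in_components_nonempty in_components_subset by blast+
  qed
  obtain x' where x': "x' \<in> Q" "x' \<in> J1"
    using hausdorff_lim_meets_closed[OF \<sigma>(2), of J1] PC(2) compk[of "sphere c R"] by (auto simp: J1_def compact_imp_closed)
  obtain y' where y': "y' \<in> Q" "y' \<in> J2"
    using hausdorff_lim_meets_closed[OF \<sigma>(2), of J2] PC(3) compk[of "sphere c r"] by (auto simp: J2_def compact_imp_closed)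
  have "(x', y') \<in> schoenflies_rel X"
  proof -
    have "inj (P \<circ> \<sigma>)" using P(1) \<sigma>(1) by (simp add: inj_compose strict_mono_imp_inj_on)
    moreover have "\<forall>n. (P \<circ> \<sigma>) n \<in> components (closure U \<inter> X) \<and> (P \<circ> \<sigma>) n \<inter> J1 \<noteq> {} \<and> (P \<circ> \<sigma>) n \<inter> J2 \<noteq> {}"
      using PC by simp
    moreover have "{x', y'} \<subseteq> Q" "x' \<in> X" "y' \<in> X" "x' \<noteq> y'" using x' y' \<sigma>(3) J12 by auto
    ultimately show ?thesis
      unfolding schoenflies_rel_def using scc J12 x'(2) y'(2) U \<sigma>(2) by blast
  qed
  moreover have "dist x' x < e'"
  proof -
    obtain z where "x' = k z" "dist c z = R" using x'(2) by (auto simp: J1_def)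
    then show ?thesis using R(2)[OF kRS, of z] hkz by (simp add: dist_commute)
  qed
  moreover have "dist y' y < e'" using y'(2) r(2) by (auto simp: J2_def)
  ultimately have "dist (x', y') (x, y) < e"
  proof -
    assume a: "dist x' x < e'" "dist y' y < e'"
    have "dist (x', y') (x, y) \<le> dist x' x + dist y' y"
      unfolding dist_Pair_Pair by (rule order_trans[OF sqrt_sum_squares_le_sum]) simp_all
    then show ?thesis using a by (simp add: e'_def)
  qed
  then show "\<exists>q\<in>schoenflies_rel X. dist q (x, y) < e" using \<open>(x', y') \<in> schoenflies_rel X\<close> by blast
qed

section \<open>The far side of a simple closed curve, and Schoenflies pairs are linked\<close>

lemma locally_connected_path_image:
  fixes g :: "real \<Rightarrow> 'a::metric_space"
  assumes "path g"
  shows "locally connected (path_image g)"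
  unfolding path_image_def
proof (rule locally_connected_quotient_image)
  show "locally connected {0..1::real}" by (intro convex_imp_locally_connected) simp
  fix T assume "T \<subseteq> g ` {0..1}"
  then show "openin (top_of_set {0..1}) ({0..1} \<inter> g -` T) = openin (top_of_set (g ` {0..1})) T"
    using assms by (intro Abstract_Topology_2.continuous_imp_quotient_map) (auto simp: path_def)
qed

lemma simple_closed_curve_facts:
  assumes "simple_closed_curve J"
  shows "compact J" "connected J" "J \<subseteq> RS" "locally connected J"
proof -
  obtain g where g: "simple_path g" "path_image g = J" "J \<subseteq> RS"
    using assms unfolding simple_closed_curve_def by blast
  have p: "path g" using g(1) simple_path_imp_path by blast
  show "compact J" "connected J" "locally connected J"
    using compact_path_image[OF p] connected_path_image[OF p] locally_connected_path_image[OF p] g(2) by simp_all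
  show "J \<subseteq> RS" by fact
qed

lemma connected_avoids_clopen:
  assumes U: "connected U" "U \<subseteq> RS" "U \<inter> J = {}" and D: "RS_open D" "closure D \<subseteq> D \<union> J"
    and p: "p \<in> U" "p \<notin> D"
  shows "U \<inter> D = {}"
proof -
  have "openin (top_of_set U) (U \<inter> D)"
  proof -
    obtain T where "open T" "D = RS \<inter> T" using D(1) by (auto simp: openin_open)
    moreover from this have "U \<inter> D = U \<inter> T" using U(2) by blast
    ultimately show ?thesis by (simp add: openin_open_Int)
  qed
  moreover have "U \<inter> D = U \<inter> closure D" using D(2) U(3) closure_subset by blast
  then have "closedin (top_of_set U) (U \<inter> D)" by (simp add: closedin_closed_Int)
  ultimately have "U \<inter> D = {} \<or> U \<inter> D = U" using U(1) unfolding connected_clopen by blast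
  then show ?thesis using p by blast
qed

lemma punctured_sphere_open:
  assumes hk: "homeomorphism (RS - {p}) (UNIV :: complex set) h k" and T: "open T"
  shows "RS_open (k ` T)"
proof -
  have "openin (top_of_set (RS - {p})) (k ` T)"
    using homeomorphism_imp_open_map[OF homeomorphism_symD[OF hk], of T] T by simp
  moreover have "RS_open (RS - {p})" by (simp add: openin_delete)
  ultimately show ?thesis using openin_trans by blast
qed

text \<open>Projection from a point p of U makes the side of J away from p the inside of a plane
  Jordan curve. U is connected and off J, so it cannot enter that side.\<close>

lemma simple_closed_curve_other_side:
  assumes J: "simple_closed_curve J" and U: "connected U" "U \<noteq> {}" "U \<subseteq> RS" "U \<inter> J = {}"
  obtains D where "RS_open D" "connected D" "D \<inter> J = {}" "D \<inter> U = {}"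
    "J \<subseteq> closure D" "closure D \<subseteq> D \<union> J"
proof -
  obtain p where p: "p \<in> U" using U(2) by blast
  obtain g where g: "simple_path g" "pathfinish g = pathstart g" "path_image g = J" "J \<subseteq> RS"
    using J unfolding simple_closed_curve_def by blast
  obtain h k where hk: "homeomorphism (RS - {p}) (UNIV :: complex set) h k"
    using punctured_sphere_homeomorphism[of p] p U(3) by blast
  have JR: "J \<subseteq> RS - {p}" using g(4) p U(4) by blast
  have kh: "k (h x) = x" if "x \<in> RS - {p}" for x using hk that by (simp add: homeomorphism_def)
  have hkz: "h (k z) = z" for z using hk by (simp add: homeomorphism_def)
  have kRS: "k z \<in> RS - {p}" for z using hk by (auto simp: homeomorphism_def)
  have ch: "continuous_on (RS - {p}) h" and ck: "continuous_on UNIV k" using hk by (simp_all add: homeomorphism_def)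
  have ckS: "continuous_on S k" for S using ck continuous_on_subset by blast
  have injh: "inj_on h (RS - {p})" using kh by (metis inj_onI)
  define c where "c = h \<circ> g"
  have c: "simple_path c" "pathfinish c = pathstart c" "path_image c = h ` J"
    unfolding c_def
    using g JR injh by (auto intro!: simple_path_continuous_image continuous_on_subset[OF ch] inj_on_subset[OF injh]
        simp: pathstart_compose pathfinish_compose path_image_compose)
  define I where "I = inside (h ` J)"
  have I: "open I" "connected I" "bounded I" "frontier I = h ` J"
    using Jordan_inside_outside[OF c(1,2)] by (simp_all add: I_def c(3))
  have IJ: "I \<inter> h ` J = {}" using inside_not_in[of _ "h ` J"] by (auto simp: I_def)
  have clI: "closure I = I \<union> h ` J" using I(4) closure_Un_frontier by metis
  define D where "D = k ` I"
  have khJ: "k ` h ` J = J" using kh JR by force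
  have oD: "RS_open D" unfolding D_def by (rule punctured_sphere_open[OF hk I(1)])
  have cD: "connected D" unfolding D_def by (intro connected_continuous_image ckS I)
  have DJ: "D \<inter> J = {}"
  proof (rule equals0I)
    fix x assume "x \<in> D \<inter> J"
    then obtain z where "z \<in> I" "x = k z" "x \<in> J" by (auto simp: D_def)
    then have "z \<in> h ` J" using hkz by (metis imageI)
    then show False using IJ \<open>z \<in> I\<close> by blast
  qed
  have clD: "closure D \<subseteq> D \<union> J"
  proof -
    have "compact (k ` closure I)" using I(3) by (intro compact_continuous_image ckS) (simp add: compact_closure)
    then have "closure D \<subseteq> k ` closure I"
      unfolding D_def by (intro closure_minimal image_mono closure_subset compact_imp_closed)
    also have "\<dots> = D \<union> J" unfolding clI image_Un khJ D_def ..
    finally show ?thesis .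
  qed
  have JD: "J \<subseteq> closure D"
  proof -
    have "k ` closure I \<subseteq> closure D" unfolding D_def by (intro image_closure_subset ckS) (auto simp: closure_subset)
    then show ?thesis unfolding clI image_Un khJ by blast
  qed
  have "p \<notin> D" using kRS by (auto simp: D_def)
  then have "U \<inter> D = {}" using connected_avoids_clopen[OF U(1,3,4) oD clD p] by blast
  then show ?thesis using that[OF oD cD DJ _ JD clD] by blast
qed

text \<open>G is a hub for K(3,3): it keeps away from x, yet is touched by every set that reaches J
  outside N. The obvious candidate \<open>D \<inter> E0\<close> accumulates at J - N but need not be
  connected. By Janiszewski's theorem its points lie in one component of the complement of
  \<open>J \<union> T\<close>, where T consists of a connected piece \<alpha> of J around x and a
  closed neighbourhood of x.\<close>

lemma curve_hub:
  assumes J: "simple_closed_curve J" and U: "U \<inter> J = {}" "J \<subseteq> closure U" "U \<subseteq> RS"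
    and D: "RS_open D" "connected D" "D \<inter> J = {}" "D \<inter> U = {}" "J \<subseteq> closure D" "closure D \<subseteq> D \<union> J"
    and x: "x \<in> J" and N: "RS_open N" "x \<in> N"
  obtains N' G where "RS_open N'" "connected N'" "x \<in> N'" "closure N' \<subseteq> N"
    "RS_open G" "connected G" "G \<subseteq> D" "closure G \<inter> closure N' = {}" "J - N \<subseteq> closure G"
proof -
  note Jf = simple_closed_curve_facts[OF J]
  have xRS: "x \<in> RS" using x Jf by blast
  have DRS: "D \<subseteq> RS" using D openin_imp_subset by blast
  obtain h0 k0 where hk0: "homeomorphism (RS - {x}) (UNIV :: complex set) h0 k0"
    using punctured_sphere_homeomorphism[OF xRS] by blast
  have kh0: "k0 (h0 y) = y" if "y \<in> RS - {x}" for y using hk0 that by (simp add: homeomorphism_def)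
  have k0RS: "k0 z \<in> RS - {x}" for z using hk0 by (auto simp: homeomorphism_def)
  have ch0: "continuous_on (RS - {x}) h0" and ck0: "continuous_on S k0" for S
    using hk0 by (auto simp: homeomorphism_def elim: continuous_on_subset)
  have "compact (h0 ` (J - N))"
    using Jf N by (intro compact_continuous_image continuous_on_subset[OF ch0] compact_Diff_openin[of J RS]) auto
  then obtain R where R: "h0 ` (J - N) \<subseteq> ball 0 R" using compact_imp_bounded bounded_subset_ballD by blast
  \<comment> \<open>Projected from x, the set J - N is compact and so lies in a disc. E0 is this
    disc on the sphere, and N0 below is the complement of the closed disc, a neighbourhood of
    x.\<close>
  define E0 where "E0 = k0 ` ball 0 R"
  have E0: "RS_open E0" "connected E0" "E0 \<subseteq> RS" "J - N \<subseteq> E0"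
  proof -
    show "RS_open E0" unfolding E0_def by (intro punctured_sphere_open[OF hk0]) simp
    show "connected E0" unfolding E0_def by (intro connected_continuous_image ck0) simp
    show "E0 \<subseteq> RS" using k0RS by (auto simp: E0_def)
    show "J - N \<subseteq> E0"
    proof
      fix y assume y: "y \<in> J - N"
      then have "y \<in> RS - {x}" using Jf N by blast
      then show "y \<in> E0" unfolding E0_def using kh0[of y] R y by (metis imageI subsetD)
    qed
  qed
  define N0 where "N0 = RS - k0 ` cball 0 R"
  have N0: "RS_open N0" "x \<in> N0" "N0 \<inter> E0 = {}"
  proof -
    have "closed (k0 ` cball 0 R)" by (intro compact_imp_closed compact_continuous_image ck0) simp
    then have "RS_open (RS \<inter> - (k0 ` cball 0 R))" by (intro openin_open_Int) auto
    then show "RS_open N0" by (simp add: N0_def Diff_eq)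
    show "x \<in> N0" using xRS k0RS by (force simp: N0_def)
    show "N0 \<inter> E0 = {}" using ball_subset_cball[of 0 R] by (auto simp: N0_def E0_def)
  qed
  obtain N1 where N1: "RS_open N1" "x \<in> N1" "closure N1 \<subseteq> N0" using connected_openin_nbhd[OF N0(1,2)] by blast
  have "openin (top_of_set J) (J \<inter> N1)"
  proof -
    obtain T where "open T" "N1 = RS \<inter> T" using N1(1) by (auto simp: openin_open)
    moreover from this have "J \<inter> N1 = J \<inter> T" using Jf(3) by blast
    ultimately show ?thesis by (simp add: openin_open_Int)
  qed
  moreover have "x \<in> J \<inter> N1" using x N1 by blast
  ultimately obtain A where A: "openin (top_of_set J) A" "connected A" "x \<in> A" "A \<subseteq> J \<inter> N1"
    using Jf(4) unfolding locally_connected by metis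
  define \<alpha> where "\<alpha> = closure A"
  have \<alpha>: "connected \<alpha>" "A \<subseteq> \<alpha>" "\<alpha> \<subseteq> J" "\<alpha> \<subseteq> N0"
  proof -
    show "connected \<alpha>" unfolding \<alpha>_def using A(2) connected_imp_connected_closure by blast
    show "A \<subseteq> \<alpha>" unfolding \<alpha>_def by (rule closure_subset)
    show "\<alpha> \<subseteq> J" unfolding \<alpha>_def using A(4) Jf(1) by (intro closure_minimal compact_imp_closed) auto
    show "\<alpha> \<subseteq> N0" unfolding \<alpha>_def using A(4) N1(3) closure_mono[of A N1] by blast
  qed
  obtain T0 where T0: "open T0" "A = J \<inter> T0" using A(1) by (auto simp: openin_open)
  \<comment> \<open>As \<open>closure N2\<close> stays within T0, it meets J only inside A; this is
    what makes \<open>J \<inter> T\<close> equal to the connected set \<alpha>.\<close>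
  have "RS_open (N \<inter> N0 \<inter> T0)" by (intro openin_Int_open openin_Int N N0 T0)
  moreover have "x \<in> N \<inter> N0 \<inter> T0" using N N0 A T0 by blast
  ultimately obtain N2 where N2: "RS_open N2" "connected N2" "x \<in> N2" "closure N2 \<subseteq> N \<inter> N0 \<inter> T0"
    using connected_openin_nbhd by blast
  obtain N' where N': "RS_open N'" "connected N'" "x \<in> N'" "closure N' \<subseteq> N2"
    using connected_openin_nbhd[OF N2(1,3)] by blast
  have N'N: "closure N' \<subseteq> N" using N'(4) N2(4) closure_subset[of N2] by blast
  define T where "T = \<alpha> \<union> closure N2"
  have N2RS: "N2 \<subseteq> RS" using N2 openin_imp_subset by blast
  have cN2: "closure N2 \<subseteq> RS" using N2RS compact_RS by (simp add: closure_minimal compact_imp_closed)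
  have T: "closed T" "T \<subseteq> N0" "T \<subseteq> RS" "J \<inter> T = \<alpha>"
  proof -
    show "closed T" by (simp add: T_def \<alpha>_def closed_Un)
    show "T \<subseteq> N0" using \<alpha> N2 by (auto simp: T_def)
    show "T \<subseteq> RS" using \<alpha> Jf(3) cN2 by (auto simp: T_def)
    show "J \<inter> T = \<alpha>" using \<alpha> T0 N2(4) by (auto simp: T_def)
  qed
  have "N2 \<inter> U \<noteq> {}"
  proof -
    obtain S where S: "open S" "N2 = RS \<inter> S" using N2(1) by (auto simp: openin_open)
    have "x \<in> closure U" using x U by blast
    then have "S \<inter> U \<noteq> {}" using S N2(3) by (metis IntE disjoint_iff open_Int_closure_eq_empty)
    then show ?thesis using S U(3) by blast
  qed
  \<comment> \<open>The point p lies in T but off J, D and E0. Projecting from it leaves J compact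
    and the rest of T merely closed, which is the form of hypothesis in
    \<open>Janiszewski\<close>.\<close>
  then obtain p where p: "p \<in> N2" "p \<in> U" by blast
  have pRS: "p \<in> RS" using p U by blast
  obtain h k where hk: "homeomorphism (RS - {p}) (UNIV :: complex set) h k"
    using punctured_sphere_homeomorphism[OF pRS] by blast
  have kh: "k (h y) = y" if "y \<in> RS - {p}" for y using hk that by (simp add: homeomorphism_def)
  have hkz: "h (k z) = z" for z using hk by (simp add: homeomorphism_def)
  have kRS: "k z \<in> RS - {p}" for z using hk by (auto simp: homeomorphism_def)
  have ch: "continuous_on (RS - {p}) h" and ck: "continuous_on S k" for S
    using hk by (auto simp: homeomorphism_def elim: continuous_on_subset)
  have injh: "inj_on h (RS - {p})" using kh by (metis inj_onI)
  have JR: "J \<subseteq> RS - {p}" using Jf(3) U(1) p by blast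
  have DR: "D \<subseteq> RS - {p}" using DRS D(4) p by blast
  have ER: "E0 \<subseteq> RS - {p}"
  proof -
    have "p \<in> N0" using p(1) N2(4) closure_subset[of N2] by blast
    then show ?thesis using E0(3) N0(3) by blast
  qed
  have disj: "h ` B \<inter> h ` C = {}" if "B \<subseteq> RS - {p}" "C \<subseteq> RS - {p}" "B \<inter> C = {}" for B C
    using inj_on_image_Int[OF injh that(1,2)] that(3) by simp
  have joined: "\<exists>Y. connected Y \<and> Y \<subseteq> RS - (J \<union> T) \<and> q1 \<in> Y \<and> q2 \<in> Y" if q: "q1 \<in> D \<inter> E0" "q2 \<in> D \<inter> E0" for q1 q2
  proof -
    (* Neither J nor T separates q1 from q2, and J and T meet in the connected set \<alpha>. *)
    have "connected_component (- (h ` J \<union> h ` (T - {p}))) (h q1) (h q2)"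
    proof (rule Janiszewski)
      show "compact (h ` J)" by (intro compact_continuous_image continuous_on_subset[OF ch] JR Jf)
      have "closedin (top_of_set (RS - {p})) (T - {p})"
      proof -
        have "T - {p} = (RS - {p}) \<inter> T" using T(3) by blast
        then show ?thesis using T(1) closedin_closed_Int by metis
      qed
      then show "closed (h ` (T - {p}))" using homeomorphism_imp_closed_map[OF hk] by simp
      have "h ` J \<inter> h ` (T - {p}) = h ` (J \<inter> (T - {p}))"
        using JR T(3) by (intro inj_on_image_Int[OF injh, symmetric]) auto
      also have "J \<inter> (T - {p}) = \<alpha>" using T(4) JR by blast
      finally show "connected (h ` J \<inter> h ` (T - {p}))"
        using \<alpha>(1,3) JR by (auto intro!: connected_continuous_image continuous_on_subset[OF ch])
      show "connected_component (- h ` J) (h q1) (h q2)"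
      proof (rule connected_component_of_subset[of "h ` D"])
        show "h ` D \<subseteq> - h ` J" using disj[OF DR JR D(3)] by blast
        have "connected (h ` D)" by (intro connected_continuous_image continuous_on_subset[OF ch] DR D)
        then show "connected_component (h ` D) (h q1) (h q2)" using q by (auto simp: connected_component_def)
      qed
      show "connected_component (- h ` (T - {p})) (h q1) (h q2)"
      proof (rule connected_component_of_subset[of "h ` E0"])
        have "E0 \<inter> (T - {p}) = {}" using T(2) N0(3) by blast
        then have "h ` E0 \<inter> h ` (T - {p}) = {}" using ER T(3) by (intro disj) auto
        then show "h ` E0 \<subseteq> - h ` (T - {p})" by blast
        have "connected (h ` E0)" by (intro connected_continuous_image continuous_on_subset[OF ch] ER E0)
        then show "connected_component (h ` E0) (h q1) (h q2)" using q by (auto simp: connected_component_def)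
      qed
    qed
    then obtain Y where Y: "connected Y" "Y \<subseteq> - (h ` J \<union> h ` (T - {p}))" "h q1 \<in> Y" "h q2 \<in> Y"
      by (auto simp: connected_component_def)
    have "k z \<notin> J \<union> T" if "z \<in> Y" for z
    proof
      assume "k z \<in> J \<union> T"
      then have "h (k z) \<in> h ` J \<union> h ` (T - {p})" using kRS[of z] by blast
      then show False using Y(2) that hkz by auto
    qed
    then have "k ` Y \<subseteq> RS - (J \<union> T)" using kRS by blast
    moreover have "q1 \<in> k ` Y" "q2 \<in> k ` Y" using kh q DR Y(3,4) by (metis IntD1 imageI subsetD)+
    moreover have "connected (k ` Y)" by (intro connected_continuous_image ck Y)
    ultimately show ?thesis by blast
  qed
  have "J - N \<subseteq> closure (D \<inter> E0)"
  proof -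
    obtain S where S: "open S" "E0 = RS \<inter> S" using E0(1) by (auto simp: openin_open)
    have "J - N \<subseteq> S \<inter> closure D" using E0(4) S D(5) by blast
    also have "\<dots> \<subseteq> closure (S \<inter> D)" using S(1) by (rule open_Int_closure_subset)
    also have "S \<inter> D = D \<inter> E0" using S DRS by blast
    finally show ?thesis .
  qed
  define W where "W = RS - (J \<union> T)"
  have oW: "RS_open W"
  proof -
    have "W = RS \<inter> - (J \<union> T)" by (auto simp: W_def)
    moreover have "open (- (J \<union> T))" using T(1) compact_imp_closed[OF Jf(1)] by (intro open_Compl closed_Un)
    ultimately show ?thesis using openin_open_Int by metis
  qed
  show ?thesis
  proof (cases "D \<inter> E0 = {}")
    \<comment> \<open>Since J is in the closure of D and the open set E0 covers J - N, this case
      means that J - N is empty, and the empty set serves as G.\<close>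
    case True
    then have "J - N \<subseteq> closure {}" using \<open>J - N \<subseteq> closure (D \<inter> E0)\<close> by simp
    then show ?thesis using that[OF N'(1-3) N'N, of "{}"] by simp
  next
    case False
    then obtain q where q: "q \<in> D \<inter> E0" by blast
    define G where "G = connected_component_set W q"
    have oG: "RS_open G"
    proof (cases "q \<in> W")
      case True
      then show ?thesis using locally_connected_RS oW unfolding G_def locally_connected_open_connected_component by blast
    qed (simp add: G_def connected_component_eq_empty[THEN iffD2])
    have cG: "connected G" by (simp add: G_def)
    have GW: "G \<subseteq> W" unfolding G_def by (rule connected_component_subset)
    have sub: "D \<inter> E0 \<subseteq> G"
    proof
      fix q' assume "q' \<in> D \<inter> E0"
      then obtain Y where "connected Y" "Y \<subseteq> W" "q \<in> Y" "q' \<in> Y" using joined[OF q] unfolding W_def by blast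
      then show "q' \<in> G" unfolding G_def by (auto simp: connected_component_def)
    qed
    have GD: "G \<subseteq> D"
    proof -
      have "openin (top_of_set G) (G \<inter> D)"
      proof -
        obtain S where "open S" "D = RS \<inter> S" using D(1) by (auto simp: openin_open)
        moreover from this have "G \<inter> D = G \<inter> S" using GW by (auto simp: W_def)
        ultimately show ?thesis by (simp add: openin_open_Int)
      qed
      moreover have "G \<inter> D = G \<inter> closure D" using D(6) GW closure_subset[of D] by (auto simp: W_def)
      then have "closedin (top_of_set G) (G \<inter> D)" by (simp add: closedin_closed_Int)
      moreover have "G \<inter> D \<noteq> {}" using sub q by blast
      ultimately have "G \<inter> D = G" using cG unfolding connected_clopen by blast
      then show ?thesis by blast
    qed
    have "closure G \<subseteq> RS - N2"
    proof (rule closure_minimal)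
      show "G \<subseteq> RS - N2" using GW closure_subset[of N2] by (auto simp: W_def T_def)
      show "closed (RS - N2)" using compact_Diff_openin[OF compact_RS order_refl N2(1)] by (rule compact_imp_closed)
    qed
    then have "closure G \<inter> closure N' = {}" using N'(4) by blast
    moreover have "J - N \<subseteq> closure G"
      using \<open>J - N \<subseteq> closure (D \<inter> E0)\<close> closure_mono[OF sub] by blast
    ultimately show ?thesis using that[OF N'(1-3) N'N oG cG GD] by blast
  qed
qed

text \<open>Two scales of neighbourhoods are at work: Nx and My, whose closures miss those of the
  hubs G1 and G2, are the ones for K(3,3); the larger N1 and M1 swallow whatever part of J1 and J2
  the hubs do not reach.\<close>

lemma schoenflies_rel_imp_linked:
  assumes X: "compact X" "X \<subseteq> RS" and xy: "(x, y) \<in> schoenflies_rel X"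
  shows "linked X x y"
  unfolding linked_def
proof (intro allI impI, elim conjE)
  fix N M assume N: "RS_open N" "x \<in> N" and M: "RS_open M" "y \<in> M"
    and NMd: "closure N \<inter> closure M = {}"
  from xy obtain J1 J2 U Q and P :: "nat \<Rightarrow> pt set" where all: "simple_closed_curve J1 \<and> simple_closed_curve J2 \<and> J1 \<inter> J2 = {} \<and>
        x \<in> J1 \<and> y \<in> J2 \<and> is_U J1 J2 U \<and>
        inj P \<and> (\<forall>n. P n \<in> components (closure U \<inter> X) \<and> P n \<inter> J1 \<noteq> {} \<and> P n \<inter> J2 \<noteq> {}) \<and>
        hausdorff_lim P Q \<and> {x, y} \<subseteq> Q"
    unfolding schoenflies_rel_def mem_Collect_eq prod.case by (elim conjE exE) (rule that, intro conjI)
  then have J: "simple_closed_curve J1" "simple_closed_curve J2" "J1 \<inter> J2 = {}" "x \<in> J1" "y \<in> J2"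
    and isU: "is_U J1 J2 U" and P: "inj P" "\<And>n. P n \<in> components (closure U \<inter> X)" and lim: "hausdorff_lim P Q" "x \<in> Q" "y \<in> Q"
    by simp_all
  note J1f = simple_closed_curve_facts[OF J(1)] and J2f = simple_closed_curve_facts[OF J(2)]
  have Uc: "U \<in> components (RS - (J1 \<union> J2))" and Uf: "top_of_set RS frontier_of U = J1 \<union> J2"
    using isU by (auto simp: is_U_def)
  have U: "connected U" "U \<noteq> {}" "U \<subseteq> RS" "U \<inter> J1 = {}" "U \<inter> J2 = {}"
    using in_components_connected[OF Uc] in_components_nonempty[OF Uc] in_components_subset[OF Uc] by blast+
  have oU: "RS_open U"
  proof -
    have "RS_open (RS \<inter> - (J1 \<union> J2))"
      using J1f(1) J2f(1) by (intro openin_open_Int open_Compl closed_Un compact_imp_closed)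
    then have "RS_open (RS - (J1 \<union> J2))" by (simp only: Diff_eq)
    then show ?thesis using locally_connected_RS Uc unfolding locally_connected_open_component by blast
  qed
  have clRS: "closure U \<subseteq> RS" using U(3) compact_RS by (simp add: closure_minimal compact_imp_closed)
  have fr: "closure U - U = J1 \<union> J2"
    using Uf U(3) clRS oU by (simp add: frontier_of_def closure_of_subtopology Int_absorb1 interior_of_openin)
  have JU: "J1 \<subseteq> closure U" "J2 \<subseteq> closure U" and clU: "closure U \<subseteq> U \<union> (J1 \<union> J2)" using fr by blast+
  obtain D1 where D1: "RS_open D1" "connected D1" "D1 \<inter> J1 = {}" "D1 \<inter> U = {}" "J1 \<subseteq> closure D1" "closure D1 \<subseteq> D1 \<union> J1"
    using simple_closed_curve_other_side[OF J(1) U(1-4)] by blast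
  obtain D2 where D2: "RS_open D2" "connected D2" "D2 \<inter> J2 = {}" "D2 \<inter> U = {}" "J2 \<subseteq> closure D2" "closure D2 \<subseteq> D2 \<union> J2"
    using simple_closed_curve_other_side[OF J(2) U(1-3,5)] by blast
  have DclU: "D \<inter> closure U = {}" if "RS_open D" "D \<inter> U = {}" for D
  proof -
    have "closure U \<subseteq> RS - D"
      using that U(3) compact_Diff_openin[OF compact_RS order_refl that(1)] by (intro closure_minimal compact_imp_closed) auto
    then show ?thesis by blast
  qed
  note D1U = DclU[OF D1(1,4)] and D2U = DclU[OF D2(1,4)]
  have xD2: "x \<notin> closure D2" using D2(6) D2U JU(1) J(3,4) by blast
  have yD1: "y \<notin> closure D1" using D1(6) D1U JU(2) J(3,5) by blast
  \<comment> \<open>Staying off the far side of the other curve makes \<open>closure Nx\<close>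
    disjoint from \<open>closure G2\<close>, and \<open>closure My\<close> from
    \<open>closure G1\<close>, as K(3,3) demands. The point x is not lost: it is in
    \<open>closure U\<close>, which misses D2, and it is off J2.\<close>
  define N1 M1 where "N1 = N \<inter> - closure D2" and "M1 = M \<inter> - closure D1"
  have N1: "RS_open N1" "x \<in> N1" "N1 \<subseteq> N" and M1: "RS_open M1" "y \<in> M1" "M1 \<subseteq> M"
    using N M xD2 yD1 by (auto simp: N1_def M1_def intro: openin_Int_open)
  have NM1d: "closure N1 \<inter> closure M1 = {}" using NMd closure_mono[OF N1(3)] closure_mono[OF M1(3)] by blast
  obtain Nx G1 where Nx: "RS_open Nx" "connected Nx" "x \<in> Nx" "closure Nx \<subseteq> N1"
    and G1: "RS_open G1" "connected G1" "G1 \<subseteq> D1" "closure G1 \<inter> closure Nx = {}" "J1 - N1 \<subseteq> closure G1"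
    by (rule curve_hub[OF J(1) U(4) JU(1) U(3) D1 J(4) N1(1,2)])
  obtain My G2 where My: "RS_open My" "connected My" "y \<in> My" "closure My \<subseteq> M1"
    and G2: "RS_open G2" "connected G2" "G2 \<subseteq> D2" "closure G2 \<inter> closure My = {}" "J2 - M1 \<subseteq> closure G2"
    by (rule curve_hub[OF J(2) U(5) JU(2) U(3) D2 J(5) M1(1,2)])
  have NxMy: "closure Nx \<inter> closure My = {}" using Nx(4) My(4) NM1d closure_subset[of N1] closure_subset[of M1] by blast
  have MyG1: "closure My \<inter> closure G1 = {}" using My(4) closure_mono[OF G1(3)] by (auto simp: M1_def)
  have NxG2: "closure Nx \<inter> closure G2 = {}" using Nx(4) closure_mono[OF G2(3)] by (auto simp: N1_def)
  let ?X = "closure U \<inter> X"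
  have X': "compact ?X" "?X \<subseteq> RS" using X by (auto simp: closed_Int_compact)
  have PRS: "P n \<subseteq> RS" for n using in_components_subset[OF P(2)] X' by blast
  have near: "\<forall>\<^sub>F n in sequentially. P n \<inter> Z \<noteq> {}" if Z: "RS_open Z" and z: "z \<in> Z" "z \<in> Q" for Z z
  proof -
    obtain T where T: "open T" "Z = RS \<inter> T" using Z by (auto simp: openin_open)
    then obtain e where e: "e > 0" "ball z e \<subseteq> T" using z(1) open_contains_ball by blast
    have "\<forall>\<^sub>F n in sequentially. (\<forall>a\<in>P n. \<exists>b\<in>Q. dist a b < e) \<and> (\<forall>b\<in>Q. \<exists>a\<in>P n. dist a b < e)"
      using lim(1) e(1) unfolding hausdorff_lim_def by blast
    then show ?thesis
    proof (rule eventually_mono)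
      fix n assume "(\<forall>a\<in>P n. \<exists>b\<in>Q. dist a b < e) \<and> (\<forall>b\<in>Q. \<exists>a\<in>P n. dist a b < e)"
      then obtain a where "a \<in> P n" "dist a z < e" using z(2) by blast
      then have "a \<in> ball z e" "a \<in> RS" using subsetD[OF PRS[of n], of a] by (simp_all add: dist_commute)
      then have "a \<in> P n \<inter> Z" using \<open>a \<in> P n\<close> e(2) T(2) by blast
      then show "P n \<inter> Z \<noteq> {}" by blast
    qed
  qed
  have "\<forall>\<^sub>F n in sequentially. P n \<inter> Nx \<noteq> {} \<and> P n \<inter> My \<noteq> {}"
    by (intro eventually_conj near[OF Nx(1,3) lim(2)] near[OF My(1,3) lim(3)])
  then obtain n0 where n0: "\<And>n. n \<ge> n0 \<Longrightarrow> P n \<inter> Nx \<noteq> {}" "\<And>n. n \<ge> n0 \<Longrightarrow> P n \<inter> My \<noteq> {}"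
    unfolding eventually_sequentially by blast
  have "infinite (crossings ?X Nx My)"
  proof (rule infinite_refinement[of "P ` {n0..}"])
    show "infinite (P ` {n0..})" using P(1) infinite_Ici by (metis finite_imageD inj_on_subset top_greatest)
    show "pairwise disjnt (P ` {n0..})"
      using pairwise_disjoint_components[of ?X] P(2) unfolding pairwise_def disjnt_def by blast
    fix C assume "C \<in> P ` {n0..}"
    then obtain n where n: "n \<ge> n0" "C = P n" by auto
    have C: "C \<in> components ?X" "C \<inter> Nx \<noteq> {}" "C \<inter> My \<noteq> {}" using n P(2) n0 by auto
    have cC: "compact C" "connected C" "C \<subseteq> RS"
      using compact_components[OF X'(1) C(1)] in_components_connected[OF C(1)] in_components_subset[OF C(1)] X'(2) by auto
    obtain E where E: "E \<in> components (C - (Nx \<union> My))" "E \<inter> closure Nx \<noteq> {}" "E \<inter> closure My \<noteq> {}"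
    proof (rule continuum_crossing[OF cC(1,2) _ NxMy])
      have "compact (C - (Nx \<union> My))" using Nx My cC by (intro compact_Diff_openin[of C RS]) auto
      then show "closed (C - (Nx \<union> My))" by (rule compact_imp_closed)
      show "C \<inter> closure Nx \<noteq> {}" "C \<inter> closure My \<noteq> {}" using C(2,3) closure_subset[of Nx] closure_subset[of My] by blast+
    qed
    have "C \<in> components (?X - {})" using C(1) by simp
    then have "E \<in> components (?X - (Nx \<union> My))" using components_Diff_trans[OF _ E(1)] by blast
    then have "E \<in> crossings ?X Nx My" using E by (simp add: crossings_def)
    moreover have "E \<subseteq> C" "E \<noteq> {}" using in_components_subset[OF E(1)] in_components_nonempty[OF E(1)] by blast+
    ultimately show "\<exists>D\<in>crossings ?X Nx My. D \<subseteq> C \<and> D \<noteq> {}" by blast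
  qed
  moreover have few: "finite {E \<in> crossings ?X Nx My. E \<inter> closure G \<noteq> {}}"
    if G: "RS_open G" "connected G" "closure Nx \<inter> closure G = {}" "closure My \<inter> closure G = {}" "G \<inter> closure U = {}" for G
  proof (rule finite_continua_touching_three[OF Nx(1,2) My(1,2) G(1,2) NxMy G(3,4)])
    show "pairwise disjnt {E \<in> crossings ?X Nx My. E \<inter> closure G \<noteq> {}}"
      by (rule pairwise_subset[OF pairwise_disjnt_crossings[of ?X Nx My]]) blast
    fix E assume "E \<in> {E \<in> crossings ?X Nx My. E \<inter> closure G \<noteq> {}}"
    then have E: "E \<in> components (?X - (Nx \<union> My))" "E \<inter> closure Nx \<noteq> {}" "E \<inter> closure My \<noteq> {}" "E \<inter> closure G \<noteq> {}"
      by (auto simp: crossings_def)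
    have "compact (?X - (Nx \<union> My))" using X' Nx My by (intro compact_Diff_openin) auto
    then show "compact E" using compact_components E(1) by blast
    show "connected E" using in_components_connected E(1) by blast
    have sub: "E \<subseteq> ?X - (Nx \<union> My)" using in_components_subset[OF E(1)] .
    then show "E \<subseteq> RS" "E \<inter> (Nx \<union> My \<union> G) = {}" using X'(2) G(5) by blast+
    show "E \<inter> closure Nx \<noteq> {}" "E \<inter> closure My \<noteq> {}" "E \<inter> closure G \<noteq> {}" by fact+
  qed
  (* Components missing closure G1 and closure G2 can meet J1 and J2 only inside N1 and M1, so that
     after removing N1 and M1 the rest of X outside U cannot connect them. *)
  have "finite {E \<in> crossings ?X Nx My. E \<inter> closure G1 \<noteq> {}}"
    using G1 MyG1 D1U by (intro few) auto
  moreover have "finite {E \<in> crossings ?X Nx My. E \<inter> closure G2 \<noteq> {}}"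
    using G2 NxG2 D2U by (intro few) auto
  ultimately have "infinite (crossings ?X Nx My - ({E \<in> crossings ?X Nx My. E \<inter> closure G1 \<noteq> {}} \<union> {E \<in> crossings ?X Nx My. E \<inter> closure G2 \<noteq> {}}))"
    (is "infinite ?\<E>") by (intro Diff_infinite_finite finite_UnI)
  then have "infinite (crossings X N1 M1)"
  proof (rule infinite_refinement)
    show "pairwise disjnt ?\<E>"
      by (rule pairwise_subset[OF pairwise_disjnt_crossings[of ?X Nx My]]) blast
    fix E assume "E \<in> ?\<E>"
    then have E: "E \<in> components (?X - (Nx \<union> My))" "E \<inter> closure Nx \<noteq> {}" "E \<inter> closure My \<noteq> {}"
        "E \<inter> closure G1 = {}" "E \<inter> closure G2 = {}"
      by (auto simp: crossings_def)
    have "compact (?X - (Nx \<union> My))" using X' Nx My by (intro compact_Diff_openin) auto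
    then have cE: "compact E" "connected E" using compact_components in_components_connected E(1) by blast+
    have ERS: "E \<subseteq> RS" using in_components_subset[OF E(1)] X'(2) by blast
    obtain H where H: "H \<in> components (E - (N1 \<union> M1))" "H \<inter> closure N1 \<noteq> {}" "H \<inter> closure M1 \<noteq> {}"
    proof (rule continuum_crossing[OF cE _ NM1d])
      have "compact (E - (N1 \<union> M1))" using N1 M1 cE ERS by (intro compact_Diff_openin[of E RS]) auto
      then show "closed (E - (N1 \<union> M1))" by (rule compact_imp_closed)
      show "E \<inter> closure N1 \<noteq> {}" "E \<inter> closure M1 \<noteq> {}"
        using E(2,3) Nx(4) My(4) closure_subset[of N1] closure_subset[of M1] by blast+
    qed
    have HE: "H \<subseteq> E - (N1 \<union> M1)" "H \<noteq> {}" using in_components_subset[OF H(1)] in_components_nonempty[OF H(1)] by blast+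
    have "Nx \<subseteq> N1" "My \<subseteq> M1" using Nx(4) My(4) closure_subset[of Nx] closure_subset[of My] by blast+
    then have HX: "H \<in> components (?X - (N1 \<union> M1))" using components_Diff_trans[OF E(1) H(1)] by blast
    have "H \<inter> (J1 \<union> J2) = {}" using HE G1(5) G2(5) E(4,5) by blast
    moreover have "H \<subseteq> closure U" using in_components_subset[OF HX] by blast
    ultimately have HU: "H \<subseteq> U" using clU by blast
    \<comment> \<open>Restricting X to \<open>closure U\<close> is rewritten as removing
      \<open>RS - closure U\<close>, so that \<open>components_Diff_forget\<close> can give these
      points back: they belong to the closed set \<open>RS - U\<close>, which H misses.\<close>
    have eq: "X - (N1 \<union> M1 \<union> (RS - closure U)) = ?X - (N1 \<union> M1)" using X(2) by blast
    have "H \<in> components (X - (N1 \<union> M1))"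
    proof (rule components_Diff_forget[where W = "RS - U"])
      show "compact (X - (N1 \<union> M1 \<union> (RS - closure U)))"
        unfolding eq using X' N1 M1 by (intro compact_Diff_openin) auto
      show "H \<in> components (X - (N1 \<union> M1 \<union> (RS - closure U)))" unfolding eq by (rule HX)
      show "N1 \<union> M1 \<union> (RS - closure U) \<subseteq> N1 \<union> M1 \<union> (RS - U)" using closure_subset[of U] by blast
      show "closed (RS - U)" using compact_Diff_openin[OF compact_RS order_refl oU] by (rule compact_imp_closed)
      show "H \<inter> (RS - U) = {}" using HU by blast
    qed blast
    then have "H \<in> crossings X N1 M1" using H by (simp add: crossings_def)
    then show "\<exists>D\<in>crossings X N1 M1. D \<subseteq> E \<and> D \<noteq> {}" using HE by blast
  qed
  then show "infinite (crossings X N M)"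
    using infinite_crossings_mono[OF X N1(1) M1(1) N(1) M(1) N1(3) M1(3) NMd] by blast
qed

section \<open>Finite-to-one open maps\<close>

lemma clopen_image_subset:
  assumes "connected N" "openin (top_of_set N) A" "closedin (top_of_set N) A" "A \<noteq> {}"
  shows "A = N"
  using assms unfolding connected_clopen by blast

text \<open>These four properties are all that the argument takes from a rational map.\<close>

locale finite_open_map =
  fixes f :: "pt \<Rightarrow> pt"
  assumes cont: "continuous_on RS f"
    and maps: "\<And>v. v \<in> RS \<Longrightarrow> f v \<in> RS"
    and opn: "\<And>V. RS_open V \<Longrightarrow> RS_open (f ` V)"
    and fib: "\<And>y. finite {v \<in> RS. f v = y}"
begin

definition pre :: "pt set \<Rightarrow> pt set" where "pre A = {v \<in> RS. f v \<in> A}"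

lemma pre_subset: "pre A \<subseteq> RS" by (auto simp: pre_def)

lemma openin_pre:
  assumes "RS_open N"
  shows "RS_open (pre N)"
proof -
  obtain T where T: "open T" "N = RS \<inter> T" using assms by (auto simp: openin_open)
  have "pre N = RS \<inter> f -` T" using maps T by (auto simp: pre_def)
  then show ?thesis using continuous_openin_preimage_gen[OF cont T(1)] by simp
qed

lemma compact_pre:
  assumes "compact A"
  shows "compact (pre A)"
proof -
  have "pre A = RS \<inter> f -` A" by (auto simp: pre_def)
  moreover have "closed (RS \<inter> f -` A)"
    using assms compact_RS cont by (intro continuous_closed_preimage) (auto simp: compact_imp_closed)
  ultimately show ?thesis using compact_RS by (metis compact_Int_closed inf.absorb2 pre_subset)
qed

lemma closure_pre: "closure (pre N) \<subseteq> pre (closure N)"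
proof
  fix v assume v: "v \<in> closure (pre N)"
  have "closure (pre N) \<subseteq> RS" using pre_subset compact_RS by (simp add: closure_minimal compact_imp_closed)
  then have "v \<in> RS" using v by blast
  then have "f v \<in> closure (f ` pre N)" using v by (intro continuous_on_image_closure[OF cont pre_subset])
  moreover have "f ` pre N \<subseteq> N" by (auto simp: pre_def)
  ultimately have "f v \<in> closure N" using closure_mono by blast
  then show "v \<in> pre (closure N)" using \<open>v \<in> RS\<close> by (simp add: pre_def)
qed

text \<open>This inclusion rests on openness: points of N close to f v have preimages close to
  v.\<close>

lemma pre_closure:
  assumes "N \<subseteq> RS"
  shows "pre (closure N) \<subseteq> closure (pre N)"
proof
  fix v assume "v \<in> pre (closure N)"
  then have v: "v \<in> RS" "f v \<in> closure N" by (auto simp: pre_def)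
  show "v \<in> closure (pre N)"
    unfolding closure_approachable
  proof (intro allI impI)
    fix e :: real assume "e > 0"
    have "RS_open (f ` (RS \<inter> ball v e))" by (intro opn openin_open_Int) simp
    then obtain T where T: "open T" "f ` (RS \<inter> ball v e) = RS \<inter> T" by (auto simp: openin_open)
    have "f v \<in> T" using T(2) v(1) \<open>e > 0\<close> by auto
    then obtain y where y: "y \<in> N" "y \<in> T" using v(2) T(1) by (metis disjoint_iff open_Int_closure_eq_empty)
    then have "y \<in> f ` (RS \<inter> ball v e)" using T(2) assms by blast
    then obtain v' where "v' \<in> RS" "dist v v' < e" "f v' = y" by auto
    then show "\<exists>y\<in>pre N. dist y v < e" using y(1) by (intro bexI[of _ v']) (auto simp: pre_def dist_commute)
  qed
qed

text \<open>If D missed the fibre over some c, a clopen neighbourhood V of D in \<open>pre C\<close>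
  would miss it too, as the fibre is closed. The image of V is open in C because f is open, and it
  is compact; hence it is all of the connected set C and contains c after all.\<close>

lemma image_component_pre_continuum:
  assumes C: "compact C" "connected C" "C \<subseteq> RS" and D: "D \<in> components (pre C)"
  shows "f ` D = C"
proof (rule ccontr)
  have fDC: "f ` D \<subseteq> C" using in_components_subset[OF D] by (auto simp: pre_def)
  assume "f ` D \<noteq> C"
  then obtain c where c: "c \<in> C" "c \<notin> f ` D" using fDC by blast
  have cP: "compact (pre C)" using compact_pre C by blast
  have "open (- {v \<in> RS. f v = c})" using fib finite_imp_closed by blast
  moreover have "D \<subseteq> - {v \<in> RS. f v = c}" using c by blast
  ultimately obtain V where V: "openin (top_of_set (pre C)) V" "compact V" "D \<subseteq> V" "V \<subseteq> - {v \<in> RS. f v = c}"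
    using Sura_Bura_clopen_subset[OF closed_imp_locally_compact[OF compact_imp_closed[OF cP]] D compact_components[OF cP D]] by blast
  obtain T where T: "open T" "V = pre C \<inter> T" using V(1) by (auto simp: openin_open)
  have VRS: "V \<subseteq> RS" using T pre_subset by blast
  have "f ` V = C \<inter> f ` (RS \<inter> T)" unfolding T by (auto simp: pre_def)
  moreover have "RS_open (f ` (RS \<inter> T))" using T by (intro opn openin_open_Int)
  then obtain S where "open S" "f ` (RS \<inter> T) = RS \<inter> S" by (auto simp: openin_open)
  ultimately have fV: "f ` V = C \<inter> (RS \<inter> S)" by simp
  moreover have "C \<inter> (RS \<inter> S) = C \<inter> S" using C(3) by blast
  ultimately have "f ` V = C \<inter> S" by simp
  then have "openin (top_of_set C) (f ` V)" using \<open>open S\<close> by (simp add: openin_open_Int)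
  moreover have "closedin (top_of_set C) (f ` V)"
  proof -
    have "compact (f ` V)" by (intro compact_continuous_image continuous_on_subset[OF cont] VRS V)
    then show ?thesis using \<open>f ` V = C \<inter> S\<close> by (intro closed_subset compact_imp_closed) auto
  qed
  moreover have "f ` V \<noteq> {}" using V(3) in_components_nonempty[OF D] by blast
  ultimately have "f ` V = C" using C(2) clopen_image_subset by blast
  then show False using c(1) V(4) VRS by blast
qed

lemma image_component_pre:
  assumes E: "compact E" "E \<subseteq> RS" and D: "D \<in> components (pre E)"
  shows "f ` D \<in> components E"
proof -
  have Dsub: "D \<subseteq> pre E" "connected D" "D \<noteq> {}"
    using D in_components_subset in_components_connected in_components_nonempty by blast+
  have "D \<subseteq> RS" using Dsub pre_subset by blast
  then have "connected (f ` D)" using Dsub by (intro connected_continuous_image continuous_on_subset[OF cont])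
  moreover have "f ` D \<subseteq> E" using Dsub by (auto simp: pre_def)
  ultimately obtain C where C: "C \<in> components E" "f ` D \<subseteq> C"
    using exists_component_superset[of "f ` D" E] Dsub by blast
  have "D \<subseteq> pre C" using C(2) \<open>D \<subseteq> RS\<close> by (auto simp: pre_def)
  moreover have "pre C \<subseteq> pre E" using in_components_subset[OF C(1)] by (auto simp: pre_def)
  ultimately have "D \<in> components (pre C)" using D components_intermediate_subset by blast
  then have "f ` D = C"
    using compact_components[OF E(1) C(1)] in_components_connected[OF C(1)] in_components_subset[OF C(1)] E(2)
    by (intro image_component_pre_continuum) auto
  then show ?thesis using C by simp
qed

lemma component_pre_component:
  assumes C: "C \<in> components E" and D: "D \<in> components (pre C)"
  shows "D \<in> components (pre E)"
  unfolding in_components_maximal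
proof (intro conjI allI impI)
  have Dsub: "D \<subseteq> pre C" "connected D" "D \<noteq> {}"
    using D in_components_subset in_components_connected in_components_nonempty by blast+
  show "D \<noteq> {}" "connected D" by fact+
  show "D \<subseteq> pre E" using Dsub in_components_subset[OF C] by (auto simp: pre_def)
  fix D' assume D': "D' \<noteq> {} \<and> D \<subseteq> D' \<and> D' \<subseteq> pre E \<and> connected D'"
  have "D' \<subseteq> RS" using D' pre_subset by blast
  have "f ` D' \<subseteq> C"
  proof (rule components_maximal[OF C])
    show "connected (f ` D')" using D' \<open>D' \<subseteq> RS\<close> by (intro connected_continuous_image continuous_on_subset[OF cont]) auto
    show "f ` D' \<subseteq> E" using D' by (auto simp: pre_def)
    obtain v where "v \<in> D" using Dsub by blast
    then have "f v \<in> C" "v \<in> D'" using Dsub D' by (auto simp: pre_def)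
    then show "C \<inter> f ` D' \<noteq> {}" by blast
  qed
  then have "D' \<subseteq> pre C" using \<open>D' \<subseteq> RS\<close> by (auto simp: pre_def)
  then have "D' \<subseteq> D" using D' Dsub by (intro components_maximal[OF D]) auto
  then show "D' = D" using D' by blast
qed

text \<open>The image of Y is open, and it is relatively closed in N because a limit point of Y over
  N lies in \<open>pre N\<close>, where the component Y is closed.\<close>

lemma component_pre_openin:
  assumes N: "RS_open N" "connected N" and Y: "Y \<in> components (pre N)"
  shows "RS_open Y" "f ` Y = N"
proof -
  have oN: "RS_open (pre N)" using openin_pre N by blast
  show oY: "RS_open Y"
    using locally_connected_RS oN Y unfolding locally_connected_open_component by blast
  have YN: "Y \<subseteq> pre N" using Y in_components_subset by blast
  have fY: "f ` Y \<subseteq> N" using YN by (auto simp: pre_def)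
  have YRS: "Y \<subseteq> RS" using YN pre_subset by blast
  have clRS: "closure Y \<subseteq> RS" using YRS compact_RS by (simp add: closure_minimal compact_imp_closed)
  have NRS: "N \<subseteq> RS" using N openin_imp_subset by blast
  have "RS_open (f ` Y)" using opn oY by blast
  then have "openin (top_of_set N) (f ` Y)" using fY NRS by (rule openin_subset_trans)
  moreover have "closedin (top_of_set N) (f ` Y)"
  proof -
    have "compact (closure Y)" using YRS compact_RS by (meson bounded_subset compact_closure compact_imp_bounded)
    then have "compact (f ` closure Y)" using clRS by (intro compact_continuous_image continuous_on_subset[OF cont])
    then have "closed (f ` closure Y)" by (rule compact_imp_closed)
    moreover have "f ` Y = N \<inter> f ` closure Y"
    proof
      show "f ` Y \<subseteq> N \<inter> f ` closure Y" using fY closure_subset by blast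
      show "N \<inter> f ` closure Y \<subseteq> f ` Y"
      proof
        fix p assume "p \<in> N \<inter> f ` closure Y"
        then obtain q where q: "f q \<in> N" "q \<in> closure Y" "p = f q" by blast
        then have "q \<in> pre N" using clRS by (auto simp: pre_def)
        moreover obtain T where "closed T" "Y = pre N \<inter> T"
          using closedin_component[OF Y] by (auto simp: closedin_closed)
        moreover from this have "closure Y \<subseteq> T" by (simp add: closure_minimal)
        ultimately have "q \<in> Y" using q by blast
        then show "p \<in> f ` Y" using q by blast
      qed
    qed
    ultimately show ?thesis by (auto simp: closedin_closed)
  qed
  moreover have "f ` Y \<noteq> {}" using in_components_nonempty[OF Y] by blast
  ultimately show "f ` Y = N" using clopen_image_subset[OF N(2)] by blast
qed

text \<open>With pulled-back neighbourhoods, \<open>image_component_pre\<close> sends crossings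
  upstairs to crossings below. Infinitude survives because crossings upstairs are disjoint, and all
  those over one crossing meet the finite fibre over any one of its points.\<close>

lemma linked_image:
  assumes K: "compact K" "K \<subseteq> RS" and uw: "u \<in> RS" "w \<in> RS" and l: "linked (pre K) u w"
  shows "linked K (f u) (f w)"
  unfolding linked_def
proof (intro allI impI, elim conjE)
  fix N M assume N: "RS_open N" "f u \<in> N" and M: "RS_open M" "f w \<in> M"
    and d: "closure N \<inter> closure M = {}"
  have "closure (pre N) \<inter> closure (pre M) = {}"
    using closure_pre[of N] closure_pre[of M] d by (auto simp: pre_def)
  then have inf: "infinite (crossings (pre K) (pre N) (pre M))"
    using l uw N M openin_pre unfolding linked_def by (auto simp: pre_def)
  define E where "E = K - (N \<union> M)"
  have E: "compact E" "E \<subseteq> RS" "pre E = pre K - (pre N \<union> pre M)"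
    using compact_Diff_openin[OF K, of "N \<union> M"] N M K by (auto simp: E_def pre_def)
  have im: "f ` D \<in> crossings K N M" if "D \<in> crossings (pre K) (pre N) (pre M)" for D
  proof -
    have D: "D \<in> components (pre E)" "D \<inter> closure (pre N) \<noteq> {}" "D \<inter> closure (pre M) \<noteq> {}"
      using that E(3) by (auto simp: crossings_def)
    have "f ` D \<inter> closure A \<noteq> {}" if "D \<inter> closure (pre A) \<noteq> {}" for A
      using that closure_pre[of A] by (auto simp: pre_def)
    then show ?thesis using image_component_pre[OF E(1,2) D(1)] D(2,3) by (simp add: crossings_def E_def)
  qed
  show "infinite (crossings K N M)"
  proof
    assume fin: "finite (crossings K N M)"
    \<comment> \<open>One point is chosen in each crossing below, and \<Phi> collects the fibres
      over these points. Each of the disjoint crossings upstairs meets \<Phi>, so it cannot be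
      finite.\<close>
    define \<Phi> where "\<Phi> = (\<Union>C\<in>crossings K N M. {v \<in> RS. f v = (SOME c. c \<in> C)})"
    have "finite ((\<lambda>v. {v}) ` \<Phi>)" using fin fib by (simp add: \<Phi>_def)
    moreover have "infinite ((\<lambda>v. {v}) ` \<Phi>)"
    proof (rule infinite_refinement[OF inf pairwise_disjnt_crossings])
      fix D assume D: "D \<in> crossings (pre K) (pre N) (pre M)"
      then have "D \<subseteq> RS" "D \<noteq> {}" using in_components_subset in_components_nonempty pre_subset unfolding crossings_def by blast+
      then have "(SOME c. c \<in> f ` D) \<in> f ` D" by (meson ex_in_conv image_is_empty someI_ex)
      then obtain v where "v \<in> D" "f v = (SOME c. c \<in> f ` D)" by (metis imageE)
      moreover have "v \<in> \<Phi>" unfolding \<Phi>_def using im[OF D] calculation \<open>D \<subseteq> RS\<close> by blast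
      ultimately show "\<exists>E\<in>(\<lambda>v. {v}) ` \<Phi>. E \<subseteq> D \<and> E \<noteq> {}" by blast
    qed
    ultimately show False by blast
  qed
qed

text \<open>On the compact sphere f is a closed map: the image of RS - V is compact and misses
  x.\<close>

lemma small_preimage_nbhd:
  assumes V: "RS_open V" "{v \<in> RS. f v = x} \<subseteq> V" and O: "RS_open P" "x \<in> P"
  obtains N where "RS_open N" "connected N" "x \<in> N" "closure N \<subseteq> P" "pre N \<subseteq> V"
proof -
  have "compact (RS - V)" using compact_RS V(1) by (intro compact_Diff_openin) auto
  then have "compact (f ` (RS - V))" by (intro compact_continuous_image continuous_on_subset[OF cont]) auto
  then have "RS_open (P \<inter> - f ` (RS - V))" using O by (intro openin_Int_open) (auto simp: compact_imp_closed)
  moreover have "x \<in> P \<inter> - f ` (RS - V)" using O V(2) by auto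
  ultimately obtain N where N: "RS_open N" "connected N" "x \<in> N" "closure N \<subseteq> P \<inter> - f ` (RS - V)"
    using connected_openin_nbhd by blast
  have "pre N \<subseteq> V" using N(4) closure_subset[of N] by (auto simp: pre_def)
  then show ?thesis using that N by blast
qed

text \<open>If u were linked to no point over y, each such w would come with sets \<open>A w\<close>
  and \<open>B w\<close> on which the failure persists. N and M are taken so small that every
  component of their preimages contains exactly one point over x or y. A crossing below can be
  lifted so that it starts at the component G u; it then ends at some G w. A single w serves
  infinitely many lifts, against the choice of \<open>A w\<close> and \<open>B w\<close>.\<close>

lemma linked_lift:
  assumes K: "compact K" "K \<subseteq> RS" and u: "u \<in> RS" "f u = x" and y: "y \<in> RS" "x \<noteq> y" and l: "linked K x y"
  obtains w where "w \<in> RS" "f w = y" "linked (pre K) u w"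
proof -
  define Fx Fy where "Fx = {v \<in> RS. f v = x}" and "Fy = {v \<in> RS. f v = y}"
  define F where "F = Fx \<union> Fy"
  have fin: "finite Fx" "finite Fy" "finite F" using fib by (simp_all add: Fx_def Fy_def F_def)
  have FRS: "F \<subseteq> RS" by (auto simp: F_def Fx_def Fy_def)
  have Fd: "Fx \<inter> Fy = {}" using y by (auto simp: Fx_def Fy_def)
  have uF: "u \<in> Fx" using u by (simp add: Fx_def)
  let ?L = "pre K"
  have L: "compact ?L" "?L \<subseteq> RS" using compact_pre K pre_subset by blast+
  have "\<exists>w\<in>Fy. linked ?L u w"
  proof (rule ccontr)
    assume neg: "\<not> ?thesis"
    have "\<exists>A B. RS_open A \<and> RS_open B \<and> u \<in> A \<and> w \<in> B \<and>
       (\<forall>N' M'. RS_open N' \<and> RS_open M' \<and> N' \<subseteq> A \<and> M' \<subseteq> B \<longrightarrow> finite (crossings ?L N' M'))"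
      if w: "w \<in> Fy" for w
    proof -
      have "\<not> linked ?L u w" using neg w by blast
      then show ?thesis
      proof (rule not_linked_nbhds[OF L], goal_cases)
        case (1 A B)
        then show ?case by (intro exI[of _ A] exI[of _ B]) simp
      qed
    qed
    then have "\<forall>w\<in>Fy. \<exists>A B. RS_open A \<and> RS_open B \<and> u \<in> A \<and> w \<in> B \<and>
       (\<forall>N' M'. RS_open N' \<and> RS_open M' \<and> N' \<subseteq> A \<and> M' \<subseteq> B \<longrightarrow> finite (crossings ?L N' M'))"
      by blast
    from bchoice[OF this] obtain A where "\<forall>w\<in>Fy. \<exists>B. RS_open (A w) \<and> RS_open B \<and> u \<in> A w \<and> w \<in> B \<and>
       (\<forall>N' M'. RS_open N' \<and> RS_open M' \<and> N' \<subseteq> A w \<and> M' \<subseteq> B \<longrightarrow> finite (crossings ?L N' M'))"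
      by (rule exE)
    from bchoice[OF this] obtain B where AB: "\<forall>w\<in>Fy. RS_open (A w) \<and> RS_open (B w) \<and> u \<in> A w \<and> w \<in> B w \<and>
       (\<forall>N' M'. RS_open N' \<and> RS_open M' \<and> N' \<subseteq> A w \<and> M' \<subseteq> B w \<longrightarrow> finite (crossings ?L N' M'))"
      by (rule exE)
    have small: "\<forall>\<^sub>F r in at_right 0. RS \<inter> ball v r \<subseteq> Z" if "RS_open Z" "v \<in> Z" for v Z
    proof -
      obtain T where T: "open T" "Z = RS \<inter> T" using \<open>RS_open Z\<close> by (auto simp: openin_open)
      then obtain e where e: "e > 0" "ball v e \<subseteq> T" using \<open>v \<in> Z\<close> open_contains_ball by blast
      show ?thesis
        unfolding eventually_at_right_field
        using e T by (intro exI[of _ e]) (auto simp: subset_iff)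
    qed
    \<comment> \<open>One radius meets all demands: the balls about u and each w fit into
      \<open>A w\<close> and \<open>B w\<close>, and closed balls about different points over x or y
      are disjoint.\<close>
    have "\<forall>\<^sub>F r in at_right 0. (\<forall>w\<in>Fy. RS \<inter> ball u r \<subseteq> A w) \<and> (\<forall>w\<in>Fy. RS \<inter> ball w r \<subseteq> B w) \<and>
        (\<forall>v\<in>F. \<forall>v'\<in>F. v \<noteq> v' \<longrightarrow> 2 * r < dist v v') \<and> 0 < r"
    proof (intro eventually_conj)
      show "\<forall>\<^sub>F r in at_right 0. \<forall>w\<in>Fy. RS \<inter> ball u r \<subseteq> A w" "\<forall>\<^sub>F r in at_right 0. \<forall>w\<in>Fy. RS \<inter> ball w r \<subseteq> B w"
        using AB fin by (auto intro!: eventually_ball_finite small)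
      show "\<forall>\<^sub>F r in at_right 0. \<forall>v\<in>F. \<forall>v'\<in>F. v \<noteq> v' \<longrightarrow> 2 * r < dist v v'"
      proof (intro eventually_ball_finite fin ballI)
        fix v v' :: pt
        show "\<forall>\<^sub>F r in at_right 0. v \<noteq> v' \<longrightarrow> 2 * r < dist v v'"
        proof (cases "v = v'")
          case False
          then show ?thesis unfolding eventually_at_right_field by (intro exI[of _ "dist v v' / 2"]) auto
        qed simp
      qed
      show "\<forall>\<^sub>F r in at_right 0. (0::real) < r" by (simp add: eventually_at_right_less)
    qed
    then obtain r where r: "\<And>w. w \<in> Fy \<Longrightarrow> RS \<inter> ball u r \<subseteq> A w" "\<And>w. w \<in> Fy \<Longrightarrow> RS \<inter> ball w r \<subseteq> B w"
        "\<And>v v'. v \<in> F \<Longrightarrow> v' \<in> F \<Longrightarrow> v \<noteq> v' \<Longrightarrow> 2 * r < dist v v'" "0 < r"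
      using eventually_happens'[OF trivial_limit_at_right_real] by blast
    have ballsd: "cball v r \<inter> cball v' r = {}" if "v \<in> F" "v' \<in> F" "v \<noteq> v'" for v v'
      using r(3)[OF that] by (intro disjoint_cballI) simp
    obtain P1 P2 where P: "RS_open P1" "RS_open P2" "x \<in> P1" "y \<in> P2" "P1 \<inter> P2 = {}"
    proof -
      obtain U V where "open U" "open V" "x \<in> U" "y \<in> V" "U \<inter> V = {}" using hausdorff[OF y(2)] by blast
      moreover have "x \<in> RS" using maps u by blast
      ultimately show ?thesis using that[of "RS \<inter> U" "RS \<inter> V"] y(1) by (auto simp: openin_open_Int)
    qed
    have oV: "RS_open (\<Union>v\<in>S. RS \<inter> ball v r)" for S by (intro openin_Union) (auto simp: openin_open_Int)
    have Vx: "{v \<in> RS. f v = x} \<subseteq> (\<Union>v\<in>Fx. RS \<inter> ball v r)" and Vy: "{v \<in> RS. f v = y} \<subseteq> (\<Union>v\<in>Fy. RS \<inter> ball v r)"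
      using r(4) by (auto simp: Fx_def Fy_def)
    obtain N where N: "RS_open N" "connected N" "x \<in> N" "closure N \<subseteq> P1" "pre N \<subseteq> (\<Union>v\<in>Fx. RS \<inter> ball v r)"
      by (rule small_preimage_nbhd[OF oV Vx P(1,3)])
    obtain M where M: "RS_open M" "connected M" "y \<in> M" "closure M \<subseteq> P2" "pre M \<subseteq> (\<Union>v\<in>Fy. RS \<inter> ball v r)"
      by (rule small_preimage_nbhd[OF oV Vy P(2,4)])
    have NMd: "closure N \<inter> closure M = {}" using N(4) M(4) P(5) by blast
    have NRS: "N \<subseteq> RS" "M \<subseteq> RS" using N M openin_imp_subset by blast+
    define G where "G = (\<lambda>v. connected_component_set (if v \<in> Fx then pre N else pre M) v)"
    have base: "v \<in> (if v \<in> Fx then pre N else pre M)" if "v \<in> F" for v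
      using that N(3) M(3) by (auto simp: F_def Fx_def Fy_def pre_def)
    have Gv: "v \<in> G v" and Gc: "connected (G v)" if "v \<in> F" for v
      using base[OF that] by (auto simp: G_def)
    have Gcomp: "G v \<in> components (if v \<in> Fx then pre N else pre M)" if "v \<in> F" for v
      unfolding G_def using base[OF that] by (rule componentsI)
    have GN: "RS_open (G v)" "f ` G v = N" "G v \<subseteq> pre N" if "v \<in> Fx" for v
    proof -
      have "G v \<in> components (pre N)" using Gcomp[of v] that by (simp add: F_def)
      then show "RS_open (G v)" "f ` G v = N" "G v \<subseteq> pre N"
        by (rule component_pre_openin[OF N(1,2)] in_components_subset)+
    qed
    have GM: "RS_open (G v)" "f ` G v = M" "G v \<subseteq> pre M" if "v \<in> Fy" for v
    proof -
      have "v \<notin> Fx" using that Fd by blast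
      then have "G v \<in> components (pre M)" using Gcomp[of v] that by (simp add: F_def)
      then show "RS_open (G v)" "f ` G v = M" "G v \<subseteq> pre M"
        by (rule component_pre_openin[OF M(1,2)] in_components_subset)+
    qed
    have Go: "RS_open (G v)" if "v \<in> F" for v using that GN(1) GM(1) unfolding F_def by blast
    have Gball: "G v \<subseteq> RS \<inter> ball v r" if v: "v \<in> F" for v
    proof -
      have "G v \<subseteq> (\<Union>v'\<in>F. RS \<inter> ball v' r)"
      proof (cases "v \<in> Fx")
        case True
        then show ?thesis using GN(3)[OF True] N(5) unfolding F_def by blast
      next
        case False
        then have "v \<in> Fy" using v by (simp add: F_def)
        then show ?thesis using GM(3)[OF \<open>v \<in> Fy\<close>] M(5) unfolding F_def by blast
      qed
      then have "G v \<subseteq> ball v r \<union> (\<Union>v'\<in>F - {v}. ball v' r)" "G v \<subseteq> RS" by auto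
      moreover have "ball v r \<inter> (\<Union>v'\<in>F - {v}. ball v' r) = {}"
      proof -
        have "ball v r \<inter> ball v' r = {}" if "v' \<in> F - {v}" for v'
          using ballsd[of v v'] v that ball_subset_cball[of v r] ball_subset_cball[of v' r] by blast
        then show ?thesis by blast
      qed
      moreover have "G v \<inter> ball v r \<noteq> {}" using Gv[OF v] r(4) by auto
      ultimately show ?thesis
        using connectedD[OF Gc[OF v], of "ball v r" "\<Union>v'\<in>F - {v}. ball v' r"] by (simp add: open_UN) blast
    qed
    have Gcl: "closure (G v) \<subseteq> cball v r" if "v \<in> F" for v
      using Gball[OF that] ball_subset_cball[of v r] by (intro closure_minimal) auto
    have Gd: "closure (G v) \<inter> closure (G v') = {}" if "v \<in> F" "v' \<in> F" "v \<noteq> v'" for v v'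
      using Gcl[OF that(1)] Gcl[OF that(2)] ballsd[OF that] by blast
    \<comment> \<open>Every component of \<open>pre N\<close> maps onto N, hence contains a point
      over x and is one of the G v.\<close>
    have preN: "pre N = (\<Union>v\<in>Fx. G v)"
    proof
      show "(\<Union>v\<in>Fx. G v) \<subseteq> pre N" using GN by blast
      show "pre N \<subseteq> (\<Union>v\<in>Fx. G v)"
      proof
        fix z assume z: "z \<in> pre N"
        define Y where "Y = connected_component_set (pre N) z"
        have "Y \<in> components (pre N)" "z \<in> Y" using z by (auto simp: Y_def intro: componentsI)
        then have "f ` Y = N" "Y \<subseteq> RS" using component_pre_openin(2)[OF N(1,2)] in_components_subset pre_subset by blast+
        then obtain v where v: "v \<in> Y" "v \<in> Fx" using N(3) by (force simp: Fx_def)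
        then have "G v = Y" unfolding G_def Y_def using connected_component_eq by force
        then show "z \<in> (\<Union>v\<in>Fx. G v)" using v \<open>z \<in> Y\<close> by blast
      qed
    qed
    have preM: "pre M = (\<Union>v\<in>Fy. G v)"
    proof
      show "(\<Union>v\<in>Fy. G v) \<subseteq> pre M" using GM by blast
      show "pre M \<subseteq> (\<Union>v\<in>Fy. G v)"
      proof
        fix z assume z: "z \<in> pre M"
        define Y where "Y = connected_component_set (pre M) z"
        have "Y \<in> components (pre M)" "z \<in> Y" using z by (auto simp: Y_def intro: componentsI)
        then have "f ` Y = M" "Y \<subseteq> RS" using component_pre_openin(2)[OF M(1,2)] in_components_subset pre_subset by blast+
        then obtain v where v: "v \<in> Y" "v \<in> Fy" using M(3) by (force simp: Fy_def)
        then have "v \<notin> Fx" using Fd by blast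
        then have "G v = Y" unfolding G_def Y_def using v connected_component_eq by (force simp: Y_def)
        then show "z \<in> (\<Union>v\<in>Fy. G v)" using v \<open>z \<in> Y\<close> by blast
      qed
    qed
    define Q where "Q = pre N \<union> pre M"
    have QG: "Q = (\<Union>v\<in>F. G v)" unfolding Q_def preN preM F_def by blast
    have oQ: "RS_open Q" unfolding Q_def using openin_pre N M by blast
    define E where "E = K - (N \<union> M)"
    have E: "compact E" "E \<subseteq> RS" "pre E = ?L - Q"
      using compact_Diff_openin[OF K, of "N \<union> M"] N M K by (auto simp: E_def pre_def Q_def)
    define \<D> where "\<D> = {D \<in> components (?L - Q). D \<inter> closure (G u) \<noteq> {} \<and> (\<exists>w\<in>Fy. D \<inter> closure (G w) \<noteq> {})}"
    have "crossings K N M \<subseteq> (\<lambda>D. f ` D) ` \<D>"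
    proof
      fix C assume C: "C \<in> crossings K N M"
      then have C': "C \<in> components E" "C \<inter> closure N \<noteq> {}" "C \<inter> closure M \<noteq> {}" by (auto simp: crossings_def E_def)
      have Cc: "compact C" "connected C" "C \<subseteq> RS"
        using C'(1) E compact_components in_components_connected in_components_subset by blast+
      obtain c where c: "c \<in> C" "c \<in> closure N" using C' by blast
      have GuRS: "closure (G u) \<subseteq> RS"
        using GN(3)[OF uF] pre_subset[of N] compact_RS by (intro closure_minimal compact_imp_closed) auto
      \<comment> \<open>As G u maps onto N, the compact image of its closure contains
        \<open>closure N\<close>. The touching point of C thus has a preimage at G u itself and not
        merely at the component of another point over x.\<close>
      have "compact (f ` closure (G u))"
      proof (intro compact_continuous_image continuous_on_subset[OF cont] GuRS)
        show "compact (closure (G u))" using GuRS compact_RS by (metis closed_closure compact_Int_closed inf.absorb2)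
      qed
      moreover have "N \<subseteq> f ` closure (G u)" using GN(2)[OF uF] closure_subset by blast
      ultimately have "closure N \<subseteq> f ` closure (G u)" by (simp add: closure_minimal compact_imp_closed)
      then obtain c' where c': "c' \<in> closure (G u)" "f c' = c" using c by blast
      have c'pre: "c' \<in> pre C" using c' c GuRS by (auto simp: pre_def)
      define D where "D = connected_component_set (pre C) c'"
      have D: "D \<in> components (pre C)" "c' \<in> D" using c'pre by (auto simp: D_def intro: componentsI)
      have fD: "f ` D = C" by (rule image_component_pre_continuum[OF Cc D(1)])
      have DE: "D \<in> components (?L - Q)" using component_pre_component[OF C'(1) D(1)] E(3) by simp
      have DRS: "D \<subseteq> RS" using D(1) in_components_subset pre_subset by blast
      obtain m where "m \<in> D" "f m \<in> closure M" using C'(3) fD by blast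
      then have "m \<in> closure (pre M)" using pre_closure[OF NRS(2)] DRS by (auto simp: pre_def)
      moreover have "closure (pre M) \<subseteq> (\<Union>w\<in>Fy. closure (G w))"
        unfolding preM using fin(2) closure_subset by (intro closure_minimal closed_UN) blast+
      ultimately obtain w where "w \<in> Fy" "m \<in> closure (G w)" by blast
      then have "D \<in> \<D>" using DE D(2) c'(1) \<open>m \<in> D\<close> by (auto simp: \<D>_def)
      then show "C \<in> (\<lambda>D. f ` D) ` \<D>" using fD by blast
    qed
    moreover have "infinite (crossings K N M)" using l N M NMd unfolding linked_def by blast
    ultimately have "infinite \<D>" by (meson finite_imageI finite_subset)
    then obtain w where w: "w \<in> Fy" "infinite {D \<in> \<D>. D \<inter> closure (G w) \<noteq> {}}"
      by (rule infinite_pigeonhole[of \<D> Fy "\<lambda>D w. D \<inter> closure (G w) \<noteq> {}"]) (use fin in \<open>auto simp: \<D>_def\<close>)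
    have uwF: "u \<in> F" "w \<in> F" "u \<noteq> w" using uF w Fd by (auto simp: F_def)
    define \<B> where "\<B> = (\<Union>v\<in>F - {u, w}. {D \<in> components (?L - Q). D \<inter> closure (G u) \<noteq> {} \<and> D \<inter> closure (G w) \<noteq> {} \<and> D \<inter> closure (G v) \<noteq> {}})"
    have "finite \<B>"
      unfolding \<B>_def
    proof (intro finite_UN_I)
      show "finite (F - {u, w})" using fin by simp
      fix v assume v: "v \<in> F - {u, w}"
      show "finite {D \<in> components (?L - Q). D \<inter> closure (G u) \<noteq> {} \<and> D \<inter> closure (G w) \<noteq> {} \<and> D \<inter> closure (G v) \<noteq> {}}"
        using v uwF by (intro finite_components_touching_three[OF L oQ] Go Gc Gd) (auto simp: QG)
    qed
    then have "infinite ({D \<in> \<D>. D \<inter> closure (G w) \<noteq> {}} - \<B>)" using w(2) by (rule Diff_infinite_finite)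
    moreover have "{D \<in> \<D>. D \<inter> closure (G w) \<noteq> {}} - \<B> \<subseteq> crossings ?L (G u) (G w)"
    proof
      fix D assume "D \<in> {D \<in> \<D>. D \<inter> closure (G w) \<noteq> {}} - \<B>"
      then have D: "D \<in> components (?L - Q)" "D \<inter> closure (G u) \<noteq> {}" "D \<inter> closure (G w) \<noteq> {}" "D \<notin> \<B>"
        by (auto simp: \<D>_def)
      then have dis: "D \<inter> closure (G v) = {}" if "v \<in> F - {u, w}" for v
        using that unfolding \<B>_def by blast
      have "D \<in> components (?L - (G u \<union> G w))"
      proof (rule components_Diff_forget[OF compact_Diff_openin[OF L oQ] D(1), of _ "\<Union>v\<in>F - {u, w}. closure (G v)"])
        show "G u \<union> G w \<subseteq> Q" using uwF QG by blast
        show "Q \<subseteq> G u \<union> G w \<union> (\<Union>v\<in>F - {u, w}. closure (G v))" unfolding QG using closure_subset by fastforce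
        show "closed (\<Union>v\<in>F - {u, w}. closure (G v))" using fin by (intro closed_UN) auto
        show "D \<inter> (\<Union>v\<in>F - {u, w}. closure (G v)) = {}" using dis by blast
      qed
      then show "D \<in> crossings ?L (G u) (G w)" using D by (simp add: crossings_def)
    qed
    ultimately have "infinite (crossings ?L (G u) (G w))" using infinite_super by blast
    moreover have "G u \<subseteq> A w" "G w \<subseteq> B w" using Gball uwF r(1,2)[OF w(1)] by blast+
    ultimately show False using AB w(1) Go uwF by blast
  qed
  then show ?thesis using that by (auto simp: Fy_def)
qed

end

section \<open>Passage to the closed relation and its sections\<close>

lemma schoenflies_rel_RS:
  assumes "X \<subseteq> RS" "(x, y) \<in> schoenflies_rel X"
  shows "x \<in> RS" "y \<in> RS" "x \<noteq> y"
  using assms by (auto simp: schoenflies_rel_def)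

lemma closure_approx_sequence:
  fixes a b :: pt
  assumes "(a, b) \<in> closure R"
  obtains s t where "\<And>n. (s n, t n) \<in> R" "s \<longlonglongrightarrow> a" "t \<longlonglongrightarrow> b"
proof -
  obtain p where p: "\<And>n. p n \<in> R" "p \<longlonglongrightarrow> (a, b)" using assms closure_sequential by blast
  show ?thesis
  proof (rule that[of "\<lambda>n. fst (p n)" "\<lambda>n. snd (p n)"])
    show "(fst (p n), snd (p n)) \<in> R" for n using p(1) by simp
    show "(\<lambda>n. fst (p n)) \<longlonglongrightarrow> a" "(\<lambda>n. snd (p n)) \<longlonglongrightarrow> b"
      using tendsto_fst[OF p(2)] tendsto_snd[OF p(2)] by simp_all
  qed
qed

lemma closure_limit:
  fixes a b :: pt
  assumes "\<And>n. (s n, t n) \<in> closure R" "s \<longlonglongrightarrow> a" "t \<longlonglongrightarrow> b"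
  shows "(a, b) \<in> closure R"
proof (rule closed_sequentially[OF closed_closure])
  show "(\<lambda>n. (s n, t n)) \<longlonglongrightarrow> (a, b)" by (intro tendsto_Pair assms)
qed (rule assms)

context finite_open_map
begin

lemma tendsto_image:
  assumes "\<And>n. s n \<in> RS" "a \<in> RS" "s \<longlonglongrightarrow> a"
  shows "(\<lambda>n. f (s n)) \<longlonglongrightarrow> f a"
  using cont assms unfolding continuous_on_sequentially comp_def by blast

lemma image_schoenflies_rel:
  assumes K: "compact K" "K \<subseteq> RS" and uw: "(u, w) \<in> schoenflies_rel (pre K)"
  shows "(f u, f w) \<in> closure (schoenflies_rel K)"
proof -
  have L: "compact (pre K)" "pre K \<subseteq> RS" using compact_pre K pre_subset by blast+
  note uwRS = schoenflies_rel_RS[OF L(2) uw]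
  have l: "linked (pre K) u w" by (rule schoenflies_rel_imp_linked[OF L uw])
  have image: "(f u, f v) \<in> closure (schoenflies_rel K)" if "v \<in> RS" "linked (pre K) u v" "f u \<noteq> f v" for v
    using linked_imp_closure[OF K maps[OF uwRS(1)] maps[OF that(1)] that(3) linked_image[OF K uwRS(1) that(1,2)]] .
  show ?thesis
  proof (cases "f u = f w")
    case False
    then show ?thesis using image l uwRS by blast
  next
    case True
    define F where "F = {v \<in> RS. f v = f u} - {u}"
    have "finite F" using fib by (simp add: F_def)
    then obtain d where d: "d > 0" "\<And>v. v \<in> F \<Longrightarrow> d \<le> dist u v"
    proof -
      have "\<exists>d>0. \<forall>x\<in>F. x \<noteq> u \<longrightarrow> d \<le> dist u x" using finite_set_avoid[OF \<open>finite F\<close>] .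
      then show ?thesis using that unfolding F_def by blast
    qed
    have wF: "w \<in> F" using uwRS True by (simp add: F_def)
    \<comment> \<open>These radii tend to 0 and are smaller than d already for n = 0. A point at
      such a distance from u is neither u nor another point over f u, so its image differs from f
      u.\<close>
    have "\<exists>v. v \<in> RS \<and> dist u v = d / (real n + 2) \<and> linked (pre K) u v" for n
    proof (rule linked_nearby[OF L uwRS(1,2) _ _ l])
      show "0 < d / (real n + 2)" using d(1) by (intro divide_pos_pos) auto
      have "d / (real n + 2) < d" using d(1) by (simp add: divide_less_eq)
      then show "d / (real n + 2) < dist u w" using d(2)[OF wF] by linarith
    qed blast
    then obtain v where v: "\<And>n. v n \<in> RS" "\<And>n. dist u (v n) = d / (real n + 2)" "\<And>n. linked (pre K) u (v n)" by metis
    have "(f u, f (v n)) \<in> closure (schoenflies_rel K)" for n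
    proof (rule image[OF v(1,3)])
      have lt: "d / (real n + 2) < d" using d(1) by (simp add: divide_less_eq)
      have "v n \<noteq> u" using v(2)[of n] d(1) by auto
      moreover have "v n \<notin> F" using d(2)[of "v n"] v(2)[of n] lt by auto
      ultimately show "f u \<noteq> f (v n)" using v(1)[of n] by (auto simp: F_def)
    qed
    moreover have "(\<lambda>n. f (v n)) \<longlonglongrightarrow> f u"
    proof (rule tendsto_image[OF v(1) uwRS(1)])
      have "(\<lambda>n. d / (real n + 2)) \<longlonglongrightarrow> 0" by real_asymp
      then have "(\<lambda>n. dist (v n) u) \<longlonglongrightarrow> 0" using v(2) by (simp add: dist_commute)
      then show "v \<longlonglongrightarrow> u" using tendsto_dist_iff by blast
    qed
    ultimately have "(f u, f u) \<in> closure (schoenflies_rel K)"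
      by (rule closure_limit[of "\<lambda>_. f u" "\<lambda>n. f (v n)", OF _ tendsto_const])
    then show ?thesis using True by simp
  qed
qed

text \<open>Forward, limits of pairs are mapped by continuity. Backward, a Schoenflies pair (x', y')
  near (f u, y) is lifted with first entry near u by openness; the second entry is only known to lie
  over y', so its limit over y is found by compactness of the sphere.\<close>

lemma image_schoenflies_section:
  assumes K: "compact K" "K \<subseteq> RS" and u: "u \<in> RS" "f u \<in> K"
  shows "f ` schoenflies_section (pre K) u = schoenflies_section K (f u)"
proof
  have L: "compact (pre K)" "pre K \<subseteq> RS" using compact_pre K pre_subset by blast+
  show "f ` schoenflies_section (pre K) u \<subseteq> schoenflies_section K (f u)"
  proof (rule image_subsetI)
    fix w assume "w \<in> schoenflies_section (pre K) u"
    then have w: "w \<in> pre K" "(u, w) \<in> closure (schoenflies_rel (pre K))"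
      by (auto simp: schoenflies_section_def schoenflies_closure_def)
    obtain s t where st: "\<And>n. (s n, t n) \<in> schoenflies_rel (pre K)" "s \<longlonglongrightarrow> u" "t \<longlonglongrightarrow> w"
      using closure_approx_sequence[OF w(2)] by blast
    note R = schoenflies_rel_RS[OF L(2) st(1)]
    have "w \<in> RS" "f w \<in> K" using w(1) by (auto simp: pre_def)
    have "(f u, f w) \<in> closure (schoenflies_rel K)"
      by (rule closure_limit[OF image_schoenflies_rel[OF K st(1)] tendsto_image[OF R(1) u(1) st(2)] tendsto_image[OF R(2) \<open>w \<in> RS\<close> st(3)]])
    then show "f w \<in> schoenflies_section K (f u)"
      using u(2) \<open>f w \<in> K\<close> by (simp add: schoenflies_section_def schoenflies_closure_def)
  qed
  show "schoenflies_section K (f u) \<subseteq> f ` schoenflies_section (pre K) u"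
  proof
    fix y assume "y \<in> schoenflies_section K (f u)"
    then have y: "y \<in> K" "(f u, y) \<in> closure (schoenflies_rel K)"
      by (auto simp: schoenflies_section_def schoenflies_closure_def)
    have step: "\<exists>p. fst p \<in> ball u e \<inter> RS \<and> snd p \<in> RS \<and> dist (f (snd p)) y < e \<and> p \<in> closure (schoenflies_rel (pre K))"
      if e: "e > 0" for e
    proof -
      have "RS_open (f ` (RS \<inter> ball u e))" by (intro opn openin_open_Int) simp
      then obtain T where T: "open T" "f ` (RS \<inter> ball u e) = RS \<inter> T" by (auto simp: openin_open)
      have "f u \<in> T" using T(2) u(1) e by auto
      then obtain \<delta> where \<delta>: "\<delta> > 0" "ball (f u) \<delta> \<subseteq> T" using T(1) open_contains_ball by blast
      obtain x' y' where xy: "(x', y') \<in> schoenflies_rel K" "dist (x', y') (f u, y) < min \<delta> e"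
        using y(2) \<delta>(1) e unfolding closure_approachable by (metis min_less_iff_conj surj_pair)
      have "dist x' (f u) < \<delta>" "dist y' y < e"
        using xy(2) dist_fst_le[of "(x', y')" "(f u, y)"] dist_snd_le[of "(x', y')" "(f u, y)"] by auto
      note R = schoenflies_rel_RS[OF K(2) xy(1)]
      have "x' \<in> ball (f u) \<delta>" using \<open>dist x' (f u) < \<delta>\<close> by (simp add: dist_commute)
      then have "x' \<in> RS \<inter> T" using R(1) \<delta>(2) by blast
      then have "x' \<in> f ` (RS \<inter> ball u e)" using T(2) by simp
      then obtain u' where u': "u' \<in> RS" "dist u u' < e" "f u' = x'" by auto
      obtain w where w: "w \<in> RS" "f w = y'" "linked (pre K) u' w"
        using linked_lift[OF K u'(1,3) R(2,3) schoenflies_rel_imp_linked[OF K xy(1)]] by blast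
      have "u' \<noteq> w" using R(3) u'(3) w(2) by blast
      then have "(u', w) \<in> closure (schoenflies_rel (pre K))" by (rule linked_imp_closure[OF L u'(1) w(1) _ w(3)])
      then show ?thesis using u' w \<open>dist y' y < e\<close> by (intro exI[of _ "(u', w)"]) simp
    qed
    then have "\<exists>p. fst p \<in> ball u (inverse (real (Suc n))) \<inter> RS \<and> snd p \<in> RS \<and> dist (f (snd p)) y < inverse (real (Suc n)) \<and>
        p \<in> closure (schoenflies_rel (pre K))" for n by simp
    then obtain p where p: "\<And>n. dist (fst (p n)) u < inverse (real (Suc n))" "\<And>n. snd (p n) \<in> RS"
        "\<And>n. dist (f (snd (p n))) y < inverse (real (Suc n))" "\<And>n. p n \<in> closure (schoenflies_rel (pre K))"
      by (metis IntE dist_commute mem_ball)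
    obtain w \<sigma> where w: "w \<in> RS" "strict_mono \<sigma>" "((\<lambda>n. snd (p n)) \<circ> \<sigma>) \<longlonglongrightarrow> w"
      using compact_RS p(2) unfolding compact_def by (metis (no_types, lifting))
    have lim0: "(\<lambda>n. inverse (real (Suc n))) \<longlonglongrightarrow> 0" by (rule LIMSEQ_inverse_real_of_nat)
    have "(\<lambda>n. fst (p n)) \<longlonglongrightarrow> u"
    proof -
      have "(\<lambda>n. dist (fst (p n)) u) \<longlonglongrightarrow> 0"
        by (rule tendsto_sandwich[OF _ _ tendsto_const lim0]) (simp_all add: less_imp_le[OF p(1)] del: of_nat_Suc)
      then show ?thesis using tendsto_dist_iff by blast
    qed
    then have lu: "(\<lambda>n. fst (p (\<sigma> n))) \<longlonglongrightarrow> u" using LIMSEQ_subseq_LIMSEQ[OF _ w(2)] by (force simp: comp_def)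
    have "(\<lambda>n. f (snd (p n))) \<longlonglongrightarrow> y"
    proof -
      have "(\<lambda>n. dist (f (snd (p n))) y) \<longlonglongrightarrow> 0"
        by (rule tendsto_sandwich[OF _ _ tendsto_const lim0]) (simp_all add: less_imp_le[OF p(3)] del: of_nat_Suc)
      then show ?thesis using tendsto_dist_iff by blast
    qed
    then have ly: "(\<lambda>n. f (snd (p (\<sigma> n)))) \<longlonglongrightarrow> y" using LIMSEQ_subseq_LIMSEQ[OF _ w(2)] by (force simp: comp_def)
    have lw: "(\<lambda>n. snd (p (\<sigma> n))) \<longlonglongrightarrow> w" using w(3) by (simp add: comp_def)
    have "f w = y"
      using LIMSEQ_unique[OF tendsto_image[OF p(2) w(1) lw] ly] .
    moreover have "(u, w) \<in> closure (schoenflies_rel (pre K))"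
      by (rule closure_limit[OF _ lu lw]) (simp add: p(4))
    ultimately have "w \<in> schoenflies_section (pre K) u"
      using w(1) y(1) u by (simp add: schoenflies_section_def schoenflies_closure_def pre_def)
    then show "y \<in> f ` schoenflies_section (pre K) u" using \<open>f w = y\<close> by blast
  qed
qed

end

section \<open>Rational maps of the sphere\<close>

text \<open>The point of the sphere with homogeneous coordinates [a : b]; junk for a = b = 0.\<close>

definition sph :: "complex \<Rightarrow> complex \<Rightarrow> pt" where
  "sph a b = (of_real (2 / ((cmod a)\<^sup>2 + (cmod b)\<^sup>2)) * (a * cnj b),
     ((cmod a)\<^sup>2 - (cmod b)\<^sup>2) / ((cmod a)\<^sup>2 + (cmod b)\<^sup>2))"

lemma sph_scale:
  assumes "l \<noteq> 0"
  shows "sph (l * a) (l * b) = sph a b"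
proof -
  define L where "L = (cmod l)\<^sup>2"
  have L: "L \<noteq> 0" using assms by (simp add: L_def)
  have lc: "l * a * cnj (l * b) = of_real L * (a * cnj b)"
    unfolding L_def complex_norm_square by (simp add: mult_ac)
  have s: "(cmod (l * a))\<^sup>2 + (cmod (l * b))\<^sup>2 = L * ((cmod a)\<^sup>2 + (cmod b)\<^sup>2)"
    and d: "(cmod (l * a))\<^sup>2 - (cmod (l * b))\<^sup>2 = L * ((cmod a)\<^sup>2 - (cmod b)\<^sup>2)"
    by (simp_all add: L_def norm_mult power_mult_distrib algebra_simps)
  have "of_real (2 / (L * ((cmod a)\<^sup>2 + (cmod b)\<^sup>2))) * (of_real L * (a * cnj b)) =
     of_real (2 / ((cmod a)\<^sup>2 + (cmod b)\<^sup>2)) * (a * cnj b)"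
  proof -
    have "2 / (L * ((cmod a)\<^sup>2 + (cmod b)\<^sup>2)) * L = 2 / ((cmod a)\<^sup>2 + (cmod b)\<^sup>2)" using L by simp
    then show ?thesis by (metis mult.assoc of_real_mult)
  qed
  then show ?thesis unfolding sph_def lc s d using L by simp
qed

lemma stereo_inv_eq_sph: "stereo_inv z = sph z 1"
  by (simp add: stereo_inv_def sph_def)

lemma sph_eq_stereo_inv:
  assumes "b \<noteq> 0"
  shows "sph a b = stereo_inv (a / b)"
  using sph_scale[of "inverse b" a b] assms by (simp add: stereo_inv_eq_sph field_simps)

lemma sph_north: "a \<noteq> 0 \<Longrightarrow> sph a 0 = north"
  by (simp add: sph_def north_def)

lemma sum_norm_squares_pos: "a \<noteq> 0 \<or> b \<noteq> 0 \<Longrightarrow> 0 < (cmod a)\<^sup>2 + (cmod b)\<^sup>2"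
  by (auto simp: sum_power2_gt_zero_iff)

lemma sph_in_RS:
  assumes "a \<noteq> 0 \<or> b \<noteq> 0"
  shows "sph a b \<in> RS"
proof -
  define A B where "A = (cmod a)\<^sup>2" and "B = (cmod b)\<^sup>2"
  have pos: "A + B > 0" using sum_norm_squares_pos[OF assms] by (simp add: A_def B_def)
  have "(norm (fst (sph a b)))\<^sup>2 = 4 * A * B / (A + B)\<^sup>2"
  proof -
    have "norm (fst (sph a b)) = 2 / (A + B) * (cmod a * cmod b)"
      using pos unfolding sph_def fst_conv norm_mult norm_of_real complex_mod_cnj A_def B_def by simp
    then show ?thesis by (simp add: power_mult_distrib power_divide A_def B_def)
  qed
  moreover have "(norm (snd (sph a b)))\<^sup>2 = (A - B)\<^sup>2 / (A + B)\<^sup>2"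
    by (simp add: sph_def A_def B_def power_divide)
  moreover have "4 * A * B / (A + B)\<^sup>2 + (A - B)\<^sup>2 / (A + B)\<^sup>2 = 1"
    using pos by (simp add: add_divide_distrib[symmetric] power2_eq_square) (simp add: algebra_simps)
  ultimately show ?thesis by (simp add: RS_def norm_prod_def)
qed

lemma to_plane_stereo_inv: "to_plane (stereo_inv z) = z"
proof -
  define A where "A = (cmod z)\<^sup>2"
  have A: "A + 1 > 0" by (simp add: A_def add_nonneg_pos)
  have "1 - (A - 1) / (A + 1) = 2 / (A + 1)" using A by (simp add: field_simps)
  moreover have "complex_of_real (2 / (A + 1)) \<noteq> 0" using A by (metis divide_pos_pos less_irrefl of_real_eq_0_iff zero_less_numeral)
  ultimately show ?thesis
    unfolding to_plane_def stereo_inv_def fst_conv snd_conv A_def[symmetric] by (metis nonzero_mult_div_cancel_left)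
qed

lemma stereo_inv_neq_north: "stereo_inv z \<noteq> north"
proof
  define A where "A = (cmod z)\<^sup>2"
  have A: "A + 1 > 0" by (simp add: A_def add_nonneg_pos)
  assume "stereo_inv z = north"
  then have "(A - 1) / (A + 1) = 1" by (simp add: stereo_inv_def north_def A_def)
  then show False using A by (simp add: field_simps)
qed

lemma snd_less_one:
  assumes "P \<in> RS" "P \<noteq> north"
  shows "snd P < 1" "(cmod (fst P))\<^sup>2 = (1 - snd P) * (1 + snd P)"
proof -
  obtain x s where P: "P = (x, s)" by (cases P)
  have n: "(cmod x)\<^sup>2 + s\<^sup>2 = 1" using assms(1) by (simp add: P RS_def norm_prod_def)
  then show "(cmod (fst P))\<^sup>2 = (1 - snd P) * (1 + snd P)" by (simp add: P power2_eq_square algebra_simps)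
  have "s\<^sup>2 \<le> 1" using n zero_le_power2[of "cmod x"] by linarith
  then have "s \<le> 1" using power2_le_imp_le[of s 1] by simp
  moreover have "s \<noteq> 1" using n assms(2) by (auto simp: P north_def)
  ultimately show "snd P < 1" by (simp add: P)
qed

lemma stereo_inv_to_plane:
  assumes "P \<in> RS" "P \<noteq> north"
  shows "stereo_inv (to_plane P) = P"
proof -
  obtain x s where P: "P = (x, s)" by (cases P)
  have s: "s < 1" "(cmod x)\<^sup>2 = (1 - s) * (1 + s)" using snd_less_one[OF assms] by (simp_all add: P)
  have n: "(cmod (x / of_real (1 - s)))\<^sup>2 = (1 + s) / (1 - s)"
    using s by (simp add: norm_divide power_divide del: of_real_diff) (simp add: power2_eq_square)
  have a: "(1 + s) / (1 - s) + 1 = 2 / (1 - s)" "(1 + s) / (1 - s) - 1 = 2 * s / (1 - s)"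
    using s by (simp_all add: field_simps)
  have "complex_of_real (1 - s) \<noteq> 0" using s by (metis diff_gt_0_iff_gt less_irrefl of_real_eq_0_iff)
  then show ?thesis
    unfolding to_plane_def stereo_inv_def P fst_conv snd_conv n a using s by simp
qed

lemma homeomorphism_stereo: "homeomorphism (RS - {north}) UNIV to_plane stereo_inv"
proof (rule homeomorphismI)
  show "continuous_on (RS - {north}) to_plane"
    unfolding to_plane_def
  proof (intro continuous_intros ballI)
    fix P assume "P \<in> RS - {north}"
    then have "snd P < 1" using snd_less_one by blast
    then show "complex_of_real (1 - snd P) \<noteq> 0" by (metis diff_gt_0_iff_gt less_irrefl of_real_eq_0_iff)
  qed
  show "continuous_on UNIV stereo_inv"
    unfolding stereo_inv_def by (intro continuous_intros) (auto simp: add_nonneg_eq_0_iff)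
  show "stereo_inv ` UNIV \<subseteq> RS - {north}"
    using sph_in_RS[of _ 1] stereo_inv_neq_north stereo_inv_neq_north[symmetric] by (auto simp: stereo_inv_eq_sph[symmetric])
qed (use to_plane_stereo_inv stereo_inv_to_plane in auto)

lemma sph_eq_imp:
  assumes "sph a b = sph c d" "a \<noteq> 0 \<or> b \<noteq> 0" "c \<noteq> 0 \<or> d \<noteq> 0"
  shows "a * d = b * c"
proof (cases "b = 0 \<or> d = 0")
  case True
  then show ?thesis
    using assms sph_north sph_eq_stereo_inv stereo_inv_neq_north by (metis mult_zero_left mult_zero_right)
next
  case False
  then have "a / b = c / d" using assms(1) sph_eq_stereo_inv to_plane_stereo_inv by metis
  then show ?thesis using False by (simp add: field_simps)
qed

text \<open>On the plane this is inversion z to 1/z, the exchange of the two homogeneous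
  coordinates; hence the conjugate in the first entry.\<close>

definition swap_poles :: "pt \<Rightarrow> pt" where "swap_poles P = (cnj (fst P), - snd P)"

lemma swap_poles_sph: "swap_poles (sph a b) = sph b a"
  by (simp add: swap_poles_def sph_def add.commute mult.commute minus_divide_left)

lemma homeomorphism_swap_poles: "homeomorphism RS RS swap_poles swap_poles"
proof (rule homeomorphismI)
  show "continuous_on RS swap_poles" unfolding swap_poles_def by (intro continuous_intros)
  then show "continuous_on RS swap_poles" .
  show "swap_poles ` RS \<subseteq> RS" by (auto simp: swap_poles_def RS_def norm_prod_def)
  then show "swap_poles ` RS \<subseteq> RS" .
qed (auto simp: swap_poles_def)

lemma open_stereo_image:
  assumes "open V"
  shows "RS_open (stereo_inv ` V)" "RS_open ((\<lambda>w. sph 1 w) ` V)"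
proof -
  have "openin (top_of_set (RS - {north})) (stereo_inv ` V)"
    using homeomorphism_imp_open_map[OF homeomorphism_symD[OF homeomorphism_stereo], of V] assms by simp
  moreover have "RS_open (RS - {north})" by (simp add: openin_delete)
  ultimately show *: "RS_open (stereo_inv ` V)" using openin_trans by blast
  have "(\<lambda>w. sph 1 w) ` V = swap_poles ` stereo_inv ` V"
    by (simp add: image_image stereo_inv_eq_sph swap_poles_sph)
  then show "RS_open ((\<lambda>w. sph 1 w) ` V)"
    using homeomorphism_imp_open_map[OF homeomorphism_swap_poles *] by simp
qed

lemma continuous_on_sph:
  assumes "continuous_on S a" "continuous_on S b" "\<And>z. z \<in> S \<Longrightarrow> a z \<noteq> 0 \<or> b z \<noteq> 0"
  shows "continuous_on S (\<lambda>z. sph (a z) (b z))"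
  unfolding sph_def
proof (intro continuous_intros assms ballI)
  fix z assume "z \<in> S"
  then show "(cmod (a z))\<^sup>2 + (cmod (b z))\<^sup>2 \<noteq> 0" using sum_norm_squares_pos assms(3) by (metis less_irrefl)
  then show "(cmod (a z))\<^sup>2 + (cmod (b z))\<^sup>2 \<noteq> 0" .
qed

lemma open_map_quotient:
  assumes h: "a holomorphic_on UNIV" "b holomorphic_on UNIV"
    and fin: "\<And>c. finite {z. a z = c * b z}" and V: "open V" "\<And>z. z \<in> V \<Longrightarrow> b z \<noteq> 0"
  shows "open ((\<lambda>z. a z / b z) ` V)"
proof (rule open_mapping_thm2[of _ V])
  show "(\<lambda>z. a z / b z) holomorphic_on V"
    using h V(2) by (intro holomorphic_intros) (auto elim: holomorphic_on_subset)
  fix X assume X: "open X" "X \<subseteq> V" "X \<noteq> {}"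
  show "\<not> (\<lambda>z. a z / b z) constant_on X"
  proof
    assume "(\<lambda>z. a z / b z) constant_on X"
    then obtain c where "\<And>z. z \<in> X \<Longrightarrow> a z / b z = c" by (auto simp: constant_on_def)
    then have "a z = c * b z" if "z \<in> X" for z
      using that V(2)[of z] X(2) by (metis nonzero_eq_divide_eq subsetD)
    then have "X \<subseteq> {z. a z = c * b z}" by blast
    then have "finite X" using fin finite_subset by blast
    then show False using finite_imp_not_open X by blast
  qed
qed (use V in auto)

text \<open>Where b is nonzero the map is read in the chart a/b, and where a is nonzero in the chart
  b/a. In each the open mapping theorem applies, as \<open>fin\<close> keeps the quotient from being
  constant on a nonempty open set.\<close>

lemma open_map_sph:
  assumes h: "a holomorphic_on UNIV" "b holomorphic_on UNIV"
    and nz: "\<And>z. a z \<noteq> 0 \<or> b z \<noteq> 0"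
    and fin: "\<And>s t. s \<noteq> 0 \<or> t \<noteq> 0 \<Longrightarrow> finite {z. s * a z = t * b z}" and V: "open V"
  shows "RS_open ((\<lambda>z. sph (a z) (b z)) ` V)"
proof -
  have oA: "open {z \<in> V. a z \<noteq> 0}" and oB: "open {z \<in> V. b z \<noteq> 0}"
  proof -
    have ca: "continuous_on UNIV a" "continuous_on UNIV b" using h holomorphic_on_imp_continuous_on by blast+
    have "open {z. a z \<noteq> 0}" "open {z. b z \<noteq> 0}" using ca by (auto intro!: open_Collect_neq continuous_intros)
    then show "open {z \<in> V. a z \<noteq> 0}" "open {z \<in> V. b z \<noteq> 0}" using V by (simp_all add: open_Collect_conj Collect_conj_eq open_Int)
  qed
  have "open ((\<lambda>z. a z / b z) ` {z \<in> V. b z \<noteq> 0})"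
    using fin[of 1] oB by (intro open_map_quotient h) auto
  then have 1: "RS_open (stereo_inv ` (\<lambda>z. a z / b z) ` {z \<in> V. b z \<noteq> 0})" by (rule open_stereo_image)
  have "finite {z. b z = c * a z}" for c
  proof -
    have "{z. b z = c * a z} = {z. c * a z = 1 * b z}" by auto
    then show ?thesis using fin[of c 1] by simp
  qed
  then have "open ((\<lambda>z. b z / a z) ` {z \<in> V. a z \<noteq> 0})" using oA by (intro open_map_quotient h) auto
  then have 2: "RS_open ((\<lambda>w. sph 1 w) ` (\<lambda>z. b z / a z) ` {z \<in> V. a z \<noteq> 0})" by (rule open_stereo_image)
  have s1: "sph (a z) (b z) = sph 1 (b z / a z)" if "a z \<noteq> 0" for z
    using sph_scale[of "inverse (a z)" "a z" "b z"] that by (simp add: field_simps)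
  have "(\<lambda>z. sph (a z) (b z)) ` V = stereo_inv ` (\<lambda>z. a z / b z) ` {z \<in> V. b z \<noteq> 0} \<union> (\<lambda>w. sph 1 w) ` (\<lambda>z. b z / a z) ` {z \<in> V. a z \<noteq> 0}"
  proof -
    have "V = {z \<in> V. b z \<noteq> 0} \<union> {z \<in> V. a z \<noteq> 0}" using nz by blast
    then have "(\<lambda>z. sph (a z) (b z)) ` V = (\<lambda>z. sph (a z) (b z)) ` {z \<in> V. b z \<noteq> 0} \<union> (\<lambda>z. sph (a z) (b z)) ` {z \<in> V. a z \<noteq> 0}"
      by (metis image_Un)
    moreover have "(\<lambda>z. sph (a z) (b z)) ` {z \<in> V. b z \<noteq> 0} = (\<lambda>z. stereo_inv (a z / b z)) ` {z \<in> V. b z \<noteq> 0}"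
      by (intro image_cong) (simp_all add: sph_eq_stereo_inv)
    moreover have "(\<lambda>z. sph (a z) (b z)) ` {z \<in> V. a z \<noteq> 0} = (\<lambda>z. sph 1 (b z / a z)) ` {z \<in> V. a z \<noteq> 0}"
      by (intro image_cong) (simp_all add: s1)
    ultimately show ?thesis by (simp add: image_image)
  qed
  then show ?thesis using 1 2 by auto
qed

text \<open>The homogenisation of p in degree d, evaluated at (1, w): the chart at infinity.\<close>

definition poly_rev :: "nat \<Rightarrow> complex poly \<Rightarrow> complex \<Rightarrow> complex" where
  "poly_rev d p w = (\<Sum>i\<le>d. coeff p i * w ^ (d - i))"

lemma poly_rev_0: "poly_rev d p 0 = coeff p d"
proof -
  have "poly_rev d p 0 = (\<Sum>i\<le>d. if i = d then coeff p i else 0)"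
    unfolding poly_rev_def by (intro sum.cong) (auto simp: power_0_left)
  then show ?thesis by simp
qed

lemma poly_rev_eq:
  assumes "degree p \<le> d" "w \<noteq> 0"
  shows "poly_rev d p w = w ^ d * poly p (inverse w)"
proof -
  have "poly p (inverse w) = (\<Sum>i\<le>d. coeff p i * inverse w ^ i)" 
    unfolding poly_altdef using assms(1) by (intro sum.mono_neutral_left) (auto simp: coeff_eq_0)
  then have "w ^ d * poly p (inverse w) = (\<Sum>i\<le>d. coeff p i * (w ^ d * inverse w ^ i))"
    by (simp add: sum_distrib_left mult_ac)
  also have "\<dots> = (\<Sum>i\<le>d. coeff p i * w ^ (d - i))"
    using assms(2) by (intro sum.cong) (auto simp: power_diff field_simps)
  finally show ?thesis by (simp add: poly_rev_def)
qed

text \<open>Near infinity f is read in the coordinate w = 1/z through the homogenisations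
  \<open>poly_rev d p\<close> and \<open>poly_rev d q\<close>. The parametrisations
  \<open>stereo_inv\<close> and \<open>sph 1\<close> together cover the sphere, and in both f takes
  the form \<open>sph (a z) (b z)\<close> with a and b entire and without common zero.\<close>

lemma finite_open_map_rational:
  assumes "rational_of_degree f d" "d \<ge> 1"
  shows "finite_open_map f"
proof -
  obtain p q where q: "q \<noteq> 0" and cop: "coprime p q" and d: "max (degree p) (degree q) = d"
    and f: "\<And>P. P \<in> RS \<Longrightarrow> f P = rat_sphere p q P"
    using assms(1) unfolding rational_of_degree_def by blast
  have deg: "degree p \<le> d" "degree q \<le> d" using d by auto
  have nz: "poly p z \<noteq> 0 \<or> poly q z \<noteq> 0" for z using coprime_poly_0[OF cop] by blast
  \<comment> \<open>A vanishing combination would make p a multiple of q; coprimality then turns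
    both into constants, against d \<ge> 1.\<close>
  have comb: "smult s p - smult t q \<noteq> 0" if st: "s \<noteq> 0 \<or> t \<noteq> 0" for s t
  proof
    assume e: "smult s p - smult t q = 0"
    have "s \<noteq> 0"
    proof
      assume "s = 0"
      then show False using e st q by simp
    qed
    have "smult (inverse s) (smult s p) = smult (inverse s) (smult t q)" using e by simp
    then have "p = smult (t / s) q" using \<open>s \<noteq> 0\<close> by (simp add: divide_inverse mult.commute)
    then have "q dvd p" by (metis dvd_smult dvd_refl)
    then have "is_unit q" using cop by (meson coprime_common_divisor dvd_refl)
    then have "degree q = 0" by (simp add: is_unit_iff_degree q)
    moreover have "degree p = 0" using \<open>p = smult (t / s) q\<close> \<open>degree q = 0\<close> by (metis degree_smult_le le_zero_eq)
    ultimately show False using d assms(2) by simp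
  qed
  have fin: "finite {z. s * poly p z = t * poly q z}" if "s \<noteq> 0 \<or> t \<noteq> 0" for s t
    using poly_roots_finite[OF comb[OF that]] by simp
  have nz': "poly_rev d p w \<noteq> 0 \<or> poly_rev d q w \<noteq> 0" for w
  proof (cases "w = 0")
    case True
    \<comment> \<open>As d is the larger of the two degrees, the homogenisations do not vanish
      together at infinity.\<close>
    have "coeff p d \<noteq> 0 \<or> coeff q d \<noteq> 0"
    proof (cases "degree q < degree p")
      case True
      then have "d = degree p" "p \<noteq> 0" using d by auto
      then show ?thesis by (simp add: leading_coeff_neq_0)
    next
      case False
      then show ?thesis using d q by (simp add: max_def leading_coeff_neq_0 split: if_splits) force
    qed
    then show ?thesis using True by (simp add: poly_rev_0)
  next
    case False
    then show ?thesis using nz[of "inverse w"] deg by (simp add: poly_rev_eq)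
  qed
  have fin': "finite {w. s * poly_rev d p w = t * poly_rev d q w}" if "s \<noteq> 0 \<or> t \<noteq> 0" for s t
  proof (rule finite_subset)
    show "finite (insert 0 (inverse ` {z. s * poly p z = t * poly q z}))" using fin[OF that] by simp
    show "{w. s * poly_rev d p w = t * poly_rev d q w} \<subseteq> insert 0 (inverse ` {z. s * poly p z = t * poly q z})"
    proof
      fix w assume w: "w \<in> {w. s * poly_rev d p w = t * poly_rev d q w}"
      show "w \<in> insert 0 (inverse ` {z. s * poly p z = t * poly q z})"
      proof (cases "w = 0")
        case False
        then have "w ^ d * (s * poly p (inverse w)) = w ^ d * (t * poly q (inverse w))"
          using w deg by (simp add: poly_rev_eq mult_ac)
        then have "inverse w \<in> {z. s * poly p z = t * poly q z}" using False by simp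
        then show ?thesis by (metis imageI insertI2 inverse_inverse_eq)
      qed simp
    qed
  qed
  have f1: "f (stereo_inv z) = sph (poly p z) (poly q z)" for z
  proof -
    have "f (stereo_inv z) = rat_sphere p q (stereo_inv z)"
      using f sph_in_RS[of z 1] by (simp add: stereo_inv_eq_sph)
    then show ?thesis
      using nz[of z] by (auto simp: rat_sphere_def stereo_inv_neq_north to_plane_stereo_inv sph_north sph_eq_stereo_inv)
  qed
  \<comment> \<open>At w = 0 this reproduces the case distinction of \<open>rat_sphere\<close>: if q
    has smaller degree than p, its coefficient at d is 0 and the value is \<open>north\<close>;
    otherwise d is the degree of q, and the quotient of the coefficients at d is the value at
    infinity.\<close>
  have f2: "f (sph 1 w) = sph (poly_rev d p w) (poly_rev d q w)" for w
  proof (cases "w = 0")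
    case True
    have "f north = rat_sphere p q north" using f sph_in_RS[of 1 0] by (simp add: sph_north)
    also have "\<dots> = sph (coeff p d) (coeff q d)"
    proof (cases "degree q < degree p")
      case True
      then have "d = degree p" "p \<noteq> 0" using d by auto
      then show ?thesis using True by (simp add: rat_sphere_def sph_north coeff_eq_0 leading_coeff_neq_0)
    next
      case False
      then have "d = degree q" using d by simp
      then show ?thesis using False q by (simp add: rat_sphere_def sph_eq_stereo_inv leading_coeff_neq_0)
    qed
    finally show ?thesis using True by (simp add: sph_north poly_rev_0)
  next
    case False
    then have "sph 1 w = stereo_inv (inverse w)" by (simp add: sph_eq_stereo_inv inverse_eq_divide)
    then show ?thesis using False deg sph_scale[of "w ^ d"] by (simp add: f1 poly_rev_eq)
  qed
  have hp: "poly r holomorphic_on UNIV" and hr: "poly_rev d r holomorphic_on UNIV" for r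
    unfolding poly_rev_def by (intro holomorphic_intros)+
  define south where "south = swap_poles north"
  have cover: "RS = (RS - {north}) \<union> (RS - {south})" by (auto simp: south_def swap_poles_def north_def)
  have swap_inv: "swap_poles (swap_poles P) = P" for P by (simp add: swap_poles_def)
  have swRS: "swap_poles P \<in> RS" if "P \<in> RS" for P using homeomorphism_swap_poles that by (auto simp: homeomorphism_def)
  have chart2: "P = sph 1 (to_plane (swap_poles P))" if P: "P \<in> RS" "P \<noteq> south" for P
  proof -
    have "swap_poles P \<noteq> north" using P(2) swap_inv unfolding south_def by metis
    then have "stereo_inv (to_plane (swap_poles P)) = swap_poles P" using swRS P(1) stereo_inv_to_plane by blast
    then show ?thesis by (metis stereo_inv_eq_sph swap_inv swap_poles_sph)
  qed
  have ct: "continuous_on (RS - {north}) to_plane" using homeomorphism_stereo by (simp add: homeomorphism_def)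
  have csw: "continuous_on S swap_poles" for S unfolding swap_poles_def by (intro continuous_intros)
  show ?thesis
  proof
    show "continuous_on RS f"
    proof (subst cover, rule continuous_on_Un_local_open)
      show "openin (top_of_set (RS - {north} \<union> (RS - {south}))) (RS - {north})"
           "openin (top_of_set (RS - {north} \<union> (RS - {south}))) (RS - {south})"
        unfolding cover[symmetric] by (simp_all add: openin_delete)
      have "continuous_on (RS - {north}) (\<lambda>P. sph (poly p (to_plane P)) (poly q (to_plane P)))"
        using nz ct by (intro continuous_on_sph continuous_intros) auto
      then show "continuous_on (RS - {north}) f"
        using f1 stereo_inv_to_plane by (auto elim!: continuous_on_eq) (metis)
      have sw: "continuous_on (RS - {south}) (\<lambda>P. to_plane (swap_poles P))"
      proof (rule continuous_on_compose2[OF ct csw])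
        show "swap_poles ` (RS - {south}) \<subseteq> RS - {north}"
        proof (rule image_subsetI)
          fix P assume "P \<in> RS - {south}"
          then have "P \<in> RS" "P \<noteq> south" by blast+
          moreover from this have "swap_poles P \<noteq> north" unfolding south_def using swap_inv by metis
          ultimately show "swap_poles P \<in> RS - {north}" using swRS by blast
        qed
      qed
      have "continuous_on (RS - {south}) (\<lambda>P. sph (poly_rev d p (to_plane (swap_poles P))) (poly_rev d q (to_plane (swap_poles P))))"
      proof (rule continuous_on_sph)
        show "continuous_on (RS - {south}) (\<lambda>P. poly_rev d r (to_plane (swap_poles P)))" for r
          unfolding poly_rev_def using sw by (intro continuous_intros)
        then show "continuous_on (RS - {south}) (\<lambda>P. poly_rev d q (to_plane (swap_poles P)))" .
      qed (rule nz')
      then show "continuous_on (RS - {south}) f"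
      proof (rule continuous_on_eq)
        fix P assume "P \<in> RS - {south}"
        then have "P = sph 1 (to_plane (swap_poles P))" using chart2 by blast
        then show "sph (poly_rev d p (to_plane (swap_poles P))) (poly_rev d q (to_plane (swap_poles P))) = f P"
          using f2 by metis
      qed
    qed
    show "f v \<in> RS" if "v \<in> RS" for v
    proof (cases "v = north")
      case True
      then show ?thesis using f2[of 0] sph_in_RS nz' by (simp add: sph_north)
    next
      case False
      then show ?thesis using f1[of "to_plane v"] stereo_inv_to_plane that sph_in_RS nz by metis
    qed
    show "RS_open (f ` V)" if V: "RS_open V" for V
    proof -
      obtain T where T: "open T" "V = RS \<inter> T" using V by (auto simp: openin_open)
      have st: "stereo_inv z \<in> RS" "sph 1 z \<in> RS" for z using sph_in_RS by (auto simp: stereo_inv_eq_sph)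
      have "continuous_on UNIV stereo_inv" using homeomorphism_stereo by (simp add: homeomorphism_def)
      then have o1: "open (stereo_inv -` T)" using T(1) by (simp add: open_vimage continuous_on_eq_continuous_at)
      have "continuous_on UNIV (\<lambda>w. sph 1 w)" by (intro continuous_on_sph continuous_intros) auto
      then have o2: "open ((\<lambda>w. sph 1 w) -` T)" using T(1) by (simp add: open_vimage continuous_on_eq_continuous_at)
      have "V = stereo_inv ` (stereo_inv -` T) \<union> (\<lambda>w. sph 1 w) ` ((\<lambda>w. sph 1 w) -` T)"
      proof
        show "stereo_inv ` (stereo_inv -` T) \<union> (\<lambda>w. sph 1 w) ` ((\<lambda>w. sph 1 w) -` T) \<subseteq> V" using T(2) st by auto
        show "V \<subseteq> stereo_inv ` (stereo_inv -` T) \<union> (\<lambda>w. sph 1 w) ` ((\<lambda>w. sph 1 w) -` T)"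
        proof
          fix P assume P: "P \<in> V"
          show "P \<in> stereo_inv ` (stereo_inv -` T) \<union> (\<lambda>w. sph 1 w) ` ((\<lambda>w. sph 1 w) -` T)"
          proof (cases "P = north")
            case True
            then have "P = sph 1 0" by (simp add: sph_north)
            then show ?thesis using P T(2) by blast
          next
            case False
            then have "P = stereo_inv (to_plane P)" using P T(2) stereo_inv_to_plane by auto
            moreover from this have "to_plane P \<in> stereo_inv -` T" using P T(2) by simp
            ultimately show ?thesis by (intro UnI1 image_eqI[of P stereo_inv "to_plane P"])
          qed
        qed
      qed
      then have "f ` V = (\<lambda>z. sph (poly p z) (poly q z)) ` (stereo_inv -` T) \<union>
          (\<lambda>w. sph (poly_rev d p w) (poly_rev d q w)) ` ((\<lambda>w. sph 1 w) -` T)"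
        by (simp only: image_Un image_image f1 f2)
      moreover have "RS_open ((\<lambda>z. sph (poly p z) (poly q z)) ` (stereo_inv -` T))"
        by (rule open_map_sph[OF hp hp nz fin o1])
      moreover have "RS_open ((\<lambda>w. sph (poly_rev d p w) (poly_rev d q w)) ` ((\<lambda>w. sph 1 w) -` T))"
        by (rule open_map_sph[OF hr hr nz' fin' o2])
      ultimately show ?thesis by auto
    qed
    show "finite {v \<in> RS. f v = y}" for y
    proof (rule finite_subset)
      show "{v \<in> RS. f v = y} \<subseteq> insert north (stereo_inv ` {z. sph (poly p z) (poly q z) = y})"
      proof
        fix v assume v: "v \<in> {v \<in> RS. f v = y}"
        show "v \<in> insert north (stereo_inv ` {z. sph (poly p z) (poly q z) = y})"
        proof (cases "v = north")
          case False
          then have eq: "stereo_inv (to_plane v) = v" using stereo_inv_to_plane v by blast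
          then have "to_plane v \<in> {z. sph (poly p z) (poly q z) = y}" using f1[of "to_plane v"] v by simp
          then show ?thesis by (intro insertI2 image_eqI[of v stereo_inv "to_plane v"] eq[symmetric])
        qed simp
      qed
      have "finite {z. sph (poly p z) (poly q z) = y}"
      proof (cases "\<exists>z0. sph (poly p z0) (poly q z0) = y")
        case True
        then obtain z0 where z0: "sph (poly p z0) (poly q z0) = y" by blast
        \<comment> \<open>Equal values mean proportional coordinate pairs, so the finite part of a
          fibre lies in the zero set of one nontrivial combination of p and q.\<close>
        have "{z. sph (poly p z) (poly q z) = y} \<subseteq> {z. poly q z0 * poly p z = poly p z0 * poly q z}"
          using sph_eq_imp[OF _ nz nz, of _ z0] z0 by (auto simp: mult.commute)
        then show ?thesis using fin[of "poly q z0" "poly p z0"] nz[of z0] finite_subset by blast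
      qed simp
      then show "finite (insert north (stereo_inv ` {z. sph (poly p z) (poly q z) = y}))" by simp
    qed
  qed
qed

theorem theorem5:
  fixes K :: "pt set" and f :: "pt \<Rightarrow> pt" and d :: nat and u x :: pt
  assumes "compact K" and "K \<subseteq> RS"
    and "rational_of_degree f d" and "d \<ge> 2"
    and "u \<in> {v \<in> RS. f v \<in> K}" and "x \<in> K" and "f u = x"
  shows "f ` schoenflies_section {v \<in> RS. f v \<in> K} u = schoenflies_section K x"
proof -
  interpret finite_open_map f
    by (rule finite_open_map_rational[OF assms(3)]) (use assms(4) in linarith)
  show ?thesis
    using image_schoenflies_section[OF assms(1,2), of u] assms(5-7) by (simp add: pre_def)
qed

end
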